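(* Let $\boldsymbol x\in\mathbb R^n\setminus\{\boldsymbol 0\}$, $\boldsymbol g\in\mathcal G_\rho$, $\boldsymbol y_l=\mathrm{diag}(\boldsymbol g)\boldsymbol A_l\boldsymbol x$ ($l\in[p]$). Given $\delta\in(0,1)$ and $t\ge1$, assume $n\gtrsim t\log(mp)$, $mp\gtrsim t\delta^{-2}(n+m)\log^2(m(p+n))\log\frac1\delta$ and $\rho<\frac{1-4\delta}{31}$, and set $\eta=1-4\delta-31\rho\in(0,1)$. There is a universal constant $c>0$ such that, with $\mu_0=c\,\eta/m$, for any $0<\mu<\mu_0$ and with probability exceeding $1-C(mp)^{-t}$ for some $C>0$, the iterates of the projected gradient descent $$\boldsymbol\xi_0=\tfrac1{mp}\textstyle\sum_{l}\boldsymbol A_l^\top\boldsymbol y_l,\ \boldsymbol\gamma_0=\boldsymbol 1_m,\qquad \boldsymbol\xi_{j+1}=\boldsymbol\xi_j-\mu\nabla_{\boldsymbol\xi}f(\boldsymbol\xi_j,\boldsymbol\gamma_j),\quad \boldsymbol\gamma_{j+1}=\mathcal P_{\mathcal G_\rho}\Big(\boldsymbol\gamma_j-\mu\tfrac{m}{\|\boldsymbol x\|^2}\nabla^\perp_{\boldsymbol\gamma}f(\boldsymbol\xi_j,\boldsymbol\gamma_j)\Big)$$ satisfy, for all $j\ge0$, $$\Delta(\boldsymbol\xi_j,\boldsymbol\gamma_j)\le(1-\eta\mu)^j(\delta^2+\rho^2)\|\boldsymbol x\|^2 .$$ In particular $\Delta(\boldsymbol\xi_j,\boldsymbol\gamma_j)\to0$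 as $j\to\infty$.
   Context: Random model: $X$ centred with $\mathbb EX^2=1$ and sub-Gaussian norm $\alpha=\|X\|_{\psi_2}<\infty$; $\boldsymbol a\in\mathbb R^n$ with i.i.d. entries $\sim X$; $\boldsymbol a_{i,l}$ ($i\in[m],l\in[p]$) i.i.d. copies; $\boldsymbol A_l$ has rows $\boldsymbol a_{i,l}^\top$. Bernoulli restriction: if $\mathbb EX^4=1$ then $n>1$ and $\|\boldsymbol x/\|\boldsymbol x\|\|_4^4\le1-c_0/n$ for a fixed $c_0>0$. $\gtrsim$ hides large constants depending only on $\alpha$ (and $c_0$). $\boldsymbol c_i$: canonical basis of $\mathbb R^m$; $\boldsymbol 1_m^\perp=\{\boldsymbol v:\boldsymbol 1_m^\top\boldsymbol v=0\}$, $\boldsymbol P=\boldsymbol I_m-\frac1m\boldsymbol 1_m\boldsymbol 1_m^\top$; $\mathcal G_\rho=\{\boldsymbol 1_m+\boldsymbol e:\boldsymbol e\in\boldsymbol 1_m^\perp,\|\boldsymbol e\|_\infty\le\rho\}$ (closed convex) and $\mathcal P_{\mathcal G_\rho}$ is the Euclidean projection onto it. $f(\boldsymbol\xi,\boldsymbol\gamma)=\frac1{2mp}\sum_l\|\mathrm{diag}(\boldsymbol\gamma)\boldsymbol A_l\boldsymbol\xi-\boldsymbol y_l\|^2$; $\nabla_{\boldsymbol\xi}f=\frac1{mp}\sum_{i,l}\gamma_i\boldsymbol a_{i,l}(\gamma_i\boldsymbol a_{i,l}^\top\boldsymbol\xi-g_i\boldsymbol a_{i,l}^\top\boldsymbol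 x)$; $\nabla^\perp_{\boldsymbol\gamma}f=\boldsymbol P\frac1{mp}\sum_{i,l}(\boldsymbol a_{i,l}^\top\boldsymbol\xi)(\gamma_i\boldsymbol a_{i,l}^\top\boldsymbol\xi-g_i\boldsymbol a_{i,l}^\top\boldsymbol x)\boldsymbol c_i$. $\Delta(\boldsymbol\xi,\boldsymbol\gamma)=\|\boldsymbol\xi-\boldsymbol x\|^2+\frac{\|\boldsymbol x\|^2}m\|\boldsymbol\gamma-\boldsymbol g\|^2$. *)

theory Defs
  imports "HOL-Probability.Probability"
begin

text \<open>Vectors in R^n (n varying) are functions nat => real; only indices below the
dimension are meaningful. The random sample is omega :: nat * nat * nat => real, where
omega (i,l,k) is the k-th entry of the sensing vector a_{i,l}.\<close>

definition inner_n :: "nat \<Rightarrow> (nat \<Rightarrow> real) \<Rightarrow> (nat \<Rightarrow> real) \<Rightarrow> real" where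
  "inner_n n u v = (\<Sum>k<n. u k * v k)"

definition sqnorm_n :: "nat \<Rightarrow> (nat \<Rightarrow> real) \<Rightarrow> real" where
  "sqnorm_n n u = (\<Sum>k<n. (u k)\<^sup>2)"

definition avec :: "(nat \<times> nat \<times> nat \<Rightarrow> real) \<Rightarrow> nat \<Rightarrow> nat \<Rightarrow> nat \<Rightarrow> real" where
  "avec \<omega> i l = (\<lambda>k. \<omega> (i, l, k))"

definition psi2_set :: "real measure \<Rightarrow> real set" where
  "psi2_set D = {K. K > 0 \<and> integrable D (\<lambda>u. exp (u\<^sup>2 / K\<^sup>2)) \<and>
                   (\<integral>u. exp (u\<^sup>2 / K\<^sup>2) \<partial>D) \<le> 2}"

definition psi2_norm :: "real measure \<Rightarrow> real" where
  "psi2_norm D = Inf (psi2_set D)"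

definition G_set :: "nat \<Rightarrow> real \<Rightarrow> (nat \<Rightarrow> real) set" where
  "G_set m \<rho> = {\<gamma>. (\<forall>i\<ge>m. \<gamma> i = 0) \<and> (\<Sum>i<m. \<gamma> i - 1) = 0 \<and> (\<forall>i<m. \<bar>\<gamma> i - 1\<bar> \<le> \<rho>)}"

definition proj_G :: "nat \<Rightarrow> real \<Rightarrow> (nat \<Rightarrow> real) \<Rightarrow> (nat \<Rightarrow> real)" where
  "proj_G m \<rho> v = (THE \<gamma>. \<gamma> \<in> G_set m \<rho> \<and>
      (\<forall>\<gamma>'\<in>G_set m \<rho>. (\<Sum>i<m. (v i - \<gamma> i)\<^sup>2) \<le> (\<Sum>i<m. (v i - \<gamma>' i)\<^sup>2)))"

definition meas_y :: "nat \<Rightarrow> (nat \<times> nat \<times> nat \<Rightarrow> real) \<Rightarrow> (nat \<Rightarrow> real) \<Rightarrow> (nat \<Rightarrow> real)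
                      \<Rightarrow> nat \<Rightarrow> nat \<Rightarrow> real" where
  "meas_y n \<omega> g x l i = g i * inner_n n (avec \<omega> i l) x"

definition grad_xi :: "nat \<Rightarrow> nat \<Rightarrow> nat \<Rightarrow> (nat \<times> nat \<times> nat \<Rightarrow> real) \<Rightarrow> (nat \<Rightarrow> nat \<Rightarrow> real)
    \<Rightarrow> (nat \<Rightarrow> real) \<Rightarrow> (nat \<Rightarrow> real) \<Rightarrow> (nat \<Rightarrow> real)" where
  "grad_xi n m p \<omega> y \<xi> \<gamma> = (\<lambda>k. if k < n then
     (1 / (real m * real p)) * (\<Sum>i<m. \<Sum>l<p.
        \<gamma> i * avec \<omega> i l k * (\<gamma> i * inner_n n (avec \<omega> i l) \<xi> - y l i)) else 0)"

definition center_m :: "nat \<Rightarrow> (nat \<Rightarrow> real) \<Rightarrow> (nat \<Rightarrow> real)" where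
  "center_m m w = (\<lambda>i. if i < m then w i - (\<Sum>j<m. w j) / real m else 0)"

definition grad_gamma_perp :: "nat \<Rightarrow> nat \<Rightarrow> nat \<Rightarrow> (nat \<times> nat \<times> nat \<Rightarrow> real) \<Rightarrow> (nat \<Rightarrow> nat \<Rightarrow> real)
    \<Rightarrow> (nat \<Rightarrow> real) \<Rightarrow> (nat \<Rightarrow> real) \<Rightarrow> (nat \<Rightarrow> real)" where
  "grad_gamma_perp n m p \<omega> y \<xi> \<gamma> = center_m m (\<lambda>i.
     (1 / (real m * real p)) * (\<Sum>l<p.
        inner_n n (avec \<omega> i l) \<xi> * (\<gamma> i * inner_n n (avec \<omega> i l) \<xi> - y l i)))"

definition pgd_init :: "nat \<Rightarrow> nat \<Rightarrow> nat \<Rightarrow> (nat \<times> nat \<times> nat \<Rightarrow> real) \<Rightarrow> (nat \<Rightarrow> nat \<Rightarrow> real)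
    \<Rightarrow> (nat \<Rightarrow> real) \<times> (nat \<Rightarrow> real)" where
  "pgd_init n m p \<omega> y =
     ((\<lambda>k. if k < n then (1 / (real m * real p)) * (\<Sum>l<p. \<Sum>i<m. avec \<omega> i l k * y l i) else 0),
      (\<lambda>i. if i < m then 1 else 0))"

definition pgd_step :: "nat \<Rightarrow> nat \<Rightarrow> nat \<Rightarrow> (nat \<times> nat \<times> nat \<Rightarrow> real) \<Rightarrow> (nat \<Rightarrow> nat \<Rightarrow> real)
    \<Rightarrow> (nat \<Rightarrow> real) \<Rightarrow> real \<Rightarrow> real
    \<Rightarrow> (nat \<Rightarrow> real) \<times> (nat \<Rightarrow> real) \<Rightarrow> (nat \<Rightarrow> real) \<times> (nat \<Rightarrow> real)" where
  "pgd_step n m p \<omega> y x \<rho> \<mu> s =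
     (let \<xi> = fst s; \<gamma> = snd s in
      ((\<lambda>k. \<xi> k - \<mu> * grad_xi n m p \<omega> y \<xi> \<gamma> k),
       proj_G m \<rho> (\<lambda>i. \<gamma> i - \<mu> * (real m / sqnorm_n n x) * grad_gamma_perp n m p \<omega> y \<xi> \<gamma> i)))"

definition pgd :: "nat \<Rightarrow> nat \<Rightarrow> nat \<Rightarrow> (nat \<times> nat \<times> nat \<Rightarrow> real) \<Rightarrow> (nat \<Rightarrow> real) \<Rightarrow> (nat \<Rightarrow> real)
    \<Rightarrow> real \<Rightarrow> real \<Rightarrow> nat \<Rightarrow> (nat \<Rightarrow> real) \<times> (nat \<Rightarrow> real)" where
  "pgd n m p \<omega> g x \<rho> \<mu> j =
     (pgd_step n m p \<omega> (meas_y n \<omega> g x) x \<rho> \<mu> ^^ j) (pgd_init n m p \<omega> (meas_y n \<omega> g x))"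

definition Delta :: "nat \<Rightarrow> nat \<Rightarrow> (nat \<Rightarrow> real) \<Rightarrow> (nat \<Rightarrow> real) \<Rightarrow> (nat \<Rightarrow> real) \<times> (nat \<Rightarrow> real) \<Rightarrow> real" where
  "Delta n m x g s = (\<Sum>k<n. (fst s k - x k)\<^sup>2) + sqnorm_n n x / real m * (\<Sum>i<m. (snd s i - g i)\<^sup>2)"

definition sample_space :: "real measure \<Rightarrow> nat \<Rightarrow> nat \<Rightarrow> nat \<Rightarrow> (nat \<times> nat \<times> nat \<Rightarrow> real) measure" where
  "sample_space D n m p = PiM ({..<m} \<times> {..<p} \<times> {..<n}) (\<lambda>_. D)"

end

theory Submission
  imports Defs
begin

text \<open>On a good event the descent is deterministic. With \<open>h = \<xi> - x\<close>, \<open>e = \<gamma> - g\<close> and residuals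
\<open>r = \<gamma> (a \<bullet> h) + e (a \<bullet> x)\<close>, the gradient paired with the error is the average of
\<open>r\<^sup>2 + e (a \<bullet> h) r\<close>. Since \<open>\<bar>\<gamma> - 1\<bar> \<le> \<rho>\<close>, \<open>\<bar>e\<bar> \<le> 2 \<rho>\<close> and the entries of \<open>e\<close> sum to zero, it is at least
\<open>(97/100 - 7 \<rho>) \<Delta>\<close> as soon as the sample covariance, the energy of each block along \<open>x\<close> and the
bilinear form in \<open>(e, h)\<close> concentrate up to small constants, while the squared gradients are at most
\<open>O(m) \<Delta>\<close>. A step of size \<open>O(1/m)\<close> then contracts \<open>\<Delta>\<close>, and the projection does not increase
the distance to \<open>g\<close>.

The good event is established by Chernoff bounds at the points of a grid in the unit balls. The
bilinear form in \<open>(e, h)\<close> involves products of two subgaussian variables with possibly very uneven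
weights \<open>e\<close>; truncating \<open>a \<bullet> x\<close> at \<open>sqrt (t log (mp))\<close> makes the products subgaussian at the price
of the logarithmic factors.\<close>

section \<open>Projection onto the gain constraints\<close>

text \<open>\<open>measure\<close> is 0 on sets that are not measurable, so the probability bound
  also needs the iterates to be measurable in the sample. \<open>proj_G\<close> is only a
  \<open>THE\<close> term; an explicit formula, clipping after a common shift, replaces it.
  Truncation is forced by the scale of the grid argument. For a unit vector \<open>e\<close> the
  coupling form must stay below a small multiple of p sqrt(m) \<delta> at about exp(C (m + n)) grid
  points. A Bernstein bound has a second regime with exponent of order p sqrt(m) \<delta> / max |e
  i|, which the sample size does not keep above m + n when \<open>e\<close> sits on one index. A
  subgaussian bound sees only the Euclidean norm of \<open>e\<close>. The condition n >= t log(mp)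
  lets the failure exponent t log(mp) be absorbed in the dimension count. The rate has slack: the
  curvature enters a step twice, giving 1.94 - 14 \<rho> against the claimed 1 - 4 \<delta> - 31
  \<rho>. The difference pays for the squared gradients when 25 m \<mu> <= 1.\<close>

definition clip :: "real \<Rightarrow> real \<Rightarrow> real" where
  "clip \<rho> s = max (- \<rho>) (min \<rho> s)"

text \<open>By the optimality conditions the projection is 1 + clip (v - 1 - s), with
  \<open>s\<close> the multiplier of the sum constraint. The equation for \<open>s\<close> is that
  this sum vanishes.\<close>

definition clip_sum :: "nat \<Rightarrow> real \<Rightarrow> (nat \<Rightarrow> real) \<Rightarrow> real \<Rightarrow> real" where
  "clip_sum m \<rho> v s = (\<Sum>i<m. clip \<rho> (v i - 1 - s))"

text \<open>A root need not be unique, since the sum can be flat at 0. The infimum selects one whose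
  sublevel sets are those of \<open>clip_sum\<close>, which is what measurability requires.\<close>

definition clip_shift :: "nat \<Rightarrow> real \<Rightarrow> (nat \<Rightarrow> real) \<Rightarrow> real" where
  "clip_shift m \<rho> v = Inf {s. clip_sum m \<rho> v s \<le> 0}"

lemma abs_clip_le: "0 \<le> \<rho> \<Longrightarrow> \<bar>clip \<rho> s\<bar> \<le> \<rho>"
  by (auto simp: clip_def max_def min_def)

text \<open>\<open>clip \<rho>\<close> is the nearest point of an interval; this is the obtuse angle
  inequality in dimension one.\<close>

lemma clip_variational:
  assumes "\<bar>b\<bar> \<le> \<rho>"
  shows "(s - clip \<rho> s) * (b - clip \<rho> s) \<le> 0"
proof -
  consider "s < - \<rho>" | "\<bar>s\<bar> \<le> \<rho>" | "s > \<rho>" by linarith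
  then show ?thesis
    using assms by cases (auto simp: clip_def max_def min_def mult_le_0_iff abs_le_iff)
qed

lemma antimono_clip_sum: "s \<le> s' \<Longrightarrow> clip_sum m \<rho> v s' \<le> clip_sum m \<rho> v s"
  unfolding clip_sum_def by (rule sum_mono) (auto simp: clip_def max_def min_def)

lemma continuous_on_clip_sum: "continuous_on A (clip_sum m \<rho> v)"
  unfolding clip_sum_def clip_def by (intro continuous_intros)

text \<open>At shift -B or B every coordinate is saturated at the same end, which brackets the root
  for the intermediate value theorem.\<close>

lemma clip_sum_extremes:
  assumes "0 \<le> \<rho>" and B: "B = \<rho> + (\<Sum>i<m. \<bar>v i - 1\<bar>)"
  shows "clip_sum m \<rho> v (- B) = m * \<rho>" "clip_sum m \<rho> v B = - (m * \<rho>)"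
proof -
  have "\<bar>v i - 1\<bar> \<le> B - \<rho>" if "i < m" for i
    unfolding B using that member_le_sum[of i "{..<m}" "\<lambda>i. \<bar>v i - 1\<bar>"] by simp
  then have "clip \<rho> (v i - 1 - (- B)) = \<rho>" "clip \<rho> (v i - 1 - B) = - \<rho>" if "i < m" for i
    using that[THEN \<open>\<And>i. i < m \<Longrightarrow> \<bar>v i - 1\<bar> \<le> B - \<rho>\<close>] assms(1)
    by (auto simp: clip_def max_def min_def abs_le_iff)
  then show "clip_sum m \<rho> v (- B) = m * \<rho>" "clip_sum m \<rho> v B = - (m * \<rho>)"
    by (simp_all add: clip_sum_def)
qed

lemma clip_sum_root:
  assumes "0 \<le> \<rho>"
  obtains s where "clip_sum m \<rho> v s = 0"
proof -
  define B where "B = \<rho> + (\<Sum>i<m. \<bar>v i - 1\<bar>)"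
  have "- B \<le> B" using assms by (simp add: B_def sum_nonneg)
  then have "\<exists>s. - B \<le> s \<and> s \<le> B \<and> clip_sum m \<rho> v s = 0"
    using assms by (intro IVT2') (auto simp: clip_sum_extremes[OF assms B_def] continuous_on_clip_sum)
  then show thesis using that by blast
qed

text \<open>Continuity and monotonicity make the set under the infimum a closed ray. It is bounded
  below because \<open>clip_sum\<close> is m \<rho> > 0 at -B; for \<rho> = 0 or m = 0 it would be
  the whole line.\<close>

lemma clip_shift_le_iff:
  assumes "0 < \<rho>" "0 < m"
  shows "clip_shift m \<rho> v \<le> c \<longleftrightarrow> clip_sum m \<rho> v c \<le> 0"
proof -
  let ?S = "{s. clip_sum m \<rho> v s \<le> 0}"
  define B where "B = \<rho> + (\<Sum>i<m. \<bar>v i - 1\<bar>)"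
  have bdd: "bdd_below ?S"
  proof (rule bdd_belowI)
    fix s assume "s \<in> ?S"
    moreover have "clip_sum m \<rho> v (- B) > 0"
      using assms clip_sum_extremes(1)[OF _ B_def] by simp
    ultimately show "- B \<le> s"
      using antimono_clip_sum[of s "- B" m \<rho> v] by (cases "s \<le> - B") auto
  qed
  have ne: "?S \<noteq> {}"
    using clip_sum_root[of \<rho> m v] assms by (metis (mono_tags) empty_Collect_eq less_eq_real_def)
  have "closed ?S"
    using closed_Collect_le[OF continuous_on_clip_sum[of UNIV m \<rho> v] continuous_on_const[of UNIV 0]] .
  then have mem: "clip_sum m \<rho> v (clip_shift m \<rho> v) \<le> 0"
    using closed_contains_Inf[OF ne bdd] by (simp add: clip_shift_def)
  show ?thesis
  proof
    assume "clip_shift m \<rho> v \<le> c"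
    then show "clip_sum m \<rho> v c \<le> 0" using antimono_clip_sum mem by (meson order_trans)
  next
    assume "clip_sum m \<rho> v c \<le> 0"
    then show "clip_shift m \<rho> v \<le> c" unfolding clip_shift_def by (intro cInf_lower bdd) auto
  qed
qed

lemma clip_sum_clip_shift:
  assumes "0 \<le> \<rho>"
  shows "clip_sum m \<rho> v (clip_shift m \<rho> v) = 0"
proof (cases "0 < \<rho> \<and> 0 < m")
  case True
  obtain s where s: "clip_sum m \<rho> v s = 0" using clip_sum_root[OF assms] .
  then have "clip_shift m \<rho> v \<le> s" using clip_shift_le_iff True by simp
  then have "clip_sum m \<rho> v (clip_shift m \<rho> v) \<ge> 0"
    using antimono_clip_sum s by metis
  moreover have "clip_sum m \<rho> v (clip_shift m \<rho> v) \<le> 0"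
    using clip_shift_le_iff[of \<rho> m v "clip_shift m \<rho> v"] True by simp
  ultimately show ?thesis by simp
next
  \<comment> \<open>Here the infimum ranges over all reals and has no useful value, but
    \<open>clip_sum\<close> vanishes identically.\<close>
  case False
  then have "\<rho> = 0 \<or> m = 0" using assms by auto
  then show ?thesis by (auto simp: clip_sum_def clip_def max_def min_def intro!: sum.neutral)
qed

definition clip_proj :: "nat \<Rightarrow> real \<Rightarrow> (nat \<Rightarrow> real) \<Rightarrow> nat \<Rightarrow> real" where
  "clip_proj m \<rho> v = (\<lambda>i. if i < m then 1 + clip \<rho> (v i - 1 - clip_shift m \<rho> v) else 0)"

lemma clip_proj_in_G_set: "0 \<le> \<rho> \<Longrightarrow> clip_proj m \<rho> v \<in> G_set m \<rho>"
  using clip_sum_clip_shift[of \<rho> m v]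
  by (auto simp: G_set_def clip_proj_def clip_sum_def abs_clip_le)

lemma sum_G_set: "\<gamma> \<in> G_set m \<rho> \<Longrightarrow> (\<Sum>i<m. \<gamma> i) = m"
  by (simp add: G_set_def sum_subtractf)

text \<open>The obtuse angle characterisation of the projection: the common shift is invisible on
differences of elements of the set, and what remains holds coordinatewise.\<close>

lemma clip_proj_pythagoras:
  assumes "0 \<le> \<rho>" "\<gamma> \<in> G_set m \<rho>"
  shows "(\<Sum>i<m. (v i - clip_proj m \<rho> v i)\<^sup>2) + (\<Sum>i<m. (\<gamma> i - clip_proj m \<rho> v i)\<^sup>2)
    \<le> (\<Sum>i<m. (v i - \<gamma> i)\<^sup>2)"
proof -
  define q where "q = clip_proj m \<rho> v"
  define s where "s = clip_shift m \<rho> v"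
  have "(\<Sum>i<m. (v i - q i - s) * (\<gamma> i - q i)) \<le> 0"
  proof (rule sum_nonpos)
    fix i assume i: "i \<in> {..<m}"
    have b: "\<bar>\<gamma> i - 1\<bar> \<le> \<rho>" using assms(2) i by (auto simp: G_set_def)
    show "(v i - q i - s) * (\<gamma> i - q i) \<le> 0"
      using clip_variational[OF b, of "v i - 1 - s"] i
      by (simp add: q_def s_def clip_proj_def algebra_simps)
  qed
  moreover have "(\<Sum>i<m. \<gamma> i - q i) = 0"
    using sum_G_set[OF assms(2)] sum_G_set[OF clip_proj_in_G_set[OF assms(1)]]
    by (simp add: sum_subtractf q_def)
  moreover have "(\<Sum>i<m. (v i - q i - s) * (\<gamma> i - q i))
      = (\<Sum>i<m. (v i - q i) * (\<gamma> i - q i)) - s * (\<Sum>i<m. \<gamma> i - q i)"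
    unfolding sum_distrib_left sum_subtractf[symmetric]
    by (intro sum.cong) (auto simp: algebra_simps)
  ultimately have le: "(\<Sum>i<m. (v i - q i) * (\<gamma> i - q i)) \<le> 0" by simp
  have "(\<Sum>i<m. (v i - \<gamma> i)\<^sup>2) = (\<Sum>i<m. (v i - q i)\<^sup>2 + (\<gamma> i - q i)\<^sup>2 - 2 * ((v i - q i) * (\<gamma> i - q i)))"
    by (intro sum.cong) (auto simp: power2_eq_square algebra_simps)
  also have "\<dots> = (\<Sum>i<m. (v i - q i)\<^sup>2) + (\<Sum>i<m. (\<gamma> i - q i)\<^sup>2) - 2 * (\<Sum>i<m. (v i - q i) * (\<gamma> i - q i))"
    by (simp add: sum.distrib sum_subtractf sum_distrib_left)
  finally show ?thesis using le by (simp add: q_def)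
qed

text \<open>The surplus square in the Pythagorean inequality gives uniqueness below
  \<open>m\<close>; from \<open>m\<close> on, \<open>G_set\<close> prescribes the value 0. So the
  \<open>THE\<close> is well defined.\<close>

lemma proj_G_eq_clip_proj:
  assumes "0 \<le> \<rho>"
  shows "proj_G m \<rho> v = clip_proj m \<rho> v"
  unfolding proj_G_def
proof (rule the_equality)
  let ?q = "clip_proj m \<rho> v"
  show "?q \<in> G_set m \<rho> \<and> (\<forall>\<gamma>'\<in>G_set m \<rho>. (\<Sum>i<m. (v i - ?q i)\<^sup>2) \<le> (\<Sum>i<m. (v i - \<gamma>' i)\<^sup>2))"
  proof (intro conjI ballI clip_proj_in_G_set assms)
    fix \<gamma>' assume "\<gamma>' \<in> G_set m \<rho>"
    then show "(\<Sum>i<m. (v i - ?q i)\<^sup>2) \<le> (\<Sum>i<m. (v i - \<gamma>' i)\<^sup>2)"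
      using clip_proj_pythagoras[OF assms, of \<gamma>' m v] sum_nonneg[of "{..<m}" "\<lambda>i. (\<gamma>' i - ?q i)\<^sup>2"]
      by simp
  qed
next
  let ?q = "clip_proj m \<rho> v"
  fix \<gamma> assume *: "\<gamma> \<in> G_set m \<rho> \<and> (\<forall>\<gamma>'\<in>G_set m \<rho>. (\<Sum>i<m. (v i - \<gamma> i)\<^sup>2) \<le> (\<Sum>i<m. (v i - \<gamma>' i)\<^sup>2))"
  then have "(\<Sum>i<m. (v i - \<gamma> i)\<^sup>2) \<le> (\<Sum>i<m. (v i - ?q i)\<^sup>2)"
    using clip_proj_in_G_set[OF assms] by blast
  with clip_proj_pythagoras[OF assms, of \<gamma> m v] * have "(\<Sum>i<m. (\<gamma> i - ?q i)\<^sup>2) \<le> 0" by simp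
  then have "(\<Sum>i<m. (\<gamma> i - ?q i)\<^sup>2) = 0" by (simp add: antisym sum_nonneg)
  then have "\<forall>i<m. \<gamma> i = ?q i" by (simp add: sum_nonneg_eq_0_iff)
  moreover have "\<forall>i\<ge>m. \<gamma> i = ?q i" using * by (auto simp: G_set_def clip_proj_def)
  ultimately show "\<gamma> = ?q" by (metis ext not_le)
qed

section \<open>Measurability of the projection\<close>

lemma borel_measurable_clip_shift:
  assumes "0 < \<rho>" "0 < m" "\<And>i. i < m \<Longrightarrow> (\<lambda>\<omega>. v \<omega> i) \<in> borel_measurable M"
  shows "(\<lambda>\<omega>. clip_shift m \<rho> (v \<omega>)) \<in> borel_measurable M"
proof (rule borel_measurableI_le)
  fix c
  have [measurable]: "(\<lambda>\<omega>. clip_sum m \<rho> (v \<omega>) c) \<in> borel_measurable M"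
    unfolding clip_sum_def clip_def using assms(3)
    by (intro borel_measurable_sum borel_measurable_max borel_measurable_min
        borel_measurable_diff borel_measurable_const) auto
  have "{\<omega> \<in> space M. clip_sum m \<rho> (v \<omega>) c \<le> 0} \<in> sets M" by measurable
  then show "{\<omega> \<in> space M. clip_shift m \<rho> (v \<omega>) \<le> c} \<in> sets M"
    using clip_shift_le_iff[OF assms(1,2)] by simp
qed

lemma borel_measurable_proj_G:
  assumes "0 \<le> \<rho>" "\<And>i. i < m \<Longrightarrow> (\<lambda>\<omega>. v \<omega> i) \<in> borel_measurable M" "i < m"
  shows "(\<lambda>\<omega>. proj_G m \<rho> (v \<omega>) i) \<in> borel_measurable M"
proof (cases "\<rho> = 0")
  case True
  then have "clip \<rho> s = 0" for s by (simp add: clip_def)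
  then show ?thesis using assms by (simp add: proj_G_eq_clip_proj clip_proj_def)
next
  case False
  then have [measurable]: "(\<lambda>\<omega>. clip_shift m \<rho> (v \<omega>)) \<in> borel_measurable M"
    using assms by (intro borel_measurable_clip_shift) auto
  have [measurable]: "(\<lambda>\<omega>. v \<omega> i) \<in> borel_measurable M" using assms by auto
  show ?thesis using assms by (simp add: proj_G_eq_clip_proj clip_proj_def clip_def)
qed

section \<open>Deterministic convergence\<close>

lemma inner_n_diff_right: "inner_n n a (\<lambda>k. u k - v k) = inner_n n a u - inner_n n a v"
  by (simp add: inner_n_def algebra_simps sum_subtractf)

lemma inner_n_scale_right: "inner_n n a (\<lambda>k. c * u k) = c * inner_n n a u"
  by (simp add: inner_n_def algebra_simps sum_distrib_left)

lemma inner_n_scale_left: "inner_n n (\<lambda>k. c * u k) a = c * inner_n n u a"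
  by (simp add: inner_n_def algebra_simps sum_distrib_left)

lemma inner_n_diff_left: "inner_n n (\<lambda>k. u k - v k) a = inner_n n u a - inner_n n v a"
  by (simp add: inner_n_def algebra_simps sum_subtractf)

lemma inner_n_cong: "(\<And>k. k < n \<Longrightarrow> u k = u' k) \<Longrightarrow> (\<And>k. k < n \<Longrightarrow> v k = v' k) \<Longrightarrow> inner_n n u v = inner_n n u' v'"
  by (simp add: inner_n_def)

lemma sqnorm_n_eq_inner_n: "sqnorm_n n u = inner_n n u u"
  by (simp add: sqnorm_n_def inner_n_def power2_eq_square)

lemma sqnorm_n_nonneg [simp]: "0 \<le> sqnorm_n n u"
  by (simp add: sqnorm_n_def sum_nonneg)

lemma sqnorm_n_scale: "sqnorm_n n (\<lambda>k. c * u k) = c\<^sup>2 * sqnorm_n n u"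
  by (simp add: sqnorm_n_def power_mult_distrib sum_distrib_left)

lemma abs_inner_n_le: "\<bar>inner_n n u v\<bar> \<le> sqrt (sqnorm_n n u) * sqrt (sqnorm_n n v)"
proof -
  have "(inner_n n u v)\<^sup>2 \<le> sqnorm_n n u * sqnorm_n n v"
    unfolding inner_n_def sqnorm_n_def by (rule Cauchy_Schwarz_ineq_sum)
  then have "sqrt ((inner_n n u v)\<^sup>2) \<le> sqrt (sqnorm_n n u * sqnorm_n n v)"
    by (rule real_sqrt_le_mono)
  then show ?thesis by (simp add: real_sqrt_mult)
qed

definition avg :: "nat \<Rightarrow> nat \<Rightarrow> (nat \<Rightarrow> nat \<Rightarrow> real) \<Rightarrow> real" where
  "avg m p f = (\<Sum>i<m. \<Sum>l<p. f i l) / (real m * real p)"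

lemma avg_add: "avg m p (\<lambda>i l. f i l + g i l) = avg m p f + avg m p g"
  by (simp add: avg_def sum.distrib add_divide_distrib)

lemma avg_cmult: "avg m p (\<lambda>i l. c * f i l) = c * avg m p f"
  by (simp add: avg_def sum_distrib_left)

lemma avg_mono: "(\<And>i l. i < m \<Longrightarrow> l < p \<Longrightarrow> f i l \<le> g i l) \<Longrightarrow> avg m p f \<le> avg m p g"
  unfolding avg_def by (intro divide_right_mono sum_mono) auto

lemma inner_n_avg:
  "inner_n n (\<lambda>k. avg m p (\<lambda>i l. a i l k * f i l)) u = avg m p (\<lambda>i l. f i l * inner_n n (a i l) u)"
proof -
  have "inner_n n (\<lambda>k. avg m p (\<lambda>i l. a i l k * f i l)) u
      = (\<Sum>k<n. \<Sum>i<m. \<Sum>l<p. f i l * (a i l k * u k)) / (real m * real p)"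
    by (simp add: inner_n_def avg_def sum_divide_distrib sum_distrib_left sum_distrib_right mult_ac)
  also have "(\<Sum>k<n. \<Sum>i<m. \<Sum>l<p. f i l * (a i l k * u k)) = (\<Sum>i<m. \<Sum>l<p. \<Sum>k<n. f i l * (a i l k * u k))"
    by (subst sum.swap, rule sum.cong[OF refl], rule sum.swap)
  finally show ?thesis by (simp add: avg_def inner_n_def sum_distrib_left)
qed

text \<open>The three concentration events on which the iteration is deterministic: the sample
covariance on all of the space, the energy of each measurement block along the signal, and the
bilinear form which couples the gains with the signal. Only the last one needs precision
proportional to \<open>\<delta>\<close>, for the initial point.\<close>

definition good_sample :: "nat \<Rightarrow> nat \<Rightarrow> nat \<Rightarrow> (nat \<Rightarrow> real) \<Rightarrow> real \<Rightarrow> (nat \<times> nat \<times> nat \<Rightarrow> real) \<Rightarrow> bool" where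
  "good_sample n m p x \<delta> \<omega> \<longleftrightarrow>
    (\<forall>v. \<bar>avg m p (\<lambda>i l. (inner_n n (avec \<omega> i l) v)\<^sup>2) - sqnorm_n n v\<bar> \<le> sqnorm_n n v / 100) \<and>
    (\<forall>i<m. \<bar>(\<Sum>l<p. (inner_n n (avec \<omega> i l) x)\<^sup>2) / p - sqnorm_n n x\<bar> \<le> sqnorm_n n x / 100) \<and>
    (\<forall>e h. \<bar>avg m p (\<lambda>i l. e i * (inner_n n (avec \<omega> i l) x * inner_n n (avec \<omega> i l) h))
             - (\<Sum>i<m. e i) / m * inner_n n x h\<bar>
           \<le> \<delta> / 100 * (sqrt (sqnorm_n n x) * sqrt (sqnorm_n n h) * sqrt (sqnorm_n m e / m)))"

text \<open>With d the error of the initial signal, the squared norm of d is the coupling form at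
  (g, d) minus the inner product of x and d. As \<open>g\<close> has mean 1, this is exactly the
  deviation in the third event, taken at the random vector d itself; one factor of the norm of d
  then cancels.\<close>

lemma pgd_init_Delta:
  assumes "m \<ge> 1" "p \<ge> 1" "good_sample n m p x \<delta> \<omega>" "g \<in> G_set m \<rho>" "0 \<le> \<rho>" "\<rho> \<le> 1" "0 < \<delta>"
  shows "Delta n m x g (pgd_init n m p \<omega> (meas_y n \<omega> g x)) \<le> (\<delta>\<^sup>2 + \<rho>\<^sup>2) * sqnorm_n n x"
proof -
  define z where "z = fst (pgd_init n m p \<omega> (meas_y n \<omega> g x))"
  define d where "d = (\<lambda>k. z k - x k)"
  define X where "X = sqnorm_n n x"
  have z: "z k = avg m p (\<lambda>i l. avec \<omega> i l k * (g i * inner_n n (avec \<omega> i l) x))" if "k < n" for k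
    using that sum.swap[of "\<lambda>l i. avec \<omega> i l k * (g i * inner_n n (avec \<omega> i l) x)" "{..<m}" "{..<p}"]
    by (simp add: z_def pgd_init_def avg_def meas_y_def)
  have zd: "inner_n n z d = avg m p (\<lambda>i l. g i * (inner_n n (avec \<omega> i l) x * inner_n n (avec \<omega> i l) d))"
    using inner_n_avg[of n m p "avec \<omega>" "\<lambda>i l. g i * inner_n n (avec \<omega> i l) x" d]
      inner_n_cong[of n z "\<lambda>k. avg m p (\<lambda>i l. avec \<omega> i l k * (g i * inner_n n (avec \<omega> i l) x))" d d] z
    by (simp add: mult_ac)
  have sg: "sqnorm_n m g \<le> 4 * m"
  proof -
    have "(g i)\<^sup>2 \<le> 4" if "i < m" for i
    proof -
      have "\<bar>g i\<bar> \<le> 2" using assms(4-6) that by (force simp: G_set_def abs_le_iff)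
      then show ?thesis using power2_le_iff_abs_le[of 2 "g i"] by simp
    qed
    then have "sqnorm_n m g \<le> (\<Sum>i<m. 4)" unfolding sqnorm_n_def by (intro sum_mono) auto
    then show ?thesis by simp
  qed
  have "sqnorm_n n d = inner_n n z d - inner_n n x d"
    unfolding sqnorm_n_eq_inner_n by (subst d_def) (simp add: inner_n_diff_left)
  also have "\<dots> \<le> \<delta> / 100 * (sqrt X * sqrt (sqnorm_n n d) * sqrt (sqnorm_n m g / m))"
  proof -
    have "\<bar>inner_n n z d - (\<Sum>i<m. g i) / m * inner_n n x d\<bar>
        \<le> \<delta> / 100 * (sqrt X * sqrt (sqnorm_n n d) * sqrt (sqnorm_n m g / m))"
      using assms(3) unfolding good_sample_def zd X_def by blast
    moreover have "(\<Sum>i<m. g i) / m = 1" using sum_G_set[OF assms(4)] assms(1) by simp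
    ultimately show ?thesis by (simp only: mult_1 abs_le_iff)
  qed
  also have "\<dots> \<le> \<delta> / 100 * (sqrt X * sqrt (sqnorm_n n d) * sqrt 4)"
    using sg assms(1,7) by (intro mult_left_mono real_sqrt_le_mono) (auto simp: field_simps X_def)
  also have "\<dots> \<le> (\<delta> * sqrt X) * sqrt (sqnorm_n n d)"
    using assms(7) by (simp add: X_def field_simps)
  finally have "sqrt (sqnorm_n n d) * sqrt (sqnorm_n n d) \<le> (\<delta> * sqrt X) * sqrt (sqnorm_n n d)" by simp
  moreover have "0 \<le> \<delta> * sqrt X" using assms(7) by (simp add: X_def)
  ultimately have "sqrt (sqnorm_n n d) \<le> \<delta> * sqrt X"
    by (cases "sqrt (sqnorm_n n d) = 0") (auto dest!: mult_right_le_imp_le simp: less_le simp del: real_sqrt_mult_self)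
  then have "(sqrt (sqnorm_n n d))\<^sup>2 \<le> (\<delta> * sqrt X)\<^sup>2" by (intro power_mono) auto
  then have 1: "sqnorm_n n d \<le> \<delta>\<^sup>2 * X" by (simp add: power_mult_distrib X_def)
  have "(\<Sum>i<m. (1 - g i)\<^sup>2) \<le> (\<Sum>i<m. \<rho>\<^sup>2)"
  proof (rule sum_mono)
    fix i assume "i \<in> {..<m}"
    then have "\<bar>1 - g i\<bar> \<le> \<rho>" using assms(4) by (auto simp: G_set_def abs_minus_commute)
    then show "(1 - g i)\<^sup>2 \<le> \<rho>\<^sup>2" using assms(5) by (simp add: power2_le_iff_abs_le)
  qed
  then have "X / m * (\<Sum>i<m. (1 - g i)\<^sup>2) \<le> X / m * (m * \<rho>\<^sup>2)"
    by (intro mult_left_mono) (auto simp: X_def)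
  also have "\<dots> = \<rho>\<^sup>2 * X" using assms(1) by simp
  finally have 2: "X / m * (\<Sum>i<m. (1 - g i)\<^sup>2) \<le> \<rho>\<^sup>2 * X" .
  have "Delta n m x g (pgd_init n m p \<omega> (meas_y n \<omega> g x)) = sqnorm_n n d + X / m * (\<Sum>i<m. (1 - g i)\<^sup>2)"
    unfolding Delta_def X_def[symmetric] z_def[symmetric]
    by (simp add: sqnorm_n_def d_def pgd_init_def)
  with 1 2 show ?thesis by (simp add: algebra_simps X_def)
qed

text \<open>Centring is an orthogonal projection.\<close>

lemma sum_center_m_sq:
  assumes "m \<ge> 1"
  shows "(\<Sum>i<m. (center_m m f i)\<^sup>2) \<le> (\<Sum>i<m. (f i)\<^sup>2)"
proof -
  define a where "a = (\<Sum>j<m. f j) / m"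
  have a: "(\<Sum>j<m. f j) = m * a" using assms by (simp add: a_def)
  have "(\<Sum>i<m. (center_m m f i)\<^sup>2) = (\<Sum>i<m. (f i)\<^sup>2 - 2 * a * f i + a\<^sup>2)"
    by (intro sum.cong) (auto simp: center_m_def a_def[symmetric] power2_eq_square algebra_simps)
  also have "\<dots> = (\<Sum>i<m. (f i)\<^sup>2) - m * a\<^sup>2"
    unfolding sum.distrib sum_subtractf sum_distrib_left[symmetric] a by (simp add: power2_eq_square)
  finally show ?thesis by simp
qed

section \<open>One projected gradient step on a good sample\<close>

context
  fixes n m p :: nat and x :: "nat \<Rightarrow> real" and \<delta> \<rho> :: real
    and \<omega> :: "nat \<times> nat \<times> nat \<Rightarrow> real" and g \<xi> \<gamma> :: "nat \<Rightarrow> real"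
  assumes m: "m \<ge> 1" and p: "p \<ge> 1" and good: "good_sample n m p x \<delta> \<omega>"
    and g: "g \<in> G_set m \<rho>" and \<gamma>: "\<gamma> \<in> G_set m \<rho>"
    and \<rho>: "0 \<le> \<rho>" "\<rho> < 1 / 31" and \<delta>: "0 < \<delta>" "\<delta> \<le> 1"
begin

private definition "b i l v = inner_n n (avec \<omega> i l) v"
private definition "X = sqnorm_n n x"
private definition "h = (\<lambda>k. \<xi> k - x k)"
private definition "e = (\<lambda>i. \<gamma> i - g i)"
private definition "H = sqnorm_n n h"
text \<open>Gain part of \<open>Delta\<close>, so that H + E is the whole error
  (\<open>Delta_eq\<close>).\<close>

private definition "E = X * sqnorm_n m e / m"
private definition "r i l = \<gamma> i * b i l h + e i * b i l x"
private definition "grad1 = grad_xi n m p \<omega> (meas_y n \<omega> g x) \<xi> \<gamma>"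
text \<open>Gain gradient before centring. Centring does not change its pairing with
  \<open>e\<close>, whose entries sum to zero.\<close>

private definition "w i = (\<Sum>l<p. b i l \<xi> * r i l) / (real m * real p)"

private lemma nonneg: "0 \<le> X" "0 \<le> H" "0 \<le> E"
  by (simp_all add: X_def H_def E_def)

private lemma e_bounds:
  assumes "i < m"
  shows "\<bar>e i\<bar> \<le> 2 * \<rho>" "\<bar>\<gamma> i - 1\<bar> \<le> \<rho>" "1 - \<rho> \<le> \<gamma> i" "\<gamma> i \<le> 1 + \<rho>"
proof -
  have 1: "\<bar>\<gamma> i - 1\<bar> \<le> \<rho>" "\<bar>g i - 1\<bar> \<le> \<rho>" using g \<gamma> assms by (auto simp: G_set_def)
  then show "\<bar>e i\<bar> \<le> 2 * \<rho>" "\<bar>\<gamma> i - 1\<bar> \<le> \<rho>" "1 - \<rho> \<le> \<gamma> i" "\<gamma> i \<le> 1 + \<rho>" by (auto simp: e_def)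
qed

private lemma sum_e: "(\<Sum>i<m. e i) = 0"
  using sum_G_set[OF g] sum_G_set[OF \<gamma>] by (simp add: e_def sum_subtractf)

private lemma residual: "\<gamma> i * b i l \<xi> - meas_y n \<omega> g x l i = r i l"
  by (simp add: r_def e_def b_def h_def meas_y_def inner_n_diff_right algebra_simps)

private lemma covariance:
  "avg m p (\<lambda>i l. (b i l v)\<^sup>2) \<le> 101 / 100 * sqnorm_n n v"
  "99 / 100 * sqnorm_n n v \<le> avg m p (\<lambda>i l. (b i l v)\<^sup>2)"
proof -
  have "\<bar>avg m p (\<lambda>i l. (b i l v)\<^sup>2) - sqnorm_n n v\<bar> \<le> sqnorm_n n v / 100"
    using good unfolding good_sample_def b_def by blast
  then show "avg m p (\<lambda>i l. (b i l v)\<^sup>2) \<le> 101 / 100 * sqnorm_n n v"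
    "99 / 100 * sqnorm_n n v \<le> avg m p (\<lambda>i l. (b i l v)\<^sup>2)" by linarith+
qed

text \<open>The factor (e i)^2 is constant on each block, so the block energies along
  \<open>x\<close> decide. As \<open>e\<close> is arbitrary, they must be controlled for every block
  and not only on average.\<close>

private lemma gain_energy:
  "avg m p (\<lambda>i l. (e i * b i l x)\<^sup>2) \<le> 101 / 100 * E"
  "99 / 100 * E \<le> avg m p (\<lambda>i l. (e i * b i l x)\<^sup>2)"
proof -
  define s where "s i = (\<Sum>l<p. (b i l x)\<^sup>2) / p" for i
  have s: "s i \<le> 101 / 100 * X" "99 / 100 * X \<le> s i" if "i < m" for i
  proof -
    have "\<bar>s i - X\<bar> \<le> X / 100"
      using good that unfolding good_sample_def b_def s_def X_def by blast
    then show "s i \<le> 101 / 100 * X" "99 / 100 * X \<le> s i" by linarith+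
  qed
  have eq: "avg m p (\<lambda>i l. (e i * b i l x)\<^sup>2) = (\<Sum>i<m. (e i)\<^sup>2 * s i) / m"
    unfolding avg_def s_def by (simp add: power_mult_distrib flip: sum_distrib_left sum_divide_distrib)
  have "(\<Sum>i<m. (e i)\<^sup>2 * s i) \<le> (\<Sum>i<m. (e i)\<^sup>2 * (101 / 100 * X))"
    "(\<Sum>i<m. (e i)\<^sup>2 * (99 / 100 * X)) \<le> (\<Sum>i<m. (e i)\<^sup>2 * s i)"
    using s by (intro sum_mono mult_left_mono; auto)+
  then have "(\<Sum>i<m. (e i)\<^sup>2 * s i) \<le> 101 / 100 * X * sqnorm_n m e"
    "99 / 100 * X * sqnorm_n m e \<le> (\<Sum>i<m. (e i)\<^sup>2 * s i)"
    unfolding sqnorm_n_def sum_distrib_left by (simp_all only: mult_ac)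
  then show "avg m p (\<lambda>i l. (e i * b i l x)\<^sup>2) \<le> 101 / 100 * E"
    "99 / 100 * E \<le> avg m p (\<lambda>i l. (e i * b i l x)\<^sup>2)"
    using divide_right_mono[of "\<Sum>i<m. (e i)\<^sup>2 * s i" "101 / 100 * X * sqnorm_n m e" "real m"]
      divide_right_mono[of "99 / 100 * X * sqnorm_n m e" "\<Sum>i<m. (e i)\<^sup>2 * s i" "real m"]
    unfolding eq E_def by (simp_all add: mult.assoc)
qed

text \<open>The coupling event is applied to the gains \<gamma> e. The deviation yields 1/50 (from
  \<gamma>^2 <= 4 and \<delta> <= 1), the mean yields \<rho>, and the product of norms is split by
  the arithmetic-geometric mean.\<close>

private lemma cross_term:
  "\<bar>avg m p (\<lambda>i l. \<gamma> i * b i l h * (e i * b i l x))\<bar> \<le> (\<rho> + 1 / 50) / 2 * (H + E)"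
proof -
  define ge where "ge i = \<gamma> i * e i" for i
  have ge: "sqnorm_n m ge \<le> 4 * sqnorm_n m e"
  proof -
    have "(ge i)\<^sup>2 \<le> 4 * (e i)\<^sup>2" if "i < m" for i
    proof -
      have "\<bar>\<gamma> i\<bar> \<le> 2" using e_bounds[OF that] \<rho> by (auto simp: abs_le_iff)
      then have "(\<gamma> i)\<^sup>2 \<le> 4" using power2_le_iff_abs_le[of 2 "\<gamma> i"] by simp
      then show ?thesis by (simp add: ge_def power_mult_distrib mult_right_mono)
    qed
    then show ?thesis unfolding sqnorm_n_def sum_distrib_left by (intro sum_mono) auto
  qed
  have prod: "sqrt X * sqrt H * sqrt (sqnorm_n m e / m) \<le> (H + E) / 2"
  proof -
    have "sqrt X * sqrt H * sqrt (sqnorm_n m e / m) = sqrt (H * E)"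
      by (simp add: E_def real_sqrt_mult real_sqrt_divide)
    also have "\<dots> \<le> (H + E) / 2" using nonneg by (intro arith_geo_mean_sqrt)
    finally show ?thesis .
  qed
  have sum: "\<bar>(\<Sum>i<m. ge i)\<bar> \<le> \<rho> * (m * sqrt (sqnorm_n m e / m))"
  proof -
    \<comment> \<open>Subtracting the zero sum of \<open>e\<close> leaves only \<gamma> - 1, which
      is small.\<close>
    have "(\<Sum>i<m. ge i) = inner_n m (\<lambda>i. \<gamma> i - 1) e"
      using sum_e by (simp add: ge_def inner_n_def algebra_simps sum_subtractf)
    then have "\<bar>(\<Sum>i<m. ge i)\<bar> \<le> sqrt (sqnorm_n m (\<lambda>i. \<gamma> i - 1)) * sqrt (sqnorm_n m e)"
      using abs_inner_n_le by simp
    also have "sqnorm_n m (\<lambda>i. \<gamma> i - 1) \<le> (\<Sum>i<m. \<rho>\<^sup>2)"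
      unfolding sqnorm_n_def using e_bounds(2) \<rho>(1) by (intro sum_mono) (simp add: power2_le_iff_abs_le)
    then have "sqrt (sqnorm_n m (\<lambda>i. \<gamma> i - 1)) \<le> sqrt (m * \<rho>\<^sup>2)" by (intro real_sqrt_le_mono) simp
    then have "sqrt (sqnorm_n m (\<lambda>i. \<gamma> i - 1)) * sqrt (sqnorm_n m e) \<le> sqrt m * \<rho> * sqrt (sqnorm_n m e)"
      using \<rho>(1) by (intro mult_right_mono) (auto simp: real_sqrt_mult)
    also have "\<dots> = \<rho> * (m * sqrt (sqnorm_n m e / m))"
      using m by (simp add: real_sqrt_divide field_simps)
    finally show ?thesis .
  qed
  have "\<bar>avg m p (\<lambda>i l. ge i * (b i l x * b i l h)) - (\<Sum>i<m. ge i) / m * inner_n n x h\<bar>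
      \<le> \<delta> / 100 * (sqrt X * sqrt H * sqrt (sqnorm_n m ge / m))"
    using good unfolding good_sample_def b_def X_def H_def by blast
  also have "\<dots> \<le> 1 / 100 * (sqrt X * sqrt H * (2 * sqrt (sqnorm_n m e / m)))"
  proof -
    have "sqrt (sqnorm_n m ge / m) \<le> sqrt (4 * (sqnorm_n m e / m))"
      using ge m by (intro real_sqrt_le_mono) (simp add: field_simps)
    also have "\<dots> = 2 * sqrt (sqnorm_n m e / m)" by (simp only: real_sqrt_mult real_sqrt_four)
    finally show ?thesis using \<delta> nonneg by (intro mult_mono) auto
  qed
  also have "\<dots> \<le> 1 / 50 * ((H + E) / 2)" using prod by simp
  finally have 1: "\<bar>avg m p (\<lambda>i l. ge i * (b i l x * b i l h)) - (\<Sum>i<m. ge i) / m * inner_n n x h\<bar>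
      \<le> 1 / 50 * ((H + E) / 2)" .
  have "\<bar>(\<Sum>i<m. ge i) / m * inner_n n x h\<bar> \<le> \<rho> * sqrt (sqnorm_n m e / m) * (sqrt X * sqrt H)"
    unfolding abs_mult X_def H_def using sum m \<rho>(1) abs_inner_n_le
    by (intro mult_mono) (auto simp: field_simps)
  also have "\<dots> \<le> \<rho> * ((H + E) / 2)"
    using mult_left_mono[OF prod \<rho>(1)] by (simp add: mult_ac)
  finally have "\<bar>avg m p (\<lambda>i l. ge i * (b i l x * b i l h))\<bar> \<le> 1 / 50 * ((H + E) / 2) + \<rho> * ((H + E) / 2)"
    using 1 by linarith
  moreover have "1 / 50 * ((H + E) / 2) + \<rho> * ((H + E) / 2) = (\<rho> + 1 / 50) / 2 * (H + E)"
    by (simp add: field_simps)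
  moreover have "avg m p (\<lambda>i l. ge i * (b i l x * b i l h)) = avg m p (\<lambda>i l. \<gamma> i * b i l h * (e i * b i l x))"
    by (simp add: ge_def mult_ac)
  ultimately show ?thesis by (simp only:)
qed

private lemma grad1_eq: "k < n \<Longrightarrow> grad1 k = avg m p (\<lambda>i l. avec \<omega> i l k * (\<gamma> i * r i l))"
  unfolding grad1_def grad_xi_def avg_def residual[symmetric] b_def
  by (simp add: mult_ac)

private lemma inner_grad1: "inner_n n grad1 v = avg m p (\<lambda>i l. \<gamma> i * r i l * b i l v)"
proof -
  have "inner_n n grad1 v = inner_n n (\<lambda>k. avg m p (\<lambda>i l. avec \<omega> i l k * (\<gamma> i * r i l))) v"
    by (intro inner_n_cong) (simp_all add: grad1_eq)
  then show ?thesis by (simp add: inner_n_avg b_def)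
qed

private lemma inner_w: "(\<Sum>i<m. w i * e i) = avg m p (\<lambda>i l. e i * b i l \<xi> * r i l)"
  by (simp add: avg_def w_def sum_divide_distrib sum_distrib_left sum_distrib_right mult_ac)

private lemma b_xi: "b i l \<xi> = b i l h + b i l x"
  by (simp add: b_def h_def inner_n_diff_right)

text \<open>Put u for a . h and z for e (a . x). Row by row the integrand is \<gamma>(\<gamma> +
  e)u^2 + z^2 + 2\<gamma>uz + euz. Only 2\<gamma>uz needs cancellation between rows
  (\<open>cross_term\<close>); the term euz is at most \<rho>(u^2 + z^2) in absolute value because
  |e| <= 2\<rho>.\<close>

private lemma curvature: "(97 / 100 - 7 * \<rho>) * (H + E) \<le> inner_n n grad1 h + (\<Sum>i<m. w i * e i)"
proof -
  let ?A = "avg m p (\<lambda>i l. (b i l h)\<^sup>2)" and ?B = "avg m p (\<lambda>i l. (e i * b i l x)\<^sup>2)"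
  let ?C = "avg m p (\<lambda>i l. \<gamma> i * b i l h * (e i * b i l x))"
  have "(1 - 4 * \<rho> - \<rho>) * ?A + ((1 - \<rho>) * ?B + 2 * ?C)
      = avg m p (\<lambda>i l. (1 - 4 * \<rho> - \<rho>) * (b i l h)\<^sup>2
        + ((1 - \<rho>) * (e i * b i l x)\<^sup>2 + 2 * (\<gamma> i * b i l h * (e i * b i l x))))"
    by (simp only: avg_add avg_cmult)
  also have "\<dots> \<le> avg m p (\<lambda>i l. \<gamma> i * r i l * b i l h + e i * b i l \<xi> * r i l)"
  proof (rule avg_mono)
    fix i l assume i: "i < m" and "l < p"
    let ?u = "b i l h" and ?z = "e i * b i l x"
    note eb = e_bounds[OF i]
    have "(1 - \<rho>) * (1 - 3 * \<rho>) \<le> \<gamma> i * (\<gamma> i + e i)"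
      using eb \<rho> by (intro mult_mono) (auto simp: abs_le_iff)
    moreover have "(1 - \<rho>) * (1 - 3 * \<rho>) = 1 - 4 * \<rho> + 3 * (\<rho> * \<rho>)" by (simp add: algebra_simps)
    ultimately have "1 - 4 * \<rho> \<le> \<gamma> i * (\<gamma> i + e i)" using mult_nonneg_nonneg[OF \<rho>(1) \<rho>(1)] by linarith
    then have 1: "(1 - 4 * \<rho>) * ?u\<^sup>2 \<le> \<gamma> i * (\<gamma> i + e i) * ?u\<^sup>2" by (intro mult_right_mono) auto
    have "\<bar>e i * (?u * ?z)\<bar> \<le> 2 * \<rho> * ((?u\<^sup>2 + ?z\<^sup>2) / 2)"
    proof -
      have "2 * (\<bar>?u\<bar> * \<bar>?z\<bar>) \<le> ?u\<^sup>2 + ?z\<^sup>2"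
        using zero_le_power2[of "\<bar>?u\<bar> - \<bar>?z\<bar>"] by (simp add: power2_diff)
      then have "\<bar>?u\<bar> * \<bar>?z\<bar> \<le> (?u\<^sup>2 + ?z\<^sup>2) / 2" by simp
      then have "\<bar>?u * ?z\<bar> \<le> (?u\<^sup>2 + ?z\<^sup>2) / 2" by (simp add: abs_mult)
      then show ?thesis unfolding abs_mult[of "e i"] using eb(1) \<rho> by (intro mult_mono) auto
    qed
    then have 2: "- (\<rho> * (?u\<^sup>2 + ?z\<^sup>2)) \<le> e i * (?u * ?z)" by (simp add: abs_le_iff)
    have "\<gamma> i * r i l * b i l h + e i * b i l \<xi> * r i l
        = \<gamma> i * (\<gamma> i + e i) * ?u\<^sup>2 + ?z\<^sup>2 + 2 * (\<gamma> i * ?u * ?z) + e i * (?u * ?z)"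
      by (simp add: r_def b_xi algebra_simps power2_eq_square)
    then show "(1 - 4 * \<rho> - \<rho>) * ?u\<^sup>2 + ((1 - \<rho>) * ?z\<^sup>2 + 2 * (\<gamma> i * ?u * ?z))
        \<le> \<gamma> i * r i l * b i l h + e i * b i l \<xi> * r i l"
      using 1 2 by (simp add: algebra_simps)
  qed
  also have "\<dots> = inner_n n grad1 h + (\<Sum>i<m. w i * e i)"
    by (simp add: inner_grad1 inner_w avg_add)
  finally have 1: "(1 - 5 * \<rho>) * ?A + (1 - \<rho>) * ?B + 2 * ?C \<le> inner_n n grad1 h + (\<Sum>i<m. w i * e i)"
    by (simp add: algebra_simps)
  have 2: "(1 - 5 * \<rho>) * (99 / 100 * H) \<le> (1 - 5 * \<rho>) * ?A"
    using covariance(2)[of h] \<rho> unfolding H_def by (intro mult_left_mono) auto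
  have 3: "(1 - \<rho>) * (99 / 100 * E) \<le> (1 - \<rho>) * ?B"
    using gain_energy(2) \<rho> by (intro mult_left_mono) auto
  have 4: "- ((\<rho> + 1 / 50) / 2 * (H + E)) \<le> ?C" using abs_le_D2[OF cross_term] by linarith
  \<comment> \<open>99/100 - 1/50 gives 97/100. The losses in \<rho>, 5.95 for H and 1.99 for E, are
    rounded up to 7; the last two terms are the surplus.\<close>
  have 5: "(97 / 100 - 7 * \<rho>) * (H + E) = (1 - 5 * \<rho>) * (99 / 100 * H) + (1 - \<rho>) * (99 / 100 * E)
      - 2 * ((\<rho> + 1 / 50) / 2 * (H + E)) - 21 / 20 * (\<rho> * H) - 501 / 100 * (\<rho> * E)"
    by (simp add: field_simps)
  have lin: "a' + b' - 2 * c' - 21 / 20 * u - 501 / 100 * z \<le> s"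
    if "a + b + 2 * c \<le> s" "a' \<le> a" "b' \<le> b" "- c' \<le> c" "0 \<le> u" "0 \<le> z"
    for a b c a' b' c' u z s :: real using that by linarith
  show ?thesis unfolding 5
    by (rule lin[OF 1 2 3 4 mult_nonneg_nonneg[OF \<rho>(1) nonneg(2)] mult_nonneg_nonneg[OF \<rho>(1) nonneg(3)]])
qed

private lemma residual_energy: "avg m p (\<lambda>i l. (r i l)\<^sup>2) \<le> 3 * (H + E)"
proof -
  have "avg m p (\<lambda>i l. (r i l)\<^sup>2) \<le> avg m p (\<lambda>i l. 5 / 2 * (b i l h)\<^sup>2 + 2 * (e i * b i l x)\<^sup>2)"
  proof (rule avg_mono)
    fix i l assume i: "i < m" and "l < p"
    let ?u = "b i l h" and ?z = "e i * b i l x"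
    have "\<gamma> i * \<gamma> i \<le> (32 / 31) * (32 / 31)"
      using e_bounds[OF i] \<rho> by (intro mult_mono) auto
    then have "(\<gamma> i)\<^sup>2 \<le> 5 / 4" by (simp add: power2_eq_square)
    then have "(\<gamma> i)\<^sup>2 * ?u\<^sup>2 \<le> 5 / 4 * ?u\<^sup>2" by (intro mult_right_mono) auto
    then have 1: "(\<gamma> i * ?u)\<^sup>2 \<le> 5 / 4 * ?u\<^sup>2" by (simp add: power_mult_distrib)
    have "(r i l)\<^sup>2 \<le> 2 * (\<gamma> i * ?u)\<^sup>2 + 2 * ?z\<^sup>2"
      using zero_le_power2[of "\<gamma> i * ?u - ?z"] by (simp add: r_def power2_sum power2_diff)
    then show "(r i l)\<^sup>2 \<le> 5 / 2 * ?u\<^sup>2 + 2 * ?z\<^sup>2" using 1 by simp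
  qed
  also have "\<dots> = 5 / 2 * avg m p (\<lambda>i l. (b i l h)\<^sup>2) + 2 * avg m p (\<lambda>i l. (e i * b i l x)\<^sup>2)"
    by (simp only: avg_add avg_cmult)
  also have "\<dots> \<le> 5 / 2 * (101 / 100 * H) + 2 * (101 / 100 * E)"
    using covariance(1)[of h] gain_energy(1) by (simp add: H_def)
  also have "\<dots> \<le> 3 * (H + E)" using nonneg by simp
  finally show ?thesis .
qed

text \<open>Self-bounding: the covariance event holds for all vectors, so it applies to the gradient
  itself, and Young's inequality leaves only 101/400 of its squared norm on the right.\<close>

private lemma grad1_bound: "sqnorm_n n grad1 \<le> 6 * (H + E)"
proof -
  have "sqnorm_n n grad1 = avg m p (\<lambda>i l. \<gamma> i * r i l * b i l grad1)"
    by (simp add: sqnorm_n_eq_inner_n inner_grad1)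
  also have "\<dots> \<le> avg m p (\<lambda>i l. 1 / 4 * (b i l grad1)\<^sup>2 + 5 / 4 * (r i l)\<^sup>2)"
  proof (rule avg_mono)
    fix i l assume i: "i < m" and "l < p"
    have "\<gamma> i * \<gamma> i \<le> (32 / 31) * (32 / 31)"
      using e_bounds[OF i] \<rho> by (intro mult_mono) auto
    then have "(\<gamma> i)\<^sup>2 \<le> 5 / 4" by (simp add: power2_eq_square)
    then have "(\<gamma> i)\<^sup>2 * (r i l)\<^sup>2 \<le> 5 / 4 * (r i l)\<^sup>2" by (intro mult_right_mono) auto
    then show "\<gamma> i * r i l * b i l grad1 \<le> 1 / 4 * (b i l grad1)\<^sup>2 + 5 / 4 * (r i l)\<^sup>2"
      using zero_le_power2[of "b i l grad1 / 2 - \<gamma> i * r i l"]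
      by (simp add: power2_eq_square algebra_simps)
  qed
  also have "\<dots> = 1 / 4 * avg m p (\<lambda>i l. (b i l grad1)\<^sup>2) + 5 / 4 * avg m p (\<lambda>i l. (r i l)\<^sup>2)"
    by (simp only: avg_add avg_cmult)
  also have "\<dots> \<le> 1 / 4 * (101 / 100 * sqnorm_n n grad1) + 5 / 4 * (3 * (H + E))"
    using covariance(1)[of grad1] residual_energy by linarith
  finally show ?thesis using nonneg by argo
qed

text \<open>The gain gradient is a product of \<open>\<xi>\<close> and the residual;
  \<open>H \<le> X\<close> bounds the first factor by the signal.\<close>

private lemma w_bound:
  assumes "H \<le> X"
  shows "(\<Sum>i<m. (w i)\<^sup>2) \<le> 15 * X * (H + E)"
proof -
  let ?N = "real m * real p"
  have N: "?N > 0" using m p by simp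
  have xi: "sqnorm_n n \<xi> \<le> 4 * X"
  proof -
    have "(\<xi> k)\<^sup>2 \<le> 2 * (x k)\<^sup>2 + 2 * (h k)\<^sup>2" for k
      using zero_le_power2[of "x k - h k"] by (simp add: h_def power2_eq_square algebra_simps)
    then have "sqnorm_n n \<xi> \<le> (\<Sum>k<n. 2 * (x k)\<^sup>2 + 2 * (h k)\<^sup>2)"
      unfolding sqnorm_n_def by (intro sum_mono)
    also have "\<dots> = 2 * X + 2 * H"
      by (simp add: X_def H_def sqnorm_n_def sum.distrib sum_distrib_left)
    finally show ?thesis using assms by simp
  qed
  \<comment> \<open>\<open>good_sample\<close> controls single blocks only along \<open>x\<close>.
    Along the data-dependent \<open>\<xi>\<close> a block is bounded by all blocks together; this
    loses the factor \<open>m\<close> that forces steps of order 1/m.\<close>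
  have blk: "(\<Sum>l<p. (b i l \<xi>)\<^sup>2) \<le> 5 * X * ?N" if "i < m" for i
  proof -
    have "(\<Sum>l<p. (b i l \<xi>)\<^sup>2) \<le> (\<Sum>i<m. \<Sum>l<p. (b i l \<xi>)\<^sup>2)"
      using that by (intro member_le_sum) (auto intro: sum_nonneg)
    also have "\<dots> = avg m p (\<lambda>i l. (b i l \<xi>)\<^sup>2) * ?N" using N by (simp add: avg_def)
    also have "\<dots> \<le> 5 * X * ?N"
      using covariance(1)[of \<xi>] xi nonneg N by (intro mult_right_mono) auto
    finally show ?thesis .
  qed
  have "(w i)\<^sup>2 \<le> 5 * X / ?N * (\<Sum>l<p. (r i l)\<^sup>2)" if "i < m" for i
  proof -
    have w: "(w i)\<^sup>2 = (\<Sum>l<p. b i l \<xi> * r i l)\<^sup>2 / ?N\<^sup>2" by (simp add: w_def power_divide)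
    have "(\<Sum>l<p. b i l \<xi> * r i l)\<^sup>2 \<le> (\<Sum>l<p. (b i l \<xi>)\<^sup>2) * (\<Sum>l<p. (r i l)\<^sup>2)"
      by (rule Cauchy_Schwarz_ineq_sum)
    also have "\<dots> \<le> 5 * X * ?N * (\<Sum>l<p. (r i l)\<^sup>2)"
      using blk[OF that] by (intro mult_right_mono sum_nonneg) auto
    finally have "(w i)\<^sup>2 \<le> 5 * X * ?N * (\<Sum>l<p. (r i l)\<^sup>2) / ?N\<^sup>2"
      unfolding w by (rule divide_right_mono) simp
    moreover have "c * d * s / d\<^sup>2 = c / d * s" if "d > 0" for c d s :: real
      using that by (simp add: power2_eq_square)
    ultimately show ?thesis using N by metis
  qed
  then have "(\<Sum>i<m. (w i)\<^sup>2) \<le> (\<Sum>i<m. 5 * X / ?N * (\<Sum>l<p. (r i l)\<^sup>2))"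
    by (intro sum_mono) auto
  also have "\<dots> = 5 * X * avg m p (\<lambda>i l. (r i l)\<^sup>2)"
    unfolding avg_def sum_distrib_left[symmetric] by simp
  also have "\<dots> \<le> 5 * X * (3 * (H + E))"
    using residual_energy nonneg by (intro mult_left_mono) auto
  finally show ?thesis by (simp only: mult_ac)
qed

private lemma Delta_eq: "Delta n m x g (\<xi>, \<gamma>) = H + E"
  by (simp add: Delta_def H_def E_def h_def e_def sqnorm_n_def[of n "\<lambda>k. \<xi> k - x k"]
      sqnorm_n_def[of m "\<lambda>i. \<gamma> i - g i"] X_def)

lemma pgd_step_contraction:
  assumes X: "0 < sqnorm_n n x" and D: "Delta n m x g (\<xi>, \<gamma>) \<le> sqnorm_n n x"
    and \<mu>: "0 < \<mu>" "25 * real m * \<mu> \<le> 1" and \<delta>': "\<delta> \<le> 1 / 4"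
  shows "Delta n m x g (pgd_step n m p \<omega> (meas_y n \<omega> g x) x \<rho> \<mu> (\<xi>, \<gamma>))
      \<le> (1 - (1 - 4 * \<delta> - 31 * \<rho>) * \<mu>) * Delta n m x g (\<xi>, \<gamma>)"
proof -
  define q where "q = center_m m w"
  have q: "grad_gamma_perp n m p \<omega> (meas_y n \<omega> g x) \<xi> \<gamma> = q"
    unfolding grad_gamma_perp_def b_def[symmetric] residual q_def by (simp add: w_def[abs_def])
  define v where "v = (\<lambda>i. \<gamma> i - \<mu> * (real m / X) * q i)"
  have X0: "X > 0" using X by (simp add: X_def)
  have DHE: "H + E \<le> X" using D by (simp add: Delta_eq X_def)
  have step: "pgd_step n m p \<omega> (meas_y n \<omega> g x) x \<rho> \<mu> (\<xi>, \<gamma>)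
      = ((\<lambda>k. \<xi> k - \<mu> * grad1 k), proj_G m \<rho> v)"
    by (simp add: pgd_step_def Let_def q v_def X_def grad1_def)
  have 1: "(\<Sum>k<n. (\<xi> k - \<mu> * grad1 k - x k)\<^sup>2) = H - 2 * \<mu> * inner_n n grad1 h + \<mu>\<^sup>2 * sqnorm_n n grad1"
  proof -
    have "(\<Sum>k<n. (\<xi> k - \<mu> * grad1 k - x k)\<^sup>2)
        = (\<Sum>k<n. (h k)\<^sup>2 - 2 * \<mu> * (grad1 k * h k) + \<mu>\<^sup>2 * (grad1 k)\<^sup>2)"
      by (intro sum.cong) (auto simp: h_def power2_eq_square algebra_simps)
    then show ?thesis
      by (simp add: H_def sqnorm_n_def inner_n_def sum.distrib sum_subtractf sum_distrib_left)
  qed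
  have qe: "(\<Sum>i<m. q i * e i) = (\<Sum>i<m. w i * e i)"
  proof -
    have "(\<Sum>i<m. q i * e i) = (\<Sum>i<m. w i * e i - (\<Sum>j<m. w j) / m * e i)"
      by (intro sum.cong) (auto simp: q_def center_m_def algebra_simps)
    then show ?thesis unfolding sum_subtractf sum_distrib_left[symmetric] sum_e by simp
  qed
  have "(\<Sum>i<m. (proj_G m \<rho> v i - g i)\<^sup>2) \<le> (\<Sum>i<m. (v i - g i)\<^sup>2)"
    using clip_proj_pythagoras[OF \<rho>(1) g, of v] sum_nonneg[of "{..<m}" "\<lambda>i. (v i - clip_proj m \<rho> v i)\<^sup>2"]
    by (simp add: proj_G_eq_clip_proj[OF \<rho>(1)] power2_commute)
  also have "\<dots> = (\<Sum>i<m. (e i)\<^sup>2 - 2 * \<mu> * (real m / X) * (q i * e i) + (\<mu> * (real m / X))\<^sup>2 * (q i)\<^sup>2)"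
  proof -
    have "(a - c * q - b)\<^sup>2 = (a - b)\<^sup>2 - 2 * c * (q * (a - b)) + c\<^sup>2 * q\<^sup>2" for a b c q :: real
      by (simp add: power2_eq_square algebra_simps)
    then show ?thesis by (simp only: v_def e_def mult.assoc[of 2 \<mu>])
  qed
  also have "\<dots> = sqnorm_n m e - 2 * \<mu> * (real m / X) * (\<Sum>i<m. w i * e i) + (\<mu> * (real m / X))\<^sup>2 * (\<Sum>i<m. (q i)\<^sup>2)"
    unfolding sqnorm_n_def sum.distrib sum_subtractf sum_distrib_left[symmetric] qe ..
  also have "\<dots> \<le> sqnorm_n m e - 2 * \<mu> * (real m / X) * (\<Sum>i<m. w i * e i) + (\<mu> * (real m / X))\<^sup>2 * (15 * X * (H + E))"
  proof -
    have "(\<Sum>i<m. (q i)\<^sup>2) \<le> 15 * X * (H + E)"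
      using sum_center_m_sq[OF m, of w] w_bound DHE nonneg by (auto simp: q_def)
    then have "(\<mu> * (real m / X))\<^sup>2 * (\<Sum>i<m. (q i)\<^sup>2) \<le> (\<mu> * (real m / X))\<^sup>2 * (15 * X * (H + E))"
      by (intro mult_left_mono) auto
    then show ?thesis by simp
  qed
  finally have "X / m * (\<Sum>i<m. (proj_G m \<rho> v i - g i)\<^sup>2)
     \<le> X / m * (sqnorm_n m e - 2 * \<mu> * (real m / X) * (\<Sum>i<m. w i * e i) + (\<mu> * (real m / X))\<^sup>2 * (15 * X * (H + E)))"
    using X0 by (intro mult_left_mono) auto
  \<comment> \<open>The weight X / m of the gains meets the squared step (\<mu> m / X)^2 and the
    factor X, leaving \<mu>^2 m.\<close>
  also have "\<dots> = E - 2 * \<mu> * (\<Sum>i<m. w i * e i) + 15 * \<mu>\<^sup>2 * m * (H + E)"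
    using X0 m by (simp add: E_def field_simps power2_eq_square)
  finally have 2: "X / m * (\<Sum>i<m. (proj_G m \<rho> v i - g i)\<^sup>2) \<le> E - 2 * \<mu> * (\<Sum>i<m. w i * e i) + 15 * \<mu>\<^sup>2 * m * (H + E)" .
  have "Delta n m x g (pgd_step n m p \<omega> (meas_y n \<omega> g x) x \<rho> \<mu> (\<xi>, \<gamma>))
     \<le> (H + E) - 2 * \<mu> * (inner_n n grad1 h + (\<Sum>i<m. w i * e i)) + \<mu>\<^sup>2 * sqnorm_n n grad1 + 15 * \<mu>\<^sup>2 * m * (H + E)"
    using 1 2 by (simp add: step Delta_def X_def[symmetric] algebra_simps)
  also have "\<dots> \<le> (H + E) - 2 * \<mu> * ((97 / 100 - 7 * \<rho>) * (H + E)) + \<mu>\<^sup>2 * (6 * (H + E)) + 15 * \<mu>\<^sup>2 * m * (H + E)"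
  proof -
    have "2 * \<mu> * ((97 / 100 - 7 * \<rho>) * (H + E)) \<le> 2 * \<mu> * (inner_n n grad1 h + (\<Sum>i<m. w i * e i))"
      using curvature \<mu> by (intro mult_left_mono) auto
    moreover have "\<mu>\<^sup>2 * sqnorm_n n grad1 \<le> \<mu>\<^sup>2 * (6 * (H + E))"
      using grad1_bound by (intro mult_left_mono) auto
    ultimately show ?thesis by linarith
  qed
  also have "\<dots> = (1 - \<mu> * (194 / 100 - 14 * \<rho> - 6 * \<mu> - 15 * (m * \<mu>))) * (H + E)"
    by (simp add: algebra_simps power2_eq_square)
  also have "\<dots> \<le> (1 - \<mu> * (1 - 4 * \<delta> - 31 * \<rho>)) * (H + E)"
  proof (intro mult_right_mono diff_left_mono mult_left_mono)
    \<comment> \<open>Then 6\<mu> + 15m\<mu> <= 21m\<mu> <= 21/25, so more than 1 is left of 1.94,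
      and 14\<rho> is dominated by 31\<rho>.\<close>
    have "\<mu> \<le> m * \<mu>" using m \<mu> by simp
    then show "1 - 4 * \<delta> - 31 * \<rho> \<le> 194 / 100 - 14 * \<rho> - 6 * \<mu> - 15 * (m * \<mu>)"
      using \<mu> \<rho> \<delta> by linarith
  qed (use \<mu> nonneg in auto)
  finally show ?thesis by (simp add: Delta_eq mult.commute)
qed

end

text \<open>Besides the rate, the induction must keep the gains in \<open>G_set\<close> and the
  error below the squared norm of \<open>x\<close>, as the step requires. The latter holds since
  \<delta>^2 + \<rho>^2 <= 1 and the contraction factor lies in [0, 1].\<close>

lemma pgd_linear_convergence:
  assumes m: "m \<ge> 1" and p: "p \<ge> 1" and good: "good_sample n m p x \<delta> \<omega>"
    and g: "g \<in> G_set m \<rho>" and \<rho>: "0 \<le> \<rho>" and \<delta>: "0 < \<delta>" and \<rho>\<delta>: "4 * \<delta> + 31 * \<rho> < 1"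
    and X: "0 < sqnorm_n n x" and \<mu>: "0 < \<mu>" "25 * real m * \<mu> \<le> 1"
  shows "Delta n m x g (pgd n m p \<omega> g x \<rho> \<mu> j)
      \<le> (1 - (1 - 4 * \<delta> - 31 * \<rho>) * \<mu>) ^ j * (\<delta>\<^sup>2 + \<rho>\<^sup>2) * sqnorm_n n x"
    and "snd (pgd n m p \<omega> g x \<rho> \<mu> j) \<in> G_set m \<rho>"
proof -
  let ?q = "1 - (1 - 4 * \<delta> - 31 * \<rho>) * \<mu>" and ?X = "sqnorm_n n x"
  have bounds: "\<delta> \<le> 1 / 4" "\<rho> < 1 / 31" "\<rho> \<le> 1" using \<rho> \<delta> \<rho>\<delta> by auto
  have "\<mu> \<le> 1"
  proof -
    have "\<mu> \<le> m * \<mu>" using m \<mu> by simp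
    then show ?thesis using \<mu> by linarith
  qed
  moreover have "(1 - 4 * \<delta> - 31 * \<rho>) * \<mu> \<le> 1 * \<mu>" using \<mu> \<rho> \<delta> by (intro mult_right_mono) auto
  ultimately have "0 \<le> ?q" by linarith
  moreover have "0 \<le> (1 - 4 * \<delta> - 31 * \<rho>) * \<mu>" using \<mu> \<rho>\<delta> by (intro mult_nonneg_nonneg) auto
  ultimately have q: "0 \<le> ?q" "?q \<le> 1" by auto
  have dr: "\<delta>\<^sup>2 + \<rho>\<^sup>2 \<le> 1"
  proof -
    have "\<delta>\<^sup>2 \<le> (1 / 4)\<^sup>2" "\<rho>\<^sup>2 \<le> (1 / 31)\<^sup>2" using bounds \<rho> \<delta> by (intro power_mono; simp)+
    then show ?thesis by (simp add: power2_eq_square)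
  qed
  have "Delta n m x g (pgd n m p \<omega> g x \<rho> \<mu> j) \<le> ?q ^ j * (\<delta>\<^sup>2 + \<rho>\<^sup>2) * ?X
      \<and> snd (pgd n m p \<omega> g x \<rho> \<mu> j) \<in> G_set m \<rho>"
  proof (induction j)
    case 0
    show ?case
      using pgd_init_Delta[OF m p good g \<rho> bounds(3) \<delta>] m \<rho>
      by (auto simp: pgd_def pgd_init_def G_set_def)
  next
    case (Suc j)
    obtain \<xi> \<gamma> where s: "pgd n m p \<omega> g x \<rho> \<mu> j = (\<xi>, \<gamma>)" by (cases "pgd n m p \<omega> g x \<rho> \<mu> j")
    have nxt: "pgd n m p \<omega> g x \<rho> \<mu> (Suc j) = pgd_step n m p \<omega> (meas_y n \<omega> g x) x \<rho> \<mu> (\<xi>, \<gamma>)"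
      using s by (simp add: pgd_def)
    have "\<gamma> \<in> G_set m \<rho>" and D: "Delta n m x g (\<xi>, \<gamma>) \<le> ?q ^ j * (\<delta>\<^sup>2 + \<rho>\<^sup>2) * ?X" using Suc s by auto
    have "?q ^ j * (\<delta>\<^sup>2 + \<rho>\<^sup>2) \<le> 1 * 1" using q dr by (intro mult_mono power_le_one) auto
    then have "?q ^ j * (\<delta>\<^sup>2 + \<rho>\<^sup>2) * ?X \<le> 1 * ?X" using X by (intro mult_right_mono) auto
    then have D': "Delta n m x g (\<xi>, \<gamma>) \<le> ?X" using D by simp
    have "\<delta> \<le> 1" using bounds by simp
    have "Delta n m x g (pgd n m p \<omega> g x \<rho> \<mu> (Suc j)) \<le> ?q * Delta n m x g (\<xi>, \<gamma>)"
      unfolding nxt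
      by (rule pgd_step_contraction[OF m p good g \<open>\<gamma> \<in> G_set m \<rho>\<close> \<rho> bounds(2) \<delta> \<open>\<delta> \<le> 1\<close> X D' \<mu> bounds(1)])
    also have "\<dots> \<le> ?q * (?q ^ j * (\<delta>\<^sup>2 + \<rho>\<^sup>2) * ?X)" using D q by (intro mult_left_mono) auto
    finally have "Delta n m x g (pgd n m p \<omega> g x \<rho> \<mu> (Suc j)) \<le> ?q ^ Suc j * (\<delta>\<^sup>2 + \<rho>\<^sup>2) * ?X"
      by (simp add: mult.assoc)
    moreover have "snd (pgd n m p \<omega> g x \<rho> \<mu> (Suc j)) \<in> G_set m \<rho>"
      by (simp add: nxt pgd_step_def Let_def proj_G_eq_clip_proj[OF \<rho>] clip_proj_in_G_set[OF \<rho>])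
    ultimately show ?case ..
  qed
  then show "Delta n m x g (pgd n m p \<omega> g x \<rho> \<mu> j) \<le> ?q ^ j * (\<delta>\<^sup>2 + \<rho>\<^sup>2) * ?X"
    "snd (pgd n m p \<omega> g x \<rho> \<mu> j) \<in> G_set m \<rho>" by auto
qed

lemma Delta_tendsto_zero:
  assumes "m \<ge> 1" "0 \<le> \<rho>" "0 < \<delta>" and \<rho>\<delta>: "4 * \<delta> + 31 * \<rho> < 1"
    and \<mu>: "0 < \<mu>" "25 * real m * \<mu> \<le> 1"
    and le: "\<And>j. Delta n m x g (s j) \<le> (1 - (1 - 4 * \<delta> - 31 * \<rho>) * \<mu>) ^ j * c * sqnorm_n n x"
  shows "(\<lambda>j. Delta n m x g (s j)) \<longlonglongrightarrow> 0"
proof -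
  let ?q = "1 - (1 - 4 * \<delta> - 31 * \<rho>) * \<mu>"
  have "\<mu> \<le> m * \<mu>" using assms(1) \<mu> by simp
  then have "\<mu> < 1" using \<mu> by linarith
  moreover have "(1 - 4 * \<delta> - 31 * \<rho>) * \<mu> \<le> 1 * \<mu>" using assms by (intro mult_right_mono) auto
  ultimately have "0 \<le> ?q" by linarith
  moreover have "?q < 1" using \<mu> \<rho>\<delta> by simp
  ultimately have "(\<lambda>j. ?q ^ j) \<longlonglongrightarrow> 0" by (intro LIMSEQ_power_zero) simp
  then have "(\<lambda>j. ?q ^ j * (c * sqnorm_n n x)) \<longlonglongrightarrow> 0 * (c * sqnorm_n n x)"
    by (intro tendsto_mult tendsto_const)
  then have lim: "(\<lambda>j. ?q ^ j * c * sqnorm_n n x) \<longlonglongrightarrow> 0" by (simp add: mult.assoc)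
  show ?thesis
  proof (rule tendsto_sandwich[OF _ _ tendsto_const lim])
    show "\<forall>\<^sub>F j in sequentially. 0 \<le> Delta n m x g (s j)"
      by (intro always_eventually allI) (simp add: Delta_def sum_nonneg)
    show "\<forall>\<^sub>F j in sequentially. Delta n m x g (s j) \<le> ?q ^ j * c * sqnorm_n n x"
      using le by (intro always_eventually) blast
  qed
qed

section \<open>Measurability of the iterates\<close>

lemma borel_measurable_sample:
  assumes "sets D = sets borel" "i < m" "l < p" "k < n"
  shows "(\<lambda>\<omega>. avec \<omega> i l k) \<in> borel_measurable (sample_space D n m p)"
proof -
  have "(\<lambda>\<omega>. \<omega> (i, l, k)) \<in> measurable (sample_space D n m p) D"
    unfolding sample_space_def using assms by (intro measurable_component_singleton) auto
  then show ?thesis using measurable_cong_sets[OF refl assms(1)] by (auto simp: avec_def)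
qed

lemma borel_measurable_inner_n_sample:
  assumes "sets D = sets borel" "i < m" "l < p"
    and "\<And>k. k < n \<Longrightarrow> (\<lambda>\<omega>. v \<omega> k) \<in> borel_measurable (sample_space D n m p)"
  shows "(\<lambda>\<omega>. inner_n n (avec \<omega> i l) (v \<omega>)) \<in> borel_measurable (sample_space D n m p)"
  unfolding inner_n_def using borel_measurable_sample[OF assms(1-3)] assms(4)
  by (intro borel_measurable_sum borel_measurable_times) auto

lemma borel_measurable_pgd:
  assumes D: "sets D = sets borel" and \<rho>: "0 \<le> \<rho>"
  shows "(\<forall>k<n. (\<lambda>\<omega>. fst (pgd n m p \<omega> g x \<rho> \<mu> j) k) \<in> borel_measurable (sample_space D n m p)) \<and>
    (\<forall>i<m. (\<lambda>\<omega>. snd (pgd n m p \<omega> g x \<rho> \<mu> j) i) \<in> borel_measurable (sample_space D n m p))"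
proof (induction j)
  case 0
  show ?case
    unfolding pgd_def pgd_init_def meas_y_def
    using borel_measurable_sample[OF D] borel_measurable_inner_n_sample[OF D]
    by (auto intro!: borel_measurable_sum borel_measurable_times)
next
  case (Suc j)
  let ?M = "sample_space D n m p"
  define \<xi> where "\<xi> \<omega> = fst (pgd n m p \<omega> g x \<rho> \<mu> j)" for \<omega>
  define \<gamma> where "\<gamma> \<omega> = snd (pgd n m p \<omega> g x \<rho> \<mu> j)" for \<omega>
  have \<xi>: "(\<lambda>\<omega>. \<xi> \<omega> k) \<in> borel_measurable ?M" if "k < n" for k using Suc that by (simp add: \<xi>_def)
  have \<gamma>: "(\<lambda>\<omega>. \<gamma> \<omega> i) \<in> borel_measurable ?M" if "i < m" for i using Suc that by (simp add: \<gamma>_def)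
  have nxt: "pgd n m p \<omega> g x \<rho> \<mu> (Suc j)
      = pgd_step n m p \<omega> (meas_y n \<omega> g x) x \<rho> \<mu> (\<xi> \<omega>, \<gamma> \<omega>)" for \<omega>
    by (simp add: pgd_def \<xi>_def \<gamma>_def)
  have r: "(\<lambda>\<omega>. \<gamma> \<omega> i * inner_n n (avec \<omega> i l) (\<xi> \<omega>) - meas_y n \<omega> g x l i) \<in> borel_measurable ?M"
    if "i < m" "l < p" for i l
    unfolding meas_y_def using that \<xi> \<gamma>
    by (intro borel_measurable_diff borel_measurable_times borel_measurable_const
        borel_measurable_inner_n_sample[OF D]) auto
  have 1: "(\<lambda>\<omega>. grad_xi n m p \<omega> (meas_y n \<omega> g x) (\<xi> \<omega>) (\<gamma> \<omega>) k) \<in> borel_measurable ?M" if "k < n" for k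
    unfolding grad_xi_def using that \<gamma> r borel_measurable_sample[OF D]
    by (auto intro!: borel_measurable_sum borel_measurable_times)
  have w: "(\<lambda>\<omega>. (1 / (real m * real p)) * (\<Sum>l<p. inner_n n (avec \<omega> i l) (\<xi> \<omega>) *
      (\<gamma> \<omega> i * inner_n n (avec \<omega> i l) (\<xi> \<omega>) - meas_y n \<omega> g x l i))) \<in> borel_measurable ?M" if "i < m" for i
    using that \<xi> r
    by (intro borel_measurable_sum borel_measurable_times borel_measurable_const
        borel_measurable_inner_n_sample[OF D]) auto
  have 2: "(\<lambda>\<omega>. grad_gamma_perp n m p \<omega> (meas_y n \<omega> g x) (\<xi> \<omega>) (\<gamma> \<omega>) i) \<in> borel_measurable ?M" if "i < m" for i
    unfolding grad_gamma_perp_def center_m_def using that w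
    by (auto intro!: borel_measurable_sum borel_measurable_diff borel_measurable_divide simp del: times_divide_eq_left)
  show ?case
    unfolding nxt pgd_step_def Let_def fst_conv snd_conv
    using 1 2 \<xi> \<gamma> \<rho> by (auto intro!: borel_measurable_proj_G)
qed

text \<open>Countably many measurable conditions, one for each \<open>j\<close>. Monotonicity of
  \<open>measure\<close> can be used for the success event only once it is known to be
  measurable.\<close>

lemma sets_Delta_bounded:
  assumes D: "sets D = sets borel" and "0 \<le> \<rho>"
  shows "{\<omega> \<in> space (sample_space D n m p). \<forall>j. Delta n m x g (pgd n m p \<omega> g x \<rho> \<mu> j) \<le> b j}
    \<in> sets (sample_space D n m p)"
proof -
  have [measurable]: "(\<lambda>\<omega>. Delta n m x g (pgd n m p \<omega> g x \<rho> \<mu> j)) \<in> borel_measurable (sample_space D n m p)" for j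
    unfolding Delta_def using borel_measurable_pgd[OF assms, of n m p g x \<mu> j]
    by (auto intro!: borel_measurable_add borel_measurable_sum borel_measurable_power borel_measurable_times
        borel_measurable_divide)
  show ?thesis by measurable
qed

section \<open>Moment generating functions\<close>

text \<open>Moment generating functions are bounded as extended nonnegative integrals throughout, so that
products over independent rows need no integrability side conditions.\<close>

lemma exp_le_quadratic:
  fixes s w :: real
  assumes "\<bar>s\<bar> \<le> 1 / 2"
  shows "exp (s * w) \<le> 1 + s * w + 4 * s\<^sup>2 * exp \<bar>w\<bar>"
proof -
  obtain t where t: "\<bar>t\<bar> \<le> \<bar>s * w\<bar>" "exp (s * w) = (\<Sum>k<2. (s * w) ^ k / fact k) + exp t / fact 2 * (s * w)\<^sup>2"
    using Maclaurin_exp_le[of "s * w" 2] by blast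
  have "\<bar>s * w\<bar> \<le> \<bar>w\<bar> / 2"
    using mult_right_mono[OF assms abs_ge_zero[of w]] by (simp add: abs_mult)
  then have "exp t \<le> exp (\<bar>w\<bar> / 2)" using t(1) by simp
  \<comment> \<open>Since |s| <= 1/2, the remainder uses only half of the exponent |w|; the other
    half absorbs the square.\<close>
  moreover have "w\<^sup>2 \<le> 8 * exp (\<bar>w\<bar> / 2)"
    using exp_lower_Taylor_quadratic[of "\<bar>w\<bar> / 2"] by (simp add: power_divide)
  ultimately have "exp t * w\<^sup>2 \<le> exp (\<bar>w\<bar> / 2) * (8 * exp (\<bar>w\<bar> / 2))"
    by (intro mult_mono) auto
  also have "\<dots> = 8 * exp \<bar>w\<bar>" by (simp flip: exp_add)
  finally have "s\<^sup>2 * (exp t * w\<^sup>2) \<le> s\<^sup>2 * (8 * exp \<bar>w\<bar>)" by (intro mult_left_mono) auto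
  then have "exp t / 2 * (s * w)\<^sup>2 \<le> 4 * s\<^sup>2 * exp \<bar>w\<bar>" by (simp add: power_mult_distrib mult_ac)
  then show ?thesis using t(2) by (simp add: eval_nat_numeral)
qed

lemma integrable_if_nn_integral_le:
  fixes f :: "'a \<Rightarrow> real"
  assumes "f \<in> borel_measurable M" "\<And>\<omega>. 0 \<le> f \<omega>" "(\<integral>\<^sup>+\<omega>. ennreal (f \<omega>) \<partial>M) \<le> ennreal B" "0 \<le> B"
  shows "integrable M f" "(\<integral>\<omega>. f \<omega> \<partial>M) \<le> B"
proof -
  show i: "integrable M f"
    using assms by (intro integrableI_nonneg) (auto intro: le_less_trans)
  show "(\<integral>\<omega>. f \<omega> \<partial>M) \<le> B"
    using assms i nn_integral_eq_integral[OF i] by simp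
qed

context prob_space
begin

text \<open>Mean zero removes the linear term of \<open>exp_le_quadratic\<close>, and 1 + y <= exp y
  turns the rest into an exponential, so that the bound multiplies over rows.\<close>

lemma mgf_le_if_subexponential:
  fixes W :: "'a \<Rightarrow> real"
  assumes W: "W \<in> borel_measurable M" and B: "(\<integral>\<^sup>+\<omega>. ennreal (exp \<bar>W \<omega>\<bar>) \<partial>M) \<le> ennreal B" "0 \<le> B"
    and mean: "expectation W = 0" and s: "\<bar>s\<bar> \<le> 1 / 2"
  shows "(\<integral>\<^sup>+\<omega>. ennreal (exp (s * W \<omega>)) \<partial>M) \<le> ennreal (exp (4 * B * s\<^sup>2))"
proof -
  note [measurable] = W
  have iE: "integrable M (\<lambda>\<omega>. exp \<bar>W \<omega>\<bar>)" "(\<integral>\<omega>. exp \<bar>W \<omega>\<bar> \<partial>M) \<le> B"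
    using integrable_if_nn_integral_le[of "\<lambda>\<omega>. exp \<bar>W \<omega>\<bar>" M B] B by auto
  have iW: "integrable M W"
    by (rule Bochner_Integration.integrable_bound[OF iE(1)])
      (auto intro!: AE_I2 order_trans[OF _ exp_ge_add_one_self[of "\<bar>W _\<bar>"]])
  let ?f = "\<lambda>\<omega>. 1 + s * W \<omega> + 4 * s\<^sup>2 * exp \<bar>W \<omega>\<bar>"
  have i: "integrable M ?f" using iE iW by auto
  have pos: "0 \<le> ?f \<omega>" for \<omega>
    using exp_le_quadratic[OF s, of "W \<omega>"] by (meson exp_ge_zero order_trans)
  have "(\<integral>\<^sup>+\<omega>. ennreal (exp (s * W \<omega>)) \<partial>M) \<le> (\<integral>\<^sup>+\<omega>. ennreal (?f \<omega>) \<partial>M)"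
    by (intro nn_integral_mono ennreal_leI exp_le_quadratic s)
  also have "\<dots> = ennreal (\<integral>\<omega>. ?f \<omega> \<partial>M)"
    by (rule nn_integral_eq_integral[OF i]) (simp add: pos)
  also have "(\<integral>\<omega>. ?f \<omega> \<partial>M) = 1 + 4 * s\<^sup>2 * (\<integral>\<omega>. exp \<bar>W \<omega>\<bar> \<partial>M)"
    using iE iW mean by (simp add: prob_space)
  also have "\<dots> \<le> 1 + 4 * s\<^sup>2 * B" using iE(2) by (intro add_left_mono mult_left_mono) auto
  also have "\<dots> \<le> exp (4 * B * s\<^sup>2)" using exp_ge_add_one_self[of "4 * B * s\<^sup>2"] by (simp add: mult_ac)
  finally show ?thesis by (simp add: ennreal_leI)
qed

text \<open>For small \<open>s\<close> a subgaussian variable is in particular subexponential. For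
  large \<open>s\<close>, the inequality s W <= s^2/4 + W^2 decouples, and the constant
  \<open>B\<close> is absorbed in the exponent because 4 s^2 >= 1.\<close>

lemma mgf_le_if_subgaussian:
  fixes W :: "'a \<Rightarrow> real"
  assumes W: "W \<in> borel_measurable M" and B: "(\<integral>\<^sup>+\<omega>. ennreal (exp ((W \<omega>)\<^sup>2)) \<partial>M) \<le> ennreal B" "1 \<le> B"
    and mean: "expectation W = 0"
  shows "(\<integral>\<^sup>+\<omega>. ennreal (exp (s * W \<omega>)) \<partial>M) \<le> ennreal (exp (8 * B * s\<^sup>2))"
proof (cases "\<bar>s\<bar> \<le> 1 / 2")
  case True
  note [measurable] = W
  have "exp \<bar>w\<bar> \<le> 2 * exp (w\<^sup>2)" for w :: real
  proof -
    have "\<bar>w\<bar> \<le> 1 / 4 + w\<^sup>2"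
      using zero_le_power2[of "\<bar>w\<bar> - 1 / 2"] by (simp add: power2_diff power2_eq_square[of "1/2"])
    then have "exp \<bar>w\<bar> \<le> exp (1 / 4) * exp (w\<^sup>2)" by (simp flip: exp_add)
    also have "exp (1 / 4) \<le> (2 :: real)" using exp_bound_half[of "1 / 4 :: real"] by simp
    finally show ?thesis by simp
  qed
  then have "(\<integral>\<^sup>+\<omega>. ennreal (exp \<bar>W \<omega>\<bar>) \<partial>M) \<le> (\<integral>\<^sup>+\<omega>. ennreal 2 * ennreal (exp ((W \<omega>)\<^sup>2)) \<partial>M)"
    by (intro nn_integral_mono, subst ennreal_mult[symmetric]) (auto intro: ennreal_leI)
  also have "\<dots> = ennreal 2 * (\<integral>\<^sup>+\<omega>. ennreal (exp ((W \<omega>)\<^sup>2)) \<partial>M)" by (rule nn_integral_cmult) auto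
  also have "\<dots> \<le> ennreal 2 * ennreal B" using B by (intro mult_left_mono) auto
  also have "\<dots> = ennreal (2 * B)" using B by (subst ennreal_mult[symmetric]) auto
  finally show ?thesis
    using mgf_le_if_subexponential[OF W _ _ mean True, of "2 * B"] B by simp
next
  case False
  note [measurable] = W
  have "(1 / 2)\<^sup>2 \<le> \<bar>s\<bar>\<^sup>2" using False by (intro power_mono) auto
  then have s: "1 \<le> 4 * s\<^sup>2" by (simp add: power2_eq_square)
  have "(\<integral>\<^sup>+\<omega>. ennreal (exp (s * W \<omega>)) \<partial>M) \<le> (\<integral>\<^sup>+\<omega>. ennreal (exp (s\<^sup>2 / 4)) * ennreal (exp ((W \<omega>)\<^sup>2)) \<partial>M)"
  proof (rule nn_integral_mono)
    fix \<omega>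
    have "s * W \<omega> \<le> s\<^sup>2 / 4 + (W \<omega>)\<^sup>2"
      using zero_le_power2[of "s / 2 - W \<omega>"] by (simp add: power2_diff power_divide)
    then show "ennreal (exp (s * W \<omega>)) \<le> ennreal (exp (s\<^sup>2 / 4)) * ennreal (exp ((W \<omega>)\<^sup>2))"
      by (simp add: ennreal_leI flip: ennreal_mult exp_add)
  qed
  also have "\<dots> = ennreal (exp (s\<^sup>2 / 4)) * (\<integral>\<^sup>+\<omega>. ennreal (exp ((W \<omega>)\<^sup>2)) \<partial>M)"
    by (rule nn_integral_cmult) auto
  also have "\<dots> \<le> ennreal (exp (s\<^sup>2 / 4)) * ennreal B" using B by (intro mult_left_mono) auto
  also have "\<dots> = ennreal (exp (s\<^sup>2 / 4) * B)" using B by (simp flip: ennreal_mult)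
  also have "\<dots> \<le> ennreal (exp (8 * B * s\<^sup>2))"
  proof (rule ennreal_leI)
    have "B \<le> exp B" using exp_ge_add_one_self[of B] by linarith
    then have "exp (s\<^sup>2 / 4) * B \<le> exp (s\<^sup>2 / 4) * exp B" by (intro mult_left_mono) auto
    also have "\<dots> = exp (s\<^sup>2 / 4 + B)" by (simp add: exp_add)
    also have "\<dots> \<le> exp (8 * B * s\<^sup>2)"
    proof -
      have "B \<le> 4 * (B * s\<^sup>2)" using mult_left_mono[OF s, of B] B by (simp add: mult_ac)
      moreover have "1 * s\<^sup>2 \<le> B * s\<^sup>2" using B by (intro mult_right_mono) auto
      ultimately have "s\<^sup>2 / 4 + B \<le> 8 * (B * s\<^sup>2)" using zero_le_power2[of s] by linarith
      then show ?thesis by (simp add: mult.assoc)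
    qed
    finally show "exp (s\<^sup>2 / 4) * B \<le> exp (8 * B * s\<^sup>2)" .
  qed
  finally show ?thesis .
qed

end

section \<open>Square exponential moments by Gaussian averaging\<close>

lemma nn_integral_exp_std_normal:
  "(\<integral>\<^sup>+g. ennreal (exp (b * g)) * ennreal (std_normal_density g) \<partial>lborel) = ennreal (exp (b\<^sup>2 / 2))"
proof -
  have "ennreal (exp (b * g)) * ennreal (std_normal_density g) = ennreal (exp (b\<^sup>2 / 2)) * ennreal (normal_density b 1 g)" for g
  proof -
    have "b * g + - g\<^sup>2 / 2 = b\<^sup>2 / 2 + - (g - b)\<^sup>2 / 2" by (simp add: power2_eq_square field_simps)
    then have "exp (b * g) * exp (- g\<^sup>2 / 2) = exp (b\<^sup>2 / 2) * exp (- (g - b)\<^sup>2 / 2)"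
      by (simp only: exp_add[symmetric])
    then have "exp (b * g) * std_normal_density g = exp (b\<^sup>2 / 2) * normal_density b 1 g"
      by (simp add: normal_density_def)
    then show ?thesis by (simp flip: ennreal_mult)
  qed
  then have "(\<integral>\<^sup>+g. ennreal (exp (b * g)) * ennreal (std_normal_density g) \<partial>lborel)
      = ennreal (exp (b\<^sup>2 / 2)) * (\<integral>\<^sup>+g. ennreal (normal_density b 1 g) \<partial>lborel)"
    by (simp add: nn_integral_cmult)
  also have "(\<integral>\<^sup>+g. ennreal (normal_density b 1 g) \<partial>lborel) = 1"
    using prob_space.emeasure_space_1[OF prob_space_normal_density[of 1 b]]
    by (simp add: emeasure_density)
  finally show ?thesis by simp
qed

lemma nn_integral_exp_square_std_normal:
  "(\<integral>\<^sup>+g. ennreal (exp (g\<^sup>2 / 4)) * ennreal (std_normal_density g) \<partial>lborel) = ennreal (sqrt 2)"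
proof -
  have "ennreal (exp (g\<^sup>2 / 4)) * ennreal (std_normal_density g) = ennreal (sqrt 2) * ennreal (normal_density 0 (sqrt 2) g)" for g
  proof -
    have "g\<^sup>2 / 4 + - g\<^sup>2 / 2 = - g\<^sup>2 / 4" by simp
    then have "exp (g\<^sup>2 / 4) * exp (- g\<^sup>2 / 2) = exp (- g\<^sup>2 / 4)"
      by (simp only: exp_add[symmetric])
    then have "exp (g\<^sup>2 / 4) * std_normal_density g = sqrt 2 * normal_density 0 (sqrt 2) g"
      by (simp add: normal_density_def real_sqrt_mult field_simps)
    then show ?thesis by (simp flip: ennreal_mult)
  qed
  then have "(\<integral>\<^sup>+g. ennreal (exp (g\<^sup>2 / 4)) * ennreal (std_normal_density g) \<partial>lborel)
      = ennreal (sqrt 2) * (\<integral>\<^sup>+g. ennreal (normal_density 0 (sqrt 2) g) \<partial>lborel)"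
    by (simp add: nn_integral_cmult)
  also have "(\<integral>\<^sup>+g. ennreal (normal_density 0 (sqrt 2) g) \<partial>lborel) = 1"
    using prob_space.emeasure_space_1[OF prob_space_normal_density[of "sqrt 2" 0]]
    by (simp add: emeasure_density)
  finally show ?thesis by simp
qed

text \<open>Writing \<open>exp (u\<^sup>2 / (8 c))\<close> as a Gaussian average of \<open>exp (s u)\<close> reduces the square
exponential moment to the moment generating function.\<close>

lemma (in prob_space) exp_square_le_if_mgf_le:
  fixes U :: "'a \<Rightarrow> real"
  assumes U: "U \<in> borel_measurable M" and c: "0 < c"
    and mgf: "\<And>s. (\<integral>\<^sup>+\<omega>. ennreal (exp (s * U \<omega>)) \<partial>M) \<le> ennreal (exp (c * s\<^sup>2))"
  shows "(\<integral>\<^sup>+\<omega>. ennreal (exp ((U \<omega>)\<^sup>2 / (8 * c))) \<partial>M) \<le> ennreal 2"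
proof -
  note [measurable] = U
  interpret pair_sigma_finite M lborel ..
  \<comment> \<open>Chosen so that a^2/2 = 1/(8c), which produces the square exponential, while c
    a^2 = 1/4 stays below the 1/2 in the exponent of the Gaussian density.\<close>
  define a where "a = 1 / (2 * sqrt c)"
  have a: "a\<^sup>2 = 1 / (4 * c)" using c by (simp add: a_def power_divide power_mult_distrib)
  let ?F = "\<lambda>\<omega> g. ennreal (exp (a * U \<omega> * g)) * ennreal (std_normal_density g)"
  have "(\<integral>\<^sup>+\<omega>. ennreal (exp ((U \<omega>)\<^sup>2 / (8 * c))) \<partial>M) = (\<integral>\<^sup>+\<omega>. (\<integral>\<^sup>+g. ?F \<omega> g \<partial>lborel) \<partial>M)"
    by (simp add: nn_integral_exp_std_normal power_mult_distrib a)
  also have "\<dots> = (\<integral>\<^sup>+g. (\<integral>\<^sup>+\<omega>. ?F \<omega> g \<partial>M) \<partial>lborel)"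
    by (rule Fubini'[symmetric]) measurable
  also have "\<dots> = (\<integral>\<^sup>+g. (\<integral>\<^sup>+\<omega>. ennreal (exp (a * g * U \<omega>)) \<partial>M) * ennreal (std_normal_density g) \<partial>lborel)"
    by (intro nn_integral_cong, subst nn_integral_multc) (auto simp: mult_ac)
  also have "\<dots> \<le> (\<integral>\<^sup>+g. ennreal (exp (g\<^sup>2 / 4)) * ennreal (std_normal_density g) \<partial>lborel)"
  proof (intro nn_integral_mono mult_right_mono)
    fix g
    have "c * (a * g)\<^sup>2 = g\<^sup>2 / 4" using c by (simp add: power_mult_distrib a)
    then show "(\<integral>\<^sup>+\<omega>. ennreal (exp (a * g * U \<omega>)) \<partial>M) \<le> ennreal (exp (g\<^sup>2 / 4))" using mgf[of "a * g"] by (simp only:)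
  qed auto
  also have "\<dots> = ennreal (sqrt 2)" by (rule nn_integral_exp_square_std_normal)
  also have "\<dots> \<le> ennreal 2" by (intro ennreal_leI) (simp add: real_le_lsqrt)
  finally show ?thesis .
qed

section \<open>Independent rows\<close>

text \<open>Restricted to the indices below \<open>n\<close>, since points of the product space
  \<open>row_law\<close> are extensional.\<close>

definition sample_row :: "nat \<Rightarrow> (nat \<times> nat \<times> nat \<Rightarrow> real) \<Rightarrow> nat \<times> nat \<Rightarrow> nat \<Rightarrow> real" where
  "sample_row n \<omega> j = (\<lambda>k\<in>{..<n}. \<omega> (fst j, snd j, k))"

definition row_law :: "real measure \<Rightarrow> nat \<Rightarrow> (nat \<Rightarrow> real) measure" where
  "row_law D n = PiM {..<n} (\<lambda>_. D)"

lemma inner_n_row: "inner_n n (sample_row n \<omega> (i, l)) v = inner_n n (avec \<omega> i l) v"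
  by (simp add: inner_n_def sample_row_def avec_def)

locale random_design = prob_space D for D :: "real measure" +
  assumes sets_D: "sets D = sets borel"
begin

lemma prob_space_sample_space: "prob_space (sample_space D n m p)"
  unfolding sample_space_def by (intro prob_space_PiM prob_space_axioms)

lemma prob_space_row_law: "prob_space (row_law D n)"
  unfolding row_law_def by (intro prob_space_PiM prob_space_axioms)

lemma distr_row:
  assumes "i < m" "l < p"
  shows "(\<lambda>\<omega>. sample_row n \<omega> (i, l)) \<in> measurable (sample_space D n m p) (row_law D n)"
    and "distr (sample_space D n m p) (row_law D n) (\<lambda>\<omega>. sample_row n \<omega> (i, l)) = row_law D n"
proof -
  show "(\<lambda>\<omega>. sample_row n \<omega> (i, l)) \<in> measurable (sample_space D n m p) (row_law D n)"
    unfolding sample_row_def row_law_def sample_space_def using assms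
    by (intro measurable_restrict measurable_component_singleton) auto
  show "distr (sample_space D n m p) (row_law D n) (\<lambda>\<omega>. sample_row n \<omega> (i, l)) = row_law D n"
    unfolding sample_row_def row_law_def sample_space_def fst_conv snd_conv using assms
    by (intro distr_PiM_reindex[where f = "\<lambda>k. (i, l, k)" and M = "\<lambda>_. D"] prob_space_axioms)
      (auto simp: inj_on_def)
qed

lemma nn_integral_row:
  assumes "i < m" "l < p" and f: "f \<in> borel_measurable (row_law D n)"
  shows "(\<integral>\<^sup>+\<omega>. f (sample_row n \<omega> (i, l)) \<partial>sample_space D n m p) = (\<integral>\<^sup>+a. f a \<partial>row_law D n)"
proof -
  have "f \<in> borel_measurable (distr (sample_space D n m p) (row_law D n) (\<lambda>\<omega>. sample_row n \<omega> (i, l)))"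
    using f by simp
  then have "(\<integral>\<^sup>+a. f a \<partial>distr (sample_space D n m p) (row_law D n) (\<lambda>\<omega>. sample_row n \<omega> (i, l)))
      = (\<integral>\<^sup>+\<omega>. f (sample_row n \<omega> (i, l)) \<partial>sample_space D n m p)"
    by (intro nn_integral_distr distr_row assms) simp
  then show ?thesis by (simp only: distr_row(2)[OF assms(1,2)])
qed

text \<open>Coordinates of a product measure are independent, and different rows read disjoint sets
  of coordinates.\<close>

lemma indep_vars_rows:
  assumes J: "J \<subseteq> {..<m} \<times> {..<p}"
  shows "prob_space.indep_vars (sample_space D n m p) (\<lambda>_. row_law D n) (\<lambda>j \<omega>. sample_row n \<omega> j) J"
proof -
  let ?I = "{..<m} \<times> {..<p} \<times> {..<n}" and ?P = "sample_space D n m p"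
  interpret P: prob_space ?P by (rule prob_space_sample_space)
  have coord: "P.indep_vars (\<lambda>_. D) (\<lambda>q \<omega>. \<omega> q) ?I"
  proof (cases "?I = {}")
    case True
    show ?thesis unfolding True P.indep_vars_def P.indep_sets_def by auto
  next
    case False
    have "distr ?P (PiM ?I (\<lambda>_. D)) (\<lambda>x. \<lambda>q\<in>?I. x q) = distr ?P ?P (\<lambda>x. x)"
    proof (rule distr_cong)
      show "sets (PiM ?I (\<lambda>_. D)) = sets ?P" by (simp add: sample_space_def)
      show "(\<lambda>q\<in>?I. x q) = x" if "x \<in> space ?P" for x
        using that unfolding sample_space_def space_PiM by (rule PiE_restrict)
    qed simp
    also have "\<dots> = ?P" by (rule distr_id)
    also have "\<dots> = PiM ?I (\<lambda>q. distr ?P D (\<lambda>\<omega>. \<omega> q))"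
      unfolding sample_space_def
      by (intro PiM_cong refl distr_PiM_component[symmetric] prob_space_axioms)
    finally show ?thesis
      using False by (subst P.indep_vars_iff_distr_eq_PiM')
        (auto simp: sample_space_def intro!: measurable_component_singleton)
  qed
  define B where "B j = {fst j} \<times> {snd j} \<times> {..<n}" for j :: "nat \<times> nat"
  define Y where "Y j f = (\<lambda>k\<in>{..<n}. f (fst j, snd j, k))" for j :: "nat \<times> nat" and f :: "nat \<times> nat \<times> nat \<Rightarrow> real"
  have "P.indep_vars (\<lambda>j. PiM (B j) (\<lambda>_. D)) (\<lambda>j \<omega>. restrict (\<lambda>q. \<omega> q) (B j)) J"
    using J by (intro P.indep_vars_restrict[OF coord]) (auto simp: B_def disjoint_family_on_def)
  then have "P.indep_vars (\<lambda>_. row_law D n) (\<lambda>j. Y j \<circ> (\<lambda>\<omega>. restrict (\<lambda>q. \<omega> q) (B j))) J"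
  proof (rule P.indep_vars_compose)
    show "Y j \<in> measurable (PiM (B j) (\<lambda>_. D)) (row_law D n)" for j
      unfolding Y_def row_law_def
      by (intro measurable_restrict measurable_component_singleton) (auto simp: B_def)
  qed
  moreover have "(Y j \<circ> (\<lambda>\<omega>. restrict (\<lambda>q. \<omega> q) (B j))) = (\<lambda>\<omega>. sample_row n \<omega> j)" for j
    by (auto simp: Y_def B_def sample_row_def fun_eq_iff)
  ultimately show ?thesis by simp
qed

lemma nn_integral_prod_rows:
  assumes J: "J \<subseteq> {..<m} \<times> {..<p}"
    and F: "\<And>j. j \<in> J \<Longrightarrow> F j \<in> borel_measurable (row_law D n)"
  shows "(\<integral>\<^sup>+\<omega>. (\<Prod>j\<in>J. F j (sample_row n \<omega> j)) \<partial>sample_space D n m p)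
      = (\<Prod>j\<in>J. \<integral>\<^sup>+a. (F j a :: ennreal) \<partial>row_law D n)"
proof -
  interpret P: prob_space "sample_space D n m p" by (rule prob_space_sample_space)
  have "P.indep_vars (\<lambda>_. borel) (\<lambda>j \<omega>. F j (sample_row n \<omega> j)) J"
    using P.indep_vars_compose[OF indep_vars_rows[OF J] F] by (simp add: comp_def)
  moreover have "finite J" using J by (rule finite_subset) simp
  ultimately have "(\<integral>\<^sup>+\<omega>. (\<Prod>j\<in>J. F j (sample_row n \<omega> j)) \<partial>sample_space D n m p)
      = (\<Prod>j\<in>J. \<integral>\<^sup>+\<omega>. F j (sample_row n \<omega> j) \<partial>sample_space D n m p)"
    by (intro P.indep_vars_nn_integral) simp_all
  also have "\<dots> = (\<Prod>j\<in>J. \<integral>\<^sup>+a. F j a \<partial>row_law D n)"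
  proof (rule prod.cong[OF refl])
    fix j assume j: "j \<in> J"
    obtain i l where il: "j = (i, l)" by (cases j)
    then show "(\<integral>\<^sup>+\<omega>. F j (sample_row n \<omega> j) \<partial>sample_space D n m p) = (\<integral>\<^sup>+a. F j a \<partial>row_law D n)"
      using j J F[OF j] nn_integral_row[of i m l p "F j" n] by auto
  qed
  finally show ?thesis .
qed

text \<open>Chernoff's bound. The functions and exponents may depend on the row because the gains
  weight the blocks differently.\<close>

lemma prob_sum_rows_ge:
  assumes J: "J \<subseteq> {..<m} \<times> {..<p}" and s: "0 \<le> s"
    and \<phi>: "\<And>j. j \<in> J \<Longrightarrow> \<phi> j \<in> borel_measurable (row_law D n)"
    and mgf: "\<And>j. j \<in> J \<Longrightarrow> (\<integral>\<^sup>+a. ennreal (exp (s * \<phi> j a)) \<partial>row_law D n) \<le> ennreal (exp (c j))"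
  shows "measure (sample_space D n m p) {\<omega> \<in> space (sample_space D n m p). \<tau> \<le> (\<Sum>j\<in>J. \<phi> j (sample_row n \<omega> j))}
    \<le> exp (- (s * \<tau>) + (\<Sum>j\<in>J. c j))"
proof -
  let ?P = "sample_space D n m p"
  interpret P: prob_space ?P by (rule prob_space_sample_space)
  have fin: "finite J" using J by (rule finite_subset) simp
  define S where "S \<omega> = (\<Sum>j\<in>J. \<phi> j (sample_row n \<omega> j))" for \<omega>
  have [measurable]: "S \<in> borel_measurable ?P"
    unfolding S_def
  proof (rule borel_measurable_sum)
    fix j assume j: "j \<in> J"
    obtain i l where "j = (i, l)" by (cases j)
    then show "(\<lambda>\<omega>. \<phi> j (sample_row n \<omega> j)) \<in> borel_measurable ?P"
      using j J measurable_compose[OF distr_row(1) \<phi>[OF j]] by auto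
  qed
  have "(\<integral>\<^sup>+\<omega>. ennreal (exp (s * S \<omega>)) \<partial>?P) = (\<integral>\<^sup>+\<omega>. (\<Prod>j\<in>J. ennreal (exp (s * \<phi> j (sample_row n \<omega> j)))) \<partial>?P)"
    by (simp add: S_def sum_distrib_left exp_sum fin prod_ennreal)
  also have "\<dots> = (\<Prod>j\<in>J. \<integral>\<^sup>+a. ennreal (exp (s * \<phi> j a)) \<partial>row_law D n)"
    using \<phi> by (intro nn_integral_prod_rows[OF J]) auto
  also have "\<dots> \<le> (\<Prod>j\<in>J. ennreal (exp (c j)))" by (intro prod_mono_ennreal mgf)
  also have "\<dots> = ennreal (exp (\<Sum>j\<in>J. c j))" by (simp add: prod_ennreal exp_sum fin)
  finally have le: "(\<integral>\<^sup>+\<omega>. ennreal (exp (s * S \<omega>)) \<partial>?P) \<le> ennreal (exp (\<Sum>j\<in>J. c j))" .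
  have "emeasure ?P {\<omega> \<in> space ?P. \<tau> \<le> S \<omega>}
      \<le> (\<integral>\<^sup>+\<omega>. ennreal (exp (- (s * \<tau>))) * ennreal (exp (s * S \<omega>)) \<partial>?P)"
  proof -
    have "emeasure ?P {\<omega> \<in> space ?P. \<tau> \<le> S \<omega>} = (\<integral>\<^sup>+\<omega>. indicator {\<omega> \<in> space ?P. \<tau> \<le> S \<omega>} \<omega> \<partial>?P)"
      by (intro nn_integral_indicator[symmetric]) measurable
    also have "\<dots> \<le> (\<integral>\<^sup>+\<omega>. ennreal (exp (- (s * \<tau>))) * ennreal (exp (s * S \<omega>)) \<partial>?P)"
    proof (rule nn_integral_mono)
      fix \<omega>
      show "indicator {\<omega> \<in> space ?P. \<tau> \<le> S \<omega>} \<omega> \<le> ennreal (exp (- (s * \<tau>))) * ennreal (exp (s * S \<omega>))"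
        using s by (auto split: split_indicator intro!: mult_left_mono simp flip: ennreal_mult exp_add)
    qed
    finally show ?thesis .
  qed
  also have "\<dots> = ennreal (exp (- (s * \<tau>))) * (\<integral>\<^sup>+\<omega>. ennreal (exp (s * S \<omega>)) \<partial>?P)"
    by (rule nn_integral_cmult) measurable
  also have "\<dots> \<le> ennreal (exp (- (s * \<tau>))) * ennreal (exp (\<Sum>j\<in>J. c j))" by (intro mult_left_mono le) auto
  also have "\<dots> = ennreal (exp (- (s * \<tau>) + (\<Sum>j\<in>J. c j)))" by (simp flip: ennreal_mult exp_add)
  finally show ?thesis by (simp add: P.emeasure_eq_measure S_def)
qed

lemma prob_abs_sum_rows_ge:
  assumes J: "J \<subseteq> {..<m} \<times> {..<p}" and s: "0 \<le> s"
    and \<phi>: "\<And>j. j \<in> J \<Longrightarrow> \<phi> j \<in> borel_measurable (row_law D n)"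
    and mgf: "\<And>j r. j \<in> J \<Longrightarrow> \<bar>r\<bar> = s \<Longrightarrow> (\<integral>\<^sup>+a. ennreal (exp (r * \<phi> j a)) \<partial>row_law D n) \<le> ennreal (exp (c j))"
  shows "measure (sample_space D n m p) {\<omega> \<in> space (sample_space D n m p). \<tau> \<le> \<bar>\<Sum>j\<in>J. \<phi> j (sample_row n \<omega> j)\<bar>}
    \<le> 2 * exp (- (s * \<tau>) + (\<Sum>j\<in>J. c j))"
proof -
  let ?P = "sample_space D n m p"
  let ?A = "{\<omega> \<in> space ?P. \<tau> \<le> (\<Sum>j\<in>J. \<phi> j (sample_row n \<omega> j))}"
  let ?B = "{\<omega> \<in> space ?P. \<tau> \<le> (\<Sum>j\<in>J. - \<phi> j (sample_row n \<omega> j))}"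
  interpret P: prob_space ?P by (rule prob_space_sample_space)
  have [measurable]: "(\<lambda>\<omega>. \<Sum>j\<in>J. \<phi> j (sample_row n \<omega> j)) \<in> borel_measurable ?P"
  proof (rule borel_measurable_sum)
    fix j assume j: "j \<in> J"
    obtain i l where "j = (i, l)" by (cases j)
    then show "(\<lambda>\<omega>. \<phi> j (sample_row n \<omega> j)) \<in> borel_measurable ?P"
      using j J measurable_compose[OF distr_row(1) \<phi>[OF j]] by auto
  qed
  have eq: "{\<omega> \<in> space ?P. \<tau> \<le> \<bar>\<Sum>j\<in>J. \<phi> j (sample_row n \<omega> j)\<bar>} = ?A \<union> ?B"
    by (auto simp: sum_negf)
  have "measure ?P (?A \<union> ?B) \<le> measure ?P ?A + measure ?P ?B"
    by (intro measure_Un_le) (simp_all add: sum_negf)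
  also have "\<dots> \<le> exp (- (s * \<tau>) + (\<Sum>j\<in>J. c j)) + exp (- (s * \<tau>) + (\<Sum>j\<in>J. c j))"
  proof (rule add_mono)
    show "measure ?P ?A \<le> exp (- (s * \<tau>) + (\<Sum>j\<in>J. c j))"
      using s by (intro prob_sum_rows_ge J \<phi> mgf) auto
    show "measure ?P ?B \<le> exp (- (s * \<tau>) + (\<Sum>j\<in>J. c j))"
      using mgf[of _ "- s"] s by (intro prob_sum_rows_ge J borel_measurable_uminus \<phi>) auto
  qed
  finally show ?thesis by (simp add: eq)
qed

end

text \<open>Arithmetic-geometric mean twice, in the exponent and between the exponentials: products
  of subgaussian variables become subexponential at the same scale.\<close>

lemma exp_abs_mult_le:
  fixes a b q :: real
  assumes "0 < q"
  shows "exp (\<bar>a * b\<bar> / q) \<le> (exp (a\<^sup>2 / q) + exp (b\<^sup>2 / q)) / 2"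
proof -
  have "2 * \<bar>a * b\<bar> \<le> a\<^sup>2 + b\<^sup>2"
    using zero_le_power2[of "\<bar>a\<bar> - \<bar>b\<bar>"] by (simp add: power2_diff abs_mult)
  then have "\<bar>a * b\<bar> / q \<le> a\<^sup>2 / q / 2 + b\<^sup>2 / q / 2" using assms by (simp add: field_simps)
  then have "exp (\<bar>a * b\<bar> / q) \<le> exp (a\<^sup>2 / q / 2) * exp (b\<^sup>2 / q / 2)" by (simp flip: exp_add)
  also have "\<dots> \<le> ((exp (a\<^sup>2 / q / 2))\<^sup>2 + (exp (b\<^sup>2 / q / 2))\<^sup>2) / 2"
    using zero_le_power2[of "exp (a\<^sup>2 / q / 2) - exp (b\<^sup>2 / q / 2)"] by (simp add: power2_diff)
  also have "\<dots> = (exp (a\<^sup>2 / q) + exp (b\<^sup>2 / q)) / 2"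
    by (simp add: power2_eq_square flip: exp_add)
  finally show ?thesis .
qed

section \<open>Moments and exponential bounds for one row\<close>

locale subgaussian_design = random_design D for D +
  fixes K :: real
  assumes K: "1 \<le> K" and psi2: "(\<integral>\<^sup>+u. ennreal (exp (u\<^sup>2 / K\<^sup>2)) \<partial>D) \<le> ennreal 2"
    and mean: "integrable D (\<lambda>u. u)" "(\<integral>u. u \<partial>D) = 0"
    and variance: "integrable D (\<lambda>u. u\<^sup>2)" "(\<integral>u. u\<^sup>2 \<partial>D) = 1"
begin

text \<open>Equal to 8 c for c = 16 K^2, the constant of \<open>mgf_row\<close> for unit vectors:
  the scale at which the square of a unit projection of a row is exponentially integrable.\<close>

definition q :: real where "q = 128 * K\<^sup>2"

lemma q_ge_1: "1 \<le> q"
proof -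
  have "1 \<le> K\<^sup>2" using power_mono[of 1 K 2] K by simp
  then show ?thesis by (simp add: q_def)
qed

lemma borel_measurable_D: "f \<in> borel_measurable borel \<Longrightarrow> f \<in> borel_measurable D"
  using measurable_cong_sets[OF sets_D refl] by blast

lemma borel_measurable_inner_n_row [measurable]: "(\<lambda>a. inner_n n a v) \<in> borel_measurable (row_law D n)"
proof -
  have "(\<lambda>a. a k) \<in> borel_measurable (row_law D n)" if "k < n" for k
  proof -
    have "(\<lambda>a. a k) \<in> measurable (row_law D n) D"
      unfolding row_law_def using that by (intro measurable_component_singleton) auto
    then show ?thesis using measurable_cong_sets[OF refl sets_D] by blast
  qed
  then show ?thesis unfolding inner_n_def by (intro borel_measurable_sum borel_measurable_times) auto
qed

lemma mgf_coordinate: "(\<integral>\<^sup>+u. ennreal (exp (s * u)) \<partial>D) \<le> ennreal (exp (16 * K\<^sup>2 * s\<^sup>2))"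
proof -
  have "(\<integral>\<^sup>+u. ennreal (exp (s * K * (u / K))) \<partial>D) \<le> ennreal (exp (8 * 2 * (s * K)\<^sup>2))"
  proof (rule mgf_le_if_subgaussian)
    show "(\<lambda>u. u / K) \<in> borel_measurable D" by (rule borel_measurable_D) measurable
    show "(\<integral>\<^sup>+u. ennreal (exp ((u / K)\<^sup>2)) \<partial>D) \<le> ennreal 2" unfolding power_divide by (rule psi2)
    show "expectation (\<lambda>u. u / K) = 0" by (simp only: integral_divide_zero mean(2) div_0)
  qed simp
  then show ?thesis using K by (simp add: power_mult_distrib mult_ac)
qed

lemma mgf_row: "(\<integral>\<^sup>+a. ennreal (exp (s * inner_n n a v)) \<partial>row_law D n) \<le> ennreal (exp (16 * K\<^sup>2 * s\<^sup>2 * sqnorm_n n v))"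
proof -
  interpret product_sigma_finite "\<lambda>_ :: nat. D" ..
  have "(\<integral>\<^sup>+a. ennreal (exp (s * inner_n n a v)) \<partial>row_law D n)
      = (\<integral>\<^sup>+a. (\<Prod>k<n. ennreal (exp (s * v k * a k))) \<partial>row_law D n)"
    by (simp add: inner_n_def sum_distrib_left exp_sum prod_ennreal mult_ac)
  also have "\<dots> = (\<Prod>k<n. \<integral>\<^sup>+u. ennreal (exp (s * v k * u)) \<partial>D)"
    unfolding row_law_def by (intro product_nn_integral_prod borel_measurable_D) auto
  also have "\<dots> \<le> (\<Prod>k<n. ennreal (exp (16 * K\<^sup>2 * (s * v k)\<^sup>2)))"
    by (intro prod_mono_ennreal mgf_coordinate)
  also have "\<dots> = ennreal (exp (16 * K\<^sup>2 * s\<^sup>2 * sqnorm_n n v))"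
    by (simp add: prod_ennreal sqnorm_n_def sum_distrib_left power_mult_distrib mult_ac flip: exp_sum)
  finally show ?thesis .
qed

lemma exp_square_row:
  assumes "sqnorm_n n v \<le> 1"
  shows "(\<integral>\<^sup>+a. ennreal (exp ((inner_n n a v)\<^sup>2 / q)) \<partial>row_law D n) \<le> ennreal 2"
proof -
  interpret R: prob_space "row_law D n" by (rule prob_space_row_law)
  have "(\<integral>\<^sup>+a. ennreal (exp (s * inner_n n a v)) \<partial>row_law D n) \<le> ennreal (exp (16 * K\<^sup>2 * s\<^sup>2))" for s
  proof -
    have "16 * K\<^sup>2 * s\<^sup>2 * sqnorm_n n v \<le> 16 * K\<^sup>2 * s\<^sup>2 * 1" using assms by (intro mult_left_mono) auto
    then have "exp (16 * K\<^sup>2 * s\<^sup>2 * sqnorm_n n v) \<le> exp (16 * K\<^sup>2 * s\<^sup>2)"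
      unfolding exp_le_cancel_iff mult_1_right .
    then show ?thesis by (rule order_trans[OF mgf_row ennreal_leI])
  qed
  then show ?thesis
    using R.exp_square_le_if_mgf_le[of "\<lambda>a. inner_n n a v" "16 * K\<^sup>2"] K by (simp add: q_def)
qed

lemma exp_square_row_real:
  assumes "sqnorm_n n v \<le> 1"
  shows "integrable (row_law D n) (\<lambda>a. exp ((inner_n n a v)\<^sup>2 / q))"
    "(\<integral>a. exp ((inner_n n a v)\<^sup>2 / q) \<partial>row_law D n) \<le> 2"
  using integrable_if_nn_integral_le[OF _ _ exp_square_row[OF assms]] by auto

lemma row_covariance:
  shows "integrable (row_law D n) (\<lambda>a. inner_n n a u * inner_n n a v)"
    "(\<integral>a. inner_n n a u * inner_n n a v \<partial>row_law D n) = inner_n n u v"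
proof -
  interpret product_sigma_finite "\<lambda>_ :: nat. D" ..
  have coord: "integrable (row_law D n) (\<lambda>a. a k * a l)"
    "(\<integral>a. a k * a l \<partial>row_law D n) = (if k = l then 1 else 0)" if "k < n" "l < n" for k l
  proof -
    \<comment> \<open>Writes a k * a l as a product with one factor per coordinate, which covers k =
      l and k \<noteq> l at once. A factor has integral 0 exactly when its index is one of two
      distinct indices k and l.\<close>
    define f where "f i z = (if i = k then z else 1) * (if i = l then z else 1)" for i :: nat and z :: real
    have cases: "f i = (if i = k \<and> i = l then (\<lambda>z. z\<^sup>2) else if i = k \<or> i = l then (\<lambda>z. z) else (\<lambda>z. 1))" for i
      by (auto simp: f_def power2_eq_square fun_eq_iff)
    have f: "integrable D (f i)" for i
      unfolding cases by (simp only: mean variance integrable_const split: if_split) simp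
    have int_f: "(\<integral>z. f i z \<partial>D) = (if (i = k) = (i = l) then 1 else 0)" for i
      unfolding cases by (cases "i = k"; cases "i = l") (simp_all only: mean variance prob_space lebesgue_integral_const if_True if_False simp_thms scaleR_one mult_1)
    have prod: "(\<Prod>i<n. f i (a i)) = a k * a l" for a :: "nat \<Rightarrow> real"
      using that by (simp add: f_def prod.distrib prod.delta)
    show "integrable (row_law D n) (\<lambda>a. a k * a l)"
      using product_integrable_prod[of "{..<n}" f] f by (simp add: row_law_def prod)
    have "(\<integral>a. a k * a l \<partial>row_law D n) = (\<Prod>i<n. (if (i = k) = (i = l) then 1 else 0 :: real))"
      using product_integral_prod[of "{..<n}" f] f by (simp add: row_law_def prod int_f)
    also have "\<dots> = (if k = l then 1 else 0)"
    proof (cases "k = l")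
      case False
      then show ?thesis using that by (auto intro!: bexI[of _ k])
    qed simp
    finally show "(\<integral>a. a k * a l \<partial>row_law D n) = (if k = l then 1 else 0)" .
  qed
  have eq: "inner_n n a u * inner_n n a v = (\<Sum>k<n. \<Sum>l<n. u k * v l * (a k * a l))" for a
    by (simp add: inner_n_def sum_product mult_ac)
  show "integrable (row_law D n) (\<lambda>a. inner_n n a u * inner_n n a v)"
    unfolding eq by (rule Bochner_Integration.integrable_sum, rule Bochner_Integration.integrable_sum,
        rule integrable_mult_right, rule coord(1)) auto
  have "(\<integral>a. inner_n n a u * inner_n n a v \<partial>row_law D n)
      = (\<Sum>k<n. \<Sum>l<n. u k * v l * (\<integral>a. a k * a l \<partial>row_law D n))"
  proof -
    have summand: "integrable (row_law D n) (\<lambda>a. u k * v l * (a k * a l))" if "k < n" "l < n" for k l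
      using that by (intro integrable_mult_right coord(1)) auto
    have "(\<integral>a. (\<Sum>l<n. u k * v l * (a k * a l)) \<partial>row_law D n)
        = (\<Sum>l<n. u k * v l * (\<integral>a. a k * a l \<partial>row_law D n))" if "k < n" for k
      using that summand by (subst Bochner_Integration.integral_sum) auto
    moreover have "(\<integral>a. (\<Sum>k<n. \<Sum>l<n. u k * v l * (a k * a l)) \<partial>row_law D n)
        = (\<Sum>k<n. \<integral>a. (\<Sum>l<n. u k * v l * (a k * a l)) \<partial>row_law D n)"
      using summand by (intro Bochner_Integration.integral_sum Bochner_Integration.integrable_sum) auto
    ultimately show ?thesis unfolding eq by simp
  qed
  also have "\<dots> = (\<Sum>k<n. \<Sum>l<n. if k = l then u k * v l else 0)"
    using coord(2) by (intro sum.cong) auto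
  also have "\<dots> = inner_n n u v" by (simp add: inner_n_def)
  finally show "(\<integral>a. inner_n n a u * inner_n n a v \<partial>row_law D n) = inner_n n u v" .
qed

text \<open>24 is 4 * 6 from \<open>mgf_le_if_subexponential\<close>. The 6 is 3 * 2: centring costs
  exp 1 <= 3, and each square exponential moment is at most 2.\<close>

lemma mgf_row_product:
  assumes u: "sqnorm_n n u \<le> 1" and v: "sqnorm_n n v \<le> 1" and s: "\<bar>s\<bar> \<le> 1 / 2"
  shows "(\<integral>\<^sup>+a. ennreal (exp (s * ((inner_n n a u * inner_n n a v - inner_n n u v) / q))) \<partial>row_law D n)
    \<le> ennreal (exp (24 * s\<^sup>2))"
proof -
  let ?R = "row_law D n"
  interpret R: prob_space ?R by (rule prob_space_row_law)
  let ?W = "\<lambda>a. (inner_n n a u * inner_n n a v - inner_n n u v) / q"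
  have uv: "\<bar>inner_n n u v\<bar> \<le> 1"
  proof -
    have "sqrt (sqnorm_n n u) * sqrt (sqnorm_n n v) \<le> 1 * 1"
      using u v by (intro mult_mono) auto
    then show ?thesis using abs_inner_n_le[of n u v] by linarith
  qed
  have pw: "exp \<bar>?W a\<bar> \<le> 3 / 2 * exp ((inner_n n a u)\<^sup>2 / q) + 3 / 2 * exp ((inner_n n a v)\<^sup>2 / q)" for a
  proof -
    have "\<bar>?W a\<bar> = \<bar>inner_n n a u * inner_n n a v - inner_n n u v\<bar> / q" using q_ge_1 by simp
    also have "\<dots> \<le> (\<bar>inner_n n a u * inner_n n a v\<bar> + 1) / q"
      using uv q_ge_1 by (intro divide_right_mono) auto
    also have "\<dots> \<le> 1 + \<bar>inner_n n a u * inner_n n a v\<bar> / q"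
      using q_ge_1 by (simp add: field_simps)
    finally have "exp \<bar>?W a\<bar> \<le> exp 1 * exp (\<bar>inner_n n a u * inner_n n a v\<bar> / q)"
      by (simp flip: exp_add)
    also have "\<dots> \<le> 3 * ((exp ((inner_n n a u)\<^sup>2 / q) + exp ((inner_n n a v)\<^sup>2 / q)) / 2)"
      using exp_le q_ge_1 by (intro mult_mono exp_abs_mult_le) auto
    finally show ?thesis by (simp add: algebra_simps)
  qed
  have "(\<integral>\<^sup>+a. ennreal (exp \<bar>?W a\<bar>) \<partial>?R)
      \<le> (\<integral>\<^sup>+a. ennreal (3 / 2) * ennreal (exp ((inner_n n a u)\<^sup>2 / q)) + ennreal (3 / 2) * ennreal (exp ((inner_n n a v)\<^sup>2 / q)) \<partial>?R)"
    using pw by (intro nn_integral_mono) (simp add: ennreal_leI flip: ennreal_mult ennreal_plus)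
  also have "\<dots> = ennreal (3 / 2) * (\<integral>\<^sup>+a. ennreal (exp ((inner_n n a u)\<^sup>2 / q)) \<partial>?R)
      + ennreal (3 / 2) * (\<integral>\<^sup>+a. ennreal (exp ((inner_n n a v)\<^sup>2 / q)) \<partial>?R)"
    by (subst nn_integral_add) (auto simp: nn_integral_cmult)
  also have "\<dots> \<le> ennreal (3 / 2) * ennreal 2 + ennreal (3 / 2) * ennreal 2"
    using u v by (intro add_mono mult_left_mono exp_square_row) auto
  also have "\<dots> = ennreal 6" by (simp flip: ennreal_mult ennreal_plus del: ennreal_numeral)
  finally have B: "(\<integral>\<^sup>+a. ennreal (exp \<bar>?W a\<bar>) \<partial>?R) \<le> ennreal 6" .
  have "R.expectation ?W = 0"
    using row_covariance[of n u v] by (simp add: R.prob_space)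
  then show ?thesis using R.mgf_le_if_subexponential[OF _ B _ _ s] by simp
qed

text \<open>Only the factor along \<open>x\<close> is truncated. The product is then dominated by T
  times a subgaussian variable, and large rows have to be excluded in one direction only, by a union
  over rows rather than over the grid.\<close>

definition truncated_product :: "nat \<Rightarrow> real \<Rightarrow> (nat \<Rightarrow> real) \<Rightarrow> (nat \<Rightarrow> real) \<Rightarrow> (nat \<Rightarrow> real) \<Rightarrow> real" where
  "truncated_product n T x v a = (if \<bar>inner_n n a x\<bar> \<le> T then inner_n n a x * inner_n n a v else 0)"

lemma borel_measurable_truncated_product [measurable]:
  "truncated_product n T x v \<in> borel_measurable (row_law D n)"
  unfolding truncated_product_def[abs_def] by measurable

lemma abs_truncated_product_le: "0 \<le> T \<Longrightarrow> \<bar>truncated_product n T x v a\<bar> \<le> T * \<bar>inner_n n a v\<bar>"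
  by (auto simp: truncated_product_def abs_mult mult_right_mono)

lemma integrable_truncated_product: "integrable (row_law D n) (truncated_product n T x v)"
  by (rule Bochner_Integration.integrable_bound[OF row_covariance(1)[of n x v]])
    (auto simp: truncated_product_def)

lemma expectation_truncated_product_le:
  assumes v: "sqnorm_n n v \<le> 1" and T: "0 \<le> T"
  shows "\<bar>\<integral>a. truncated_product n T x v a \<partial>row_law D n\<bar> \<le> T"
proof -
  let ?R = "row_law D n"
  interpret R: prob_space ?R by (rule prob_space_row_law)
  have sq: "integrable ?R (\<lambda>a. (inner_n n a v)\<^sup>2)" "(\<integral>a. (inner_n n a v)\<^sup>2 \<partial>?R) = sqnorm_n n v"
    using row_covariance[of n v v] by (simp_all add: power2_eq_square sqnorm_n_eq_inner_n)
  have "\<bar>\<integral>a. truncated_product n T x v a \<partial>?R\<bar> \<le> (\<integral>a. \<bar>truncated_product n T x v a\<bar> \<partial>?R)"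
    by (rule integral_abs_bound)
  also have "\<dots> \<le> (\<integral>a. T * ((1 + (inner_n n a v)\<^sup>2) / 2) \<partial>?R)"
  proof (rule integral_mono)
    fix a
    have "\<bar>inner_n n a v\<bar> \<le> (1 + (inner_n n a v)\<^sup>2) / 2"
      using zero_le_power2[of "\<bar>inner_n n a v\<bar> - 1"] by (simp add: power2_diff)
    then show "\<bar>truncated_product n T x v a\<bar> \<le> T * ((1 + (inner_n n a v)\<^sup>2) / 2)"
      using abs_truncated_product_le[OF T, of n x v a] T by (meson mult_left_mono order_trans)
  qed (use sq integrable_truncated_product in auto)
  also have "\<dots> = T * ((1 + sqnorm_n n v) / 2)"
    using sq by (simp add: R.prob_space)
  also have "\<dots> \<le> T * 1" using v T by (intro mult_left_mono) auto
  finally show ?thesis by simp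
qed

lemma mgf_truncated_product:
  assumes v: "sqnorm_n n v \<le> 1" and T: "0 < T"
  shows "(\<integral>\<^sup>+a. ennreal (exp (s * (truncated_product n T x v a - (\<integral>b. truncated_product n T x v b \<partial>row_law D n)))) \<partial>row_law D n)
    \<le> ennreal (exp (128 * q * T\<^sup>2 * s\<^sup>2))"
proof -
  let ?R = "row_law D n"
  interpret R: prob_space ?R by (rule prob_space_row_law)
  define Y where "Y = truncated_product n T x v"
  define E where "E = (\<integral>b. Y b \<partial>?R)"
  \<comment> \<open>At this scale the square is at most (a . v)^2/q + 1/2, so its exponential moment
    stays below 4, and 8 * 4 * c^2 gives 128 q T^2.\<close>
  define c where "c = 2 * T * sqrt q"
  have c: "c\<^sup>2 = 4 * T\<^sup>2 * q" "c > 0" using q_ge_1 T by (simp_all add: c_def power_mult_distrib)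
  have [measurable]: "Y \<in> borel_measurable ?R" by (simp add: Y_def)
  have pw: "exp (((Y a - E) / c)\<^sup>2) \<le> 2 * exp ((inner_n n a v)\<^sup>2 / q)" for a
  proof -
    have "\<bar>E\<bar> \<le> T" unfolding E_def Y_def using expectation_truncated_product_le v T by simp
    then have E: "E\<^sup>2 \<le> T\<^sup>2" using T by (simp add: power2_le_iff_abs_le)
    have "\<bar>Y a\<bar>\<^sup>2 \<le> (T * \<bar>inner_n n a v\<bar>)\<^sup>2"
      unfolding Y_def using abs_truncated_product_le T by (intro power_mono) auto
    then have Y: "(Y a)\<^sup>2 \<le> T\<^sup>2 * (inner_n n a v)\<^sup>2" by (simp add: power_mult_distrib)
    have "(Y a - E)\<^sup>2 \<le> 2 * (Y a)\<^sup>2 + 2 * E\<^sup>2"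
      using zero_le_power2[of "Y a + E"] by (simp add: power2_diff power2_sum)
    also have "\<dots> \<le> T\<^sup>2 * (2 * (inner_n n a v)\<^sup>2 + 2)" using E Y by (simp add: algebra_simps)
    finally have "((Y a - E) / c)\<^sup>2 \<le> T\<^sup>2 * (2 * (inner_n n a v)\<^sup>2 + 2) / (4 * T\<^sup>2 * q)"
      unfolding power_divide c(1) using q_ge_1 by (intro divide_right_mono) auto
    also have "\<dots> = (inner_n n a v)\<^sup>2 / q / 2 + 1 / q / 2" using T q_ge_1 by (simp add: field_simps)
    also have "\<dots> \<le> (inner_n n a v)\<^sup>2 / q + 1 / 2"
      using q_ge_1 by (intro add_mono) (auto simp: field_simps)
    finally have "exp (((Y a - E) / c)\<^sup>2) \<le> exp ((inner_n n a v)\<^sup>2 / q) * exp (1 / 2)"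
      by (simp flip: exp_add)
    also have "\<dots> \<le> exp ((inner_n n a v)\<^sup>2 / q) * 2"
      using exp_bound_half[of "1 / 2 :: real"] by (intro mult_left_mono) auto
    finally show ?thesis by simp
  qed
  have "(\<integral>\<^sup>+a. ennreal (exp (((Y a - E) / c)\<^sup>2)) \<partial>?R) \<le> (\<integral>\<^sup>+a. ennreal 2 * ennreal (exp ((inner_n n a v)\<^sup>2 / q)) \<partial>?R)"
    using pw by (intro nn_integral_mono, subst ennreal_mult[symmetric]) (auto intro: ennreal_leI)
  also have "\<dots> = ennreal 2 * (\<integral>\<^sup>+a. ennreal (exp ((inner_n n a v)\<^sup>2 / q)) \<partial>?R)"
    by (rule nn_integral_cmult) measurable
  also have "\<dots> \<le> ennreal 2 * ennreal 2" by (intro mult_left_mono exp_square_row v) auto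
  also have "\<dots> = ennreal 4" by (simp flip: ennreal_mult del: ennreal_numeral)
  finally have B: "(\<integral>\<^sup>+a. ennreal (exp (((Y a - E) / c)\<^sup>2)) \<partial>?R) \<le> ennreal 4" .
  have "R.expectation (\<lambda>a. (Y a - E) / c) = 0"
    using integrable_truncated_product[of n T x v] by (simp add: E_def Y_def R.prob_space)
  then have "(\<integral>\<^sup>+a. ennreal (exp (s * c * ((Y a - E) / c))) \<partial>?R) \<le> ennreal (exp (8 * 4 * (s * c)\<^sup>2))"
    by (intro R.mgf_le_if_subgaussian B) auto
  then show ?thesis using c(2) by (simp add: power_mult_distrib c Y_def E_def mult_ac)
qed

text \<open>Where |a . x| > T, one factor exp((a . x)^2/(2q)) pays for exp(-T^2/(2q)). What is left
  stays integrable because exponents up to (a . x)^2/q and (a . v)^2/q are available.\<close>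

lemma truncation_bias:
  assumes x: "sqnorm_n n x \<le> 1" and v: "sqnorm_n n v \<le> 1" and T: "0 \<le> T"
  shows "\<bar>(\<integral>a. truncated_product n T x v a \<partial>row_law D n) - inner_n n x v\<bar> \<le> 4 * q * exp (- (T\<^sup>2) / (2 * q))"
proof -
  let ?R = "row_law D n"
  interpret R: prob_space ?R by (rule prob_space_row_law)
  let ?b = "exp (- (T\<^sup>2) / (2 * q))"
  let ?X = "\<lambda>a. exp ((inner_n n a x)\<^sup>2 / q)" and ?V = "\<lambda>a. exp ((inner_n n a v)\<^sup>2 / q)"
  have q: "q > 0" using q_ge_1 by simp
  have pw: "\<bar>truncated_product n T x v a - inner_n n a x * inner_n n a v\<bar> \<le> q * ?b * (3 / 2 * ?X a + 1 / 2 * ?V a)" for a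
  proof (cases "\<bar>inner_n n a x\<bar> \<le> T")
    case True
    then show ?thesis using q by (simp add: truncated_product_def)
  next
    case False
    define y z where "y = (inner_n n a x)\<^sup>2 / (2 * q)" and "z = (inner_n n a v)\<^sup>2 / (2 * q)"
    have yz: "(inner_n n a x)\<^sup>2 = 2 * q * y" "(inner_n n a v)\<^sup>2 = 2 * q * z" "0 \<le> y" "0 \<le> z"
      using q by (simp_all add: y_def z_def)
    have "T\<^sup>2 \<le> \<bar>inner_n n a x\<bar>\<^sup>2" using False T by (intro power_mono) auto
    then have "T\<^sup>2 / (2 * q) \<le> y" using q by (simp add: y_def divide_right_mono)
    then have 1: "1 \<le> ?b * exp y" by (simp flip: exp_add)
    have "2 * (\<bar>inner_n n a x\<bar> * \<bar>inner_n n a v\<bar>) \<le> (inner_n n a x)\<^sup>2 + (inner_n n a v)\<^sup>2"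
      using zero_le_power2[of "\<bar>inner_n n a x\<bar> - \<bar>inner_n n a v\<bar>"] by (simp add: power2_diff)
    then have "\<bar>inner_n n a x * inner_n n a v\<bar> \<le> q * (y + z)"
      using yz by (simp add: abs_mult algebra_simps)
    also have "\<dots> \<le> q * (exp y + exp z)"
      using exp_ge_add_one_self[of y] exp_ge_add_one_self[of z] q by (intro mult_left_mono) linarith+
    also have "\<dots> \<le> q * (exp y + exp z) * (?b * exp y)"
      using mult_left_mono[OF 1, of "q * (exp y + exp z)"] q by simp
    also have "\<dots> = q * ?b * (exp y * exp y + exp y * exp z)" by (simp add: algebra_simps)
    also have "\<dots> \<le> q * ?b * (exp y * exp y + (exp y * exp y + exp z * exp z) / 2)"
      using zero_le_power2[of "exp y - exp z"] q
      by (intro mult_left_mono add_left_mono) (auto simp: power2_eq_square algebra_simps)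
    also have "exp y * exp y = ?X a" using q by (simp add: y_def flip: exp_add)
    also have "exp z * exp z = ?V a" using q by (simp add: z_def flip: exp_add)
    also have "q * ?b * (?X a + (?X a + ?V a) / 2) = q * ?b * (3 / 2 * ?X a + 1 / 2 * ?V a)"
      by (simp add: field_simps)
    finally show ?thesis using False by (simp add: truncated_product_def)
  qed
  have "\<bar>(\<integral>a. truncated_product n T x v a \<partial>?R) - inner_n n x v\<bar>
      = \<bar>\<integral>a. truncated_product n T x v a - inner_n n a x * inner_n n a v \<partial>?R\<bar>"
    using row_covariance[of n x v] integrable_truncated_product by simp
  also have "\<dots> \<le> (\<integral>a. \<bar>truncated_product n T x v a - inner_n n a x * inner_n n a v\<bar> \<partial>?R)"
    by (rule integral_abs_bound)
  also have "\<dots> \<le> (\<integral>a. q * ?b * (3 / 2 * ?X a + 1 / 2 * ?V a) \<partial>?R)"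
    using row_covariance[of n x v] integrable_truncated_product exp_square_row_real(1)[OF x] exp_square_row_real(1)[OF v]
    by (intro integral_mono pw) auto
  also have "\<dots> = q * ?b * (3 / 2 * (\<integral>a. ?X a \<partial>?R) + 1 / 2 * (\<integral>a. ?V a \<partial>?R))"
    using exp_square_row_real(1)[OF x] exp_square_row_real(1)[OF v] by simp
  also have "\<dots> \<le> q * ?b * (3 / 2 * 2 + 1 / 2 * 2)"
    using exp_square_row_real(2)[OF x] exp_square_row_real(2)[OF v] q
    by (intro mult_left_mono add_mono) auto
  finally show ?thesis by (simp add: mult_ac)
qed

end

section \<open>Grids and bilinear forms\<close>

text \<open>A grid of mesh \<open>1 / (4 sqrt n)\<close> in the unit ball. Rounding towards the origin stays in the
ball, and the number of grid points is bounded by weighting an integer vector \<open>z\<close> with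
\<open>2 ^ (16 n - (\<Sum>k. \<bar>z k\<bar>)) \<ge> 1\<close>.\<close>

definition int_grid :: "nat \<Rightarrow> (nat \<Rightarrow> int) set" where
  "int_grid n = {z \<in> {..<n} \<rightarrow>\<^sub>E {- int (16 * n)..int (16 * n)}. (\<Sum>k<n. (z k)\<^sup>2) \<le> int (16 * n)}"

definition grid :: "nat \<Rightarrow> (nat \<Rightarrow> real) set" where
  "grid n = (\<lambda>z k. real_of_int (z k) / (4 * sqrt n)) ` int_grid n"

lemma sum_half_power_int: "(\<Sum>j\<in>{- int R..int R}. (1 / 2 :: real) ^ nat \<bar>j\<bar>) = 3 - 2 * (1 / 2) ^ R"
proof (induction R)
  case (Suc R)
  have "{- int (Suc R)..int (Suc R)} = insert (- int (Suc R)) (insert (int (Suc R)) {- int R..int R})"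
    by auto
  then have "(\<Sum>j\<in>{- int (Suc R)..int (Suc R)}. (1 / 2 :: real) ^ nat \<bar>j\<bar>)
      = (1 / 2) ^ Suc R + ((1 / 2) ^ Suc R + (\<Sum>j\<in>{- int R..int R}. (1 / 2) ^ nat \<bar>j\<bar>))"
    by (simp add: nat_add_distrib)
  then show ?case using Suc by simp
qed simp

lemma finite_int_grid: "finite (int_grid n)"
proof (rule finite_subset)
  show "int_grid n \<subseteq> {..<n} \<rightarrow>\<^sub>E {- int (16 * n)..int (16 * n)}" by (auto simp: int_grid_def)
qed (simp add: finite_PiE)

lemma card_int_grid: "real (card (int_grid n)) \<le> (3 * 2 ^ 16) ^ n"
proof -
  let ?box = "{- int (16 * n)..int (16 * n)}"
  \<comment> \<open>The weight is spread evenly over the coordinates, so the sum over the box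
    factorises; each factor is at most 3 * 2^16.\<close>
  let ?f = "\<lambda>j :: int. 2 ^ 16 * (1 / 2 :: real) ^ nat \<bar>j\<bar>"
  have "real (card (int_grid n)) = (\<Sum>z\<in>int_grid n. 1)" by simp
  also have "\<dots> \<le> (\<Sum>z\<in>int_grid n. \<Prod>k<n. ?f (z k))"
  proof (rule sum_mono)
    fix z assume z: "z \<in> int_grid n"
    \<comment> \<open>On integers |z| <= z^2, so the Euclidean constraint also bounds the sum of
      absolute values.\<close>
    have "int (\<Sum>k<n. nat \<bar>z k\<bar>) = (\<Sum>k<n. \<bar>z k\<bar>)" by simp
    also have "\<dots> \<le> (\<Sum>k<n. (z k)\<^sup>2)"
    proof (rule sum_mono)
      fix k
      show "\<bar>z k\<bar> \<le> (z k)\<^sup>2"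
        using mult_left_mono[of 1 "\<bar>z k\<bar>" "\<bar>z k\<bar>"] by (cases "z k = 0") (auto simp: power2_eq_square abs_mult_self_eq)
    qed
    also have "\<dots> \<le> int (16 * n)" using z by (simp add: int_grid_def)
    finally have le: "(\<Sum>k<n. nat \<bar>z k\<bar>) \<le> 16 * n" by linarith
    have "(1 :: real) \<le> 2 ^ (16 * n) * (1 / 2) ^ (\<Sum>k<n. nat \<bar>z k\<bar>)"
      using power_increasing[OF le, of "2 :: real"] by (simp add: power_divide field_simps)
    also have "\<dots> = (\<Prod>k<n. ?f (z k))" by (simp only: prod.distrib power_mult power_sum prod_constant card_lessThan)
    finally show "1 \<le> (\<Prod>k<n. ?f (z k))" .
  qed
  also have "\<dots> \<le> (\<Sum>z\<in>{..<n} \<rightarrow>\<^sub>E ?box. \<Prod>k<n. ?f (z k))"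
  proof (rule sum_mono2)
    show "finite ({..<n} \<rightarrow>\<^sub>E ?box)" by (intro finite_PiE) auto
    show "int_grid n \<subseteq> {..<n} \<rightarrow>\<^sub>E ?box" unfolding int_grid_def by (rule Collect_restrict)
  qed (intro prod_nonneg, simp)
  also have "\<dots> = (\<Prod>k<n. \<Sum>j\<in>?box. ?f j)"
    by (rule prod_sum_PiE[symmetric]) auto
  also have "\<dots> = (2 ^ 16 * (\<Sum>j\<in>?box. (1 / 2) ^ nat \<bar>j\<bar>)) ^ n"
    by (simp only: sum_distrib_left prod_constant card_lessThan)
  also have "\<dots> \<le> (2 ^ 16 * 3) ^ n"
  proof (intro power_mono mult_left_mono mult_nonneg_nonneg sum_nonneg)
    show "(\<Sum>j\<in>?box. (1 / 2 :: real) ^ nat \<bar>j\<bar>) \<le> 3"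
      unfolding sum_half_power_int[of "16 * n"] by (simp only: diff_le_eq le_add_same_cancel1) simp
  qed simp_all
  finally show ?thesis by (simp add: mult.commute)
qed

lemma finite_grid: "finite (grid n)"
  by (simp add: grid_def finite_int_grid)

lemma card_grid: "real (card (grid n)) \<le> (3 * 2 ^ 16) ^ n"
  using card_image_le[OF finite_int_grid[of n], of "\<lambda>z k. real_of_int (z k) / (4 * sqrt n)"] card_int_grid[of n]
  unfolding grid_def by linarith

lemma grid_in_ball:
  assumes "e \<in> grid n" "0 < n"
  shows "sqnorm_n n e \<le> 1"
proof -
  obtain z where z: "z \<in> int_grid n" "e = (\<lambda>k. real_of_int (z k) / (4 * sqrt n))"
    using assms by (auto simp: grid_def)
  have "real_of_int (\<Sum>k<n. (z k)\<^sup>2) \<le> real_of_int (int (16 * n))"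
    using z(1) unfolding int_grid_def of_int_le_iff by simp
  then have "(\<Sum>k<n. (real_of_int (z k))\<^sup>2) \<le> 16 * real n" by simp
  moreover have "sqnorm_n n e = (\<Sum>k<n. (real_of_int (z k))\<^sup>2) / (16 * n)"
    using assms(2) by (simp add: sqnorm_n_def z(2) power_divide power_mult_distrib sum_divide_distrib)
  ultimately show ?thesis using assms(2) by simp
qed

lemma grid_approx:
  assumes v: "sqnorm_n n v \<le> 1" and n: "0 < n"
  obtains e where "e \<in> grid n" "sqnorm_n n (\<lambda>k. v k - e k) \<le> 1 / 16"
proof -
  let ?s = "4 * sqrt (real n)"
  have s: "?s > 0" "?s\<^sup>2 = 16 * n" using n by (auto simp: power_mult_distrib)
  \<comment> \<open>Rounding towards zero: floor on one side, ceiling on the other. An error of at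
    most 1 per coordinate becomes n / (16 n) after rescaling.\<close>
  have "\<exists>j :: int. \<bar>real_of_int j\<bar> \<le> \<bar>r\<bar> \<and> \<bar>r - real_of_int j\<bar> \<le> 1" for r :: real
  proof (cases "0 \<le> r")
    case True
    then have "0 \<le> real_of_int \<lfloor>r\<rfloor>" by simp
    then show ?thesis using floor_correct[of r] by (intro exI[of _ "\<lfloor>r\<rfloor>"] conjI) linarith+
  next
    case False
    then have "real_of_int \<lceil>r\<rceil> \<le> 0" by simp
    then show ?thesis using False ceiling_correct[of r] by (intro exI[of _ "\<lceil>r\<rceil>"] conjI) linarith+
  qed
  then obtain rnd :: "real \<Rightarrow> int" where rnd: "\<And>r. \<bar>real_of_int (rnd r)\<bar> \<le> \<bar>r\<bar>" "\<And>r. \<bar>r - real_of_int (rnd r)\<bar> \<le> 1"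
    by metis
  define z where "z = (\<lambda>k\<in>{..<n}. rnd (v k * ?s))"
  have sq: "(real_of_int (z k))\<^sup>2 \<le> 16 * n * (v k)\<^sup>2" if "k < n" for k
  proof -
    have "\<bar>real_of_int (z k)\<bar>\<^sup>2 \<le> \<bar>v k * ?s\<bar>\<^sup>2" using rnd(1) that unfolding z_def by (intro power_mono) auto
    then show ?thesis by (simp add: power_mult_distrib mult_ac)
  qed
  have "(\<Sum>k<n. (real_of_int (z k))\<^sup>2) \<le> (\<Sum>k<n. 16 * n * (v k)\<^sup>2)" using sq by (intro sum_mono) auto
  also have "\<dots> = 16 * real n * sqnorm_n n v" by (simp add: sqnorm_n_def sum_distrib_left)
  also have "\<dots> \<le> 16 * real n * 1" using v by (intro mult_left_mono) auto
  finally have "real_of_int (\<Sum>k<n. (z k)\<^sup>2) \<le> real_of_int (int (16 * n))" by simp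
  then have zz: "(\<Sum>k<n. (z k)\<^sup>2) \<le> int (16 * n)" unfolding of_int_le_iff .
  have "z k \<in> {- int (16 * n)..int (16 * n)}" if "k < n" for k
  proof -
    have "(z k)\<^sup>2 \<le> (\<Sum>k<n. (z k)\<^sup>2)" using that by (intro member_le_sum) auto
    moreover have "\<bar>z k\<bar> \<le> (z k)\<^sup>2"
      using mult_left_mono[of 1 "\<bar>z k\<bar>" "\<bar>z k\<bar>"] by (cases "z k = 0") (auto simp: power2_eq_square abs_mult_self_eq)
    ultimately show ?thesis using zz by auto
  qed
  then have "z \<in> int_grid n" using zz by (auto simp: int_grid_def z_def)
  moreover have "sqnorm_n n (\<lambda>k. v k - real_of_int (z k) / ?s) \<le> 1 / 16"
  proof -
    have "(v k - real_of_int (z k) / ?s)\<^sup>2 \<le> 1 / (16 * n)" if "k < n" for k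
    proof -
      have "v k - real_of_int (z k) / ?s = (v k * ?s - real_of_int (rnd (v k * ?s))) / ?s"
        using s(1) that by (simp add: z_def diff_divide_distrib)
      then have "(v k - real_of_int (z k) / ?s)\<^sup>2 = \<bar>v k * ?s - real_of_int (rnd (v k * ?s))\<bar>\<^sup>2 / (16 * n)"
        by (simp only: power_divide s(2) power2_abs)
      also have "\<dots> \<le> 1\<^sup>2 / (16 * n)"
        using rnd(2)[of "v k * ?s"] by (intro divide_right_mono power_mono) auto
      finally show ?thesis by simp
    qed
    then have "sqnorm_n n (\<lambda>k. v k - real_of_int (z k) / ?s) \<le> (\<Sum>k<n. 1 / (16 * n))"
      unfolding sqnorm_n_def by (intro sum_mono) auto
    then show ?thesis using n by simp
  qed
  ultimately show thesis using that by (auto simp: grid_def)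
qed

section \<open>Bilinear forms controlled on a grid\<close>

definition bilin :: "nat \<Rightarrow> nat \<Rightarrow> (nat \<Rightarrow> nat \<Rightarrow> real) \<Rightarrow> (nat \<Rightarrow> real) \<Rightarrow> (nat \<Rightarrow> real) \<Rightarrow> real" where
  "bilin m n A e h = (\<Sum>i<m. \<Sum>k<n. A i k * e i * h k)"

lemma bilin_diff_left: "bilin m n A (\<lambda>i. e i - e' i) h = bilin m n A e h - bilin m n A e' h"
  by (simp add: bilin_def algebra_simps sum_subtractf)

lemma bilin_diff_right: "bilin m n A e (\<lambda>k. h k - h' k) = bilin m n A e h - bilin m n A e h'"
  by (simp add: bilin_def algebra_simps sum_subtractf)

lemma bilin_scale: "bilin m n A (\<lambda>i. c * e i) (\<lambda>k. d * h k) = c * d * bilin m n A e h"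
  by (simp add: bilin_def sum_distrib_left mult_ac)

lemma abs_le_1_if_sqnorm_n_le_1:
  assumes "sqnorm_n n e \<le> 1" "k < n"
  shows "\<bar>e k\<bar> \<le> 1"
proof -
  have "(e k)\<^sup>2 \<le> sqnorm_n n e" unfolding sqnorm_n_def using assms(2) by (intro member_le_sum) auto
  then have "(e k)\<^sup>2 \<le> 1" using assms(1) by linarith
  then show ?thesis by (simp add: abs_square_le_1)
qed

text \<open>Replacing \<open>e\<close> and \<open>h\<close> by grid points leaves two forms with one
  argument in a ball of radius 1/4, so the supremum S satisfies S <= \<tau> + S/4 + S/4. Solving for
  S requires it to be finite, hence the crude bound first.\<close>

lemma bilin_le_on_ball_if_on_grid:
  assumes m: "0 < m" and n: "0 < n"
    and net: "\<And>e h. e \<in> grid m \<Longrightarrow> h \<in> grid n \<Longrightarrow> \<bar>bilin m n A e h\<bar> \<le> \<tau>"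
    and "sqnorm_n m e \<le> 1" "sqnorm_n n h \<le> 1"
  shows "\<bar>bilin m n A e h\<bar> \<le> 2 * \<tau>"
proof -
  let ?V = "{\<bar>bilin m n A e h\<bar> |e h. sqnorm_n m e \<le> 1 \<and> sqnorm_n n h \<le> 1}"
  have bdd: "bdd_above ?V"
  proof (rule bdd_aboveI)
    fix y assume "y \<in> ?V"
    then obtain e h where eh: "y = \<bar>bilin m n A e h\<bar>" "sqnorm_n m e \<le> 1" "sqnorm_n n h \<le> 1" by auto
    have "\<bar>bilin m n A e h\<bar> \<le> (\<Sum>i<m. \<Sum>k<n. \<bar>A i k * e i * h k\<bar>)"
      unfolding bilin_def by (intro order_trans[OF sum_abs] sum_mono sum_abs)
    also have "\<dots> \<le> (\<Sum>i<m. \<Sum>k<n. \<bar>A i k\<bar>)"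
    proof (intro sum_mono)
      fix i k assume "i \<in> {..<m}" "k \<in> {..<n}"
      then have "\<bar>A i k\<bar> * \<bar>e i\<bar> * \<bar>h k\<bar> \<le> \<bar>A i k\<bar> * 1 * 1"
        using eh abs_le_1_if_sqnorm_n_le_1 by (intro mult_mono) auto
      then show "\<bar>A i k * e i * h k\<bar> \<le> \<bar>A i k\<bar>" by (simp add: abs_mult)
    qed
    finally show "y \<le> (\<Sum>i<m. \<Sum>k<n. \<bar>A i k\<bar>)" using eh by simp
  qed
  define S where "S = Sup ?V"
  have le_S: "\<bar>bilin m n A e h\<bar> \<le> S" if "sqnorm_n m e \<le> 1" "sqnorm_n n h \<le> 1" for e h
    unfolding S_def using that by (intro cSup_upper bdd) blast
  have "S \<le> \<tau> + S / 2"
    unfolding S_def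
  proof (rule cSup_least)
    show "?V \<noteq> {}" using assms(4,5) by blast
  next
    fix y assume "y \<in> ?V"
    then obtain e h where eh: "y = \<bar>bilin m n A e h\<bar>" "sqnorm_n m e \<le> 1" "sqnorm_n n h \<le> 1" by auto
    obtain e' where e': "e' \<in> grid m" "sqnorm_n m (\<lambda>k. e k - e' k) \<le> 1 / 16" using grid_approx[OF eh(2) m] .
    obtain h' where h': "h' \<in> grid n" "sqnorm_n n (\<lambda>k. h k - h' k) \<le> 1 / 16" using grid_approx[OF eh(3) n] .
    have 1: "\<bar>bilin m n A (\<lambda>i. 4 * (e i - e' i)) (\<lambda>k. 1 * h k)\<bar> \<le> S"
      using e' eh by (intro le_S) (simp_all only: sqnorm_n_scale, simp_all)
    have 2: "\<bar>bilin m n A (\<lambda>i. 1 * e' i) (\<lambda>k. 4 * (h k - h' k))\<bar> \<le> S"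
      using h' grid_in_ball[OF e'(1) m] by (intro le_S) (simp_all only: sqnorm_n_scale, simp_all)
    have "bilin m n A e h = bilin m n A e' h' + bilin m n A (\<lambda>i. e i - e' i) h + bilin m n A e' (\<lambda>k. h k - h' k)"
      by (simp add: bilin_diff_left bilin_diff_right)
    moreover have "\<bar>bilin m n A e' h'\<bar> \<le> \<tau>" using net e' h' by blast
    ultimately have "y \<le> \<tau> + S / 2" using 1 2 unfolding bilin_scale eh(1) by (simp add: abs_mult)
    then show "y \<le> \<tau> + Sup ?V / 2" by (simp add: S_def)
  qed
  then show ?thesis using le_S[OF assms(4,5)] by linarith
qed

lemma bilin_le_if_on_grid:
  assumes m: "0 < m" and n: "0 < n"
    and net: "\<And>e h. e \<in> grid m \<Longrightarrow> h \<in> grid n \<Longrightarrow> \<bar>bilin m n A e h\<bar> \<le> \<tau>"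
  shows "\<bar>bilin m n A e h\<bar> \<le> 2 * \<tau> * (sqrt (sqnorm_n m e) * sqrt (sqnorm_n n h))"
proof (cases "sqnorm_n m e = 0 \<or> sqnorm_n n h = 0")
  case True
  then have "(\<forall>i<m. e i = 0) \<or> (\<forall>k<n. h k = 0)"
    by (auto simp: sqnorm_n_def sum_nonneg_eq_0_iff)
  then have "bilin m n A e h = 0" by (auto simp: bilin_def)
  then show ?thesis using True by auto
next
  case False
  let ?a = "sqrt (sqnorm_n m e)" and ?b = "sqrt (sqnorm_n n h)"
  have pos: "?a > 0" "?b > 0" using False by (simp_all add: less_le)
  have "\<bar>bilin m n A (\<lambda>i. (1 / ?a) * e i) (\<lambda>k. (1 / ?b) * h k)\<bar> \<le> 2 * \<tau>"
    using pos by (intro bilin_le_on_ball_if_on_grid[OF m n net])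
      (simp_all only: sqnorm_n_scale, simp_all add: power_divide)
  then show ?thesis using pos unfolding bilin_scale by (simp add: abs_mult field_simps)
qed

section \<open>Probability of the good event\<close>

lemma sum_rows_eq: "(\<Sum>j\<in>{..<m} \<times> {..<p}. F j) = (\<Sum>i<m. \<Sum>l<p. F (i, l))"
  by (simp add: sum.cartesian_product)

text \<open>Polarised form of the first event, so that the same grid lemma serves both the
  covariance and the gains.\<close>

lemma bilin_covariance:
  "bilin n n (\<lambda>k k'. avg m p (\<lambda>i l. avec \<omega> i l k * avec \<omega> i l k') - (if k = k' then 1 else 0)) e h
    = avg m p (\<lambda>i l. inner_n n (avec \<omega> i l) e * inner_n n (avec \<omega> i l) h) - inner_n n e h"
proof -
  define A where "A k = avg m p (\<lambda>i l. avec \<omega> i l k * inner_n n (avec \<omega> i l) h)" for k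
  have A: "A k = (\<Sum>k'<n. avg m p (\<lambda>i l. avec \<omega> i l k * avec \<omega> i l k') * h k')" for k
    using inner_n_avg[of n m p "avec \<omega>" "\<lambda>i l. avec \<omega> i l k" h]
    by (simp add: A_def inner_n_def[of n "\<lambda>k'. avg m p (\<lambda>i l. avec \<omega> i l k' * avec \<omega> i l k)"] mult.commute)
  have "avg m p (\<lambda>i l. inner_n n (avec \<omega> i l) e * inner_n n (avec \<omega> i l) h) = inner_n n A e"
    by (simp add: A_def[abs_def] inner_n_avg mult.commute)
  also have "\<dots> = (\<Sum>k<n. \<Sum>k'<n. avg m p (\<lambda>i l. avec \<omega> i l k * avec \<omega> i l k') * e k * h k')"
    unfolding inner_n_def A by (simp add: sum_distrib_left sum_distrib_right mult_ac)
  finally show ?thesis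
    by (simp add: bilin_def algebra_simps sum_subtractf inner_n_def if_distrib[of "\<lambda>b. _ * b"] cong: if_cong)
qed

lemma bilin_gain:
  assumes "0 < m" "0 < p"
  shows "bilin m n (\<lambda>i k. (\<Sum>l<p. inner_n n (avec \<omega> i l) u * avec \<omega> i l k) / (real m * real p) - u k / m) e h
    = avg m p (\<lambda>i l. e i * (inner_n n (avec \<omega> i l) u * inner_n n (avec \<omega> i l) h)) - (\<Sum>i<m. e i) / m * inner_n n u h"
proof -
  have "(\<Sum>k<n. (\<Sum>l<p. inner_n n (avec \<omega> i l) u * avec \<omega> i l k) / (real m * real p) * e i * h k)
      = (\<Sum>l<p. e i * (inner_n n (avec \<omega> i l) u * inner_n n (avec \<omega> i l) h)) / (real m * real p)" for i
  proof -
    have "(\<Sum>l<p. e i * (inner_n n (avec \<omega> i l) u * inner_n n (avec \<omega> i l) h))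
       = (\<Sum>l<p. \<Sum>k<n. e i * (inner_n n (avec \<omega> i l) u * (avec \<omega> i l k * h k)))"
      by (simp add: inner_n_def[of n _ h] sum_distrib_left)
    also have "\<dots> = (\<Sum>k<n. \<Sum>l<p. e i * (inner_n n (avec \<omega> i l) u * (avec \<omega> i l k * h k)))"
      by (rule sum.swap)
    finally show ?thesis
      by (simp add: sum_divide_distrib sum_distrib_left sum_distrib_right mult_ac)
  qed
  then have 1: "(\<Sum>i<m. \<Sum>k<n. (\<Sum>l<p. inner_n n (avec \<omega> i l) u * avec \<omega> i l k) / (real m * real p) * e i * h k)
      = avg m p (\<lambda>i l. e i * (inner_n n (avec \<omega> i l) u * inner_n n (avec \<omega> i l) h))"
    by (simp add: avg_def sum_divide_distrib)
  have 2: "(\<Sum>i<m. \<Sum>k<n. u k / m * e i * h k) = (\<Sum>i<m. e i) / m * inner_n n u h"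
    unfolding inner_n_def sum_divide_distrib sum_product by (simp add: mult_ac)
  show ?thesis unfolding bilin_def left_diff_distrib sum_subtractf 1 2 ..
qed

context subgaussian_design
begin

text \<open>The threshold is precision 1/200, half of the 1/100 in \<open>good_sample\<close>,
  because passing from the grid to the ball doubles it. \<open>J\<close> is all rows for the
  covariance and one block for the block energy.\<close>

lemma prob_product_deviation:
  assumes J: "J \<subseteq> {..<m} \<times> {..<p}" and u: "sqnorm_n n u \<le> 1" and v: "sqnorm_n n v \<le> 1"
  shows "measure (sample_space D n m p) {\<omega> \<in> space (sample_space D n m p).
      card J / (200 * q) \<le> \<bar>\<Sum>j\<in>J. (inner_n n (sample_row n \<omega> j) u * inner_n n (sample_row n \<omega> j) v - inner_n n u v) / q\<bar>}
    \<le> 2 * exp (- (card J / (3840000 * q\<^sup>2)))"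
proof -
  define s where "s = 1 / (9600 * q)" \<comment> \<open>minimises \<open>24 s\<^sup>2 - s / (200 q)\<close>\<close>
  have s: "0 \<le> s" "s \<le> 1 / 2" using q_ge_1 by (auto simp: s_def field_simps)
  have "measure (sample_space D n m p) {\<omega> \<in> space (sample_space D n m p).
      card J / (200 * q) \<le> \<bar>\<Sum>j\<in>J. (inner_n n (sample_row n \<omega> j) u * inner_n n (sample_row n \<omega> j) v - inner_n n u v) / q\<bar>}
    \<le> 2 * exp (- (s * (card J / (200 * q))) + (\<Sum>j\<in>J. 24 * s\<^sup>2))"
  proof (rule prob_abs_sum_rows_ge[OF J s(1)])
    fix j r assume r: "\<bar>r\<bar> = s"
    then have "r\<^sup>2 = s\<^sup>2" by (metis power2_abs)
    then show "(\<integral>\<^sup>+a. ennreal (exp (r * ((inner_n n a u * inner_n n a v - inner_n n u v) / q))) \<partial>row_law D n) \<le> ennreal (exp (24 * s\<^sup>2))"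
      using mgf_row_product[OF u v, of r] r s by simp
  qed measurable
  also have "- (s * (card J / (200 * q))) + (\<Sum>j\<in>J. 24 * s\<^sup>2) = - (card J / (3840000 * q\<^sup>2))"
    using q_ge_1 by (simp add: s_def power_divide power_mult_distrib field_simps power2_eq_square)
  finally show ?thesis .
qed

text \<open>Each \<open>e i\<close> occurs in p rows, so the exponents add up to B s^2 times the
  squared norm of \<open>e\<close>, however unevenly it is spread. The choice s = \<tau>/(2B) is
  optimal for a unit vector.\<close>

lemma prob_truncated_deviation:
  assumes p: "0 < p" and e: "sqnorm_n m e \<le> 1" and v: "sqnorm_n n v \<le> 1" and T: "0 < T" and \<tau>: "0 \<le> \<tau>"
  shows "measure (sample_space D n m p) {\<omega> \<in> space (sample_space D n m p).
      \<tau> \<le> \<bar>\<Sum>j\<in>{..<m} \<times> {..<p}. e (fst j) * (truncated_product n T x v (sample_row n \<omega> j) - (\<integral>b. truncated_product n T x v b \<partial>row_law D n))\<bar>}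
    \<le> 2 * exp (- (\<tau>\<^sup>2 / (512 * q * T\<^sup>2 * p)))"
proof -
  let ?E = "\<integral>b. truncated_product n T x v b \<partial>row_law D n" and ?J = "{..<m} \<times> {..<p}"
  let ?\<phi> = "\<lambda>j a. e (fst j) * (truncated_product n T x v a - ?E)"
  define B where "B = 128 * q * T\<^sup>2 * p"
  define s where "s = \<tau> / (2 * B)"
  have B: "B > 0" using q_ge_1 T p by (simp add: B_def)
  have s: "0 \<le> s" using B \<tau> by (simp add: s_def)
  have "measure (sample_space D n m p) {\<omega> \<in> space (sample_space D n m p).
      \<tau> \<le> \<bar>\<Sum>j\<in>?J. ?\<phi> j (sample_row n \<omega> j)\<bar>}
    \<le> 2 * exp (- (s * \<tau>) + (\<Sum>j\<in>?J. 128 * q * T\<^sup>2 * (s * e (fst j))\<^sup>2))"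
  proof (rule prob_abs_sum_rows_ge[OF order_refl s])
    fix j :: "nat \<times> nat" and r assume r: "\<bar>r\<bar> = s"
    then have "r\<^sup>2 = s\<^sup>2" by (metis power2_abs)
    then show "(\<integral>\<^sup>+a. ennreal (exp (r * ?\<phi> j a)) \<partial>row_law D n) \<le> ennreal (exp (128 * q * T\<^sup>2 * (s * e (fst j))\<^sup>2))"
      using mgf_truncated_product[OF v T, of "r * e (fst j)" x] by (simp add: power_mult_distrib mult.assoc)
  qed measurable
  also have "(\<Sum>j\<in>?J. 128 * q * T\<^sup>2 * (s * e (fst j))\<^sup>2) = B * s\<^sup>2 * sqnorm_n m e"
    unfolding sum_rows_eq by (simp add: B_def sqnorm_n_def power_mult_distrib sum_distrib_left mult_ac)
  also have "2 * exp (- (s * \<tau>) + B * s\<^sup>2 * sqnorm_n m e) \<le> 2 * exp (- (s * \<tau>) + B * s\<^sup>2 * 1)"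
    using mult_left_mono[OF e, of "B * s\<^sup>2"] B by simp
  also have "- (s * \<tau>) + B * s\<^sup>2 * 1 = - (\<tau>\<^sup>2 / (4 * B))"
    using B by (simp add: s_def field_simps power2_eq_square)
  finally show ?thesis by (simp add: B_def mult_ac)
qed

lemma prob_row_tail:
  assumes il: "i < m" "l < p" and v: "sqnorm_n n v \<le> 1" and T: "0 \<le> T"
  shows "measure (sample_space D n m p) {\<omega> \<in> space (sample_space D n m p). T < \<bar>inner_n n (sample_row n \<omega> (i, l)) v\<bar>}
    \<le> 2 * exp (- (T\<^sup>2 / q))"
proof -
  let ?P = "sample_space D n m p"
  interpret P: prob_space ?P by (rule prob_space_sample_space)
  have q: "q > 0" using q_ge_1 by simp
  have [measurable]: "(\<lambda>\<omega>. inner_n n (sample_row n \<omega> (i, l)) v) \<in> borel_measurable ?P"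
    using measurable_compose[OF distr_row(1)[OF il] borel_measurable_inner_n_row] .
  let ?A = "{\<omega> \<in> space ?P. T < \<bar>inner_n n (sample_row n \<omega> (i, l)) v\<bar>}"
  have "emeasure ?P ?A = (\<integral>\<^sup>+\<omega>. indicator ?A \<omega> \<partial>?P)" by (intro nn_integral_indicator[symmetric]) measurable
  also have "\<dots> \<le> (\<integral>\<^sup>+\<omega>. ennreal (exp (- (T\<^sup>2 / q))) * ennreal (exp ((inner_n n (sample_row n \<omega> (i, l)) v)\<^sup>2 / q)) \<partial>?P)"
  proof (rule nn_integral_mono)
    fix \<omega>
    have "1 \<le> exp (- (T\<^sup>2 / q)) * exp ((inner_n n (sample_row n \<omega> (i, l)) v)\<^sup>2 / q)"
      if "T < \<bar>inner_n n (sample_row n \<omega> (i, l)) v\<bar>"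
    proof -
      have "T\<^sup>2 \<le> \<bar>inner_n n (sample_row n \<omega> (i, l)) v\<bar>\<^sup>2" using that T by (intro power_mono) auto
      then have "T\<^sup>2 / q \<le> (inner_n n (sample_row n \<omega> (i, l)) v)\<^sup>2 / q" using q by (simp add: divide_right_mono)
      then show ?thesis by (simp flip: exp_add)
    qed
    then show "indicator ?A \<omega> \<le> ennreal (exp (- (T\<^sup>2 / q))) * ennreal (exp ((inner_n n (sample_row n \<omega> (i, l)) v)\<^sup>2 / q))"
      by (auto split: split_indicator simp flip: ennreal_mult)
  qed
  also have "\<dots> = ennreal (exp (- (T\<^sup>2 / q))) * (\<integral>\<^sup>+\<omega>. ennreal (exp ((inner_n n (sample_row n \<omega> (i, l)) v)\<^sup>2 / q)) \<partial>?P)"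
    by (rule nn_integral_cmult) measurable
  also have "(\<integral>\<^sup>+\<omega>. ennreal (exp ((inner_n n (sample_row n \<omega> (i, l)) v)\<^sup>2 / q)) \<partial>?P)
      = (\<integral>\<^sup>+a. ennreal (exp ((inner_n n a v)\<^sup>2 / q)) \<partial>row_law D n)"
    by (rule nn_integral_row[OF il]) measurable
  also have "ennreal (exp (- (T\<^sup>2 / q))) * \<dots> \<le> ennreal (exp (- (T\<^sup>2 / q))) * ennreal 2"
    by (intro mult_left_mono exp_square_row v) auto
  also have "\<dots> = ennreal (2 * exp (- (T\<^sup>2 / q)))" by (simp add: mult.commute flip: ennreal_mult del: ennreal_numeral)
  finally show ?thesis by (simp add: P.emeasure_eq_measure)
qed

definition rows_deviation :: "nat \<Rightarrow> (nat \<times> nat) set \<Rightarrow> (nat \<Rightarrow> real) \<Rightarrow> (nat \<Rightarrow> real) \<Rightarrow> (nat \<times> nat \<times> nat \<Rightarrow> real) \<Rightarrow> real" where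
  "rows_deviation n J u v \<omega>
    = (\<Sum>j\<in>J. (inner_n n (sample_row n \<omega> j) u * inner_n n (sample_row n \<omega> j) v - inner_n n u v) / q)"

definition gain_deviation ::
    "nat \<Rightarrow> nat \<Rightarrow> nat \<Rightarrow> real \<Rightarrow> (nat \<Rightarrow> real) \<Rightarrow> (nat \<Rightarrow> real) \<Rightarrow> (nat \<Rightarrow> real) \<Rightarrow> (nat \<times> nat \<times> nat \<Rightarrow> real) \<Rightarrow> real" where
  "gain_deviation n m p T u e h \<omega> = (\<Sum>j\<in>{..<m} \<times> {..<p}. e (fst j) *
      (truncated_product n T u h (sample_row n \<omega> j) - (\<integral>b. truncated_product n T u h b \<partial>row_law D n)))"

text \<open>Budget for the gains: \<delta>/400 for the deviation and \<delta>/400 for the truncation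
  bias, doubled in passing from the grid to all vectors, make \<delta>/100. The events concern the
  normalised signal \<open>u\<close>; homogeneity restores the factor \<open>c\<close>.\<close>

lemma good_sample_if_on_grid:
  assumes n: "0 < n" and m: "0 < m" and p: "0 < p" and T: "0 \<le> T" and \<delta>: "0 < \<delta>"
    and u: "sqnorm_n n u = 1" and x: "x = (\<lambda>k. c * u k)" "0 < c"
    and bias: "4 * q * exp (- (T\<^sup>2) / (2 * q)) \<le> \<delta> / 400"
    and 1: "\<And>e h. e \<in> grid n \<Longrightarrow> h \<in> grid n \<Longrightarrow> \<bar>rows_deviation n ({..<m} \<times> {..<p}) e h \<omega>\<bar> \<le> real m * real p / (200 * q)"
    and 2: "\<And>i. i < m \<Longrightarrow> \<bar>rows_deviation n ({i} \<times> {..<p}) u u \<omega>\<bar> \<le> p / (200 * q)"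
    and 3: "\<And>i l. i < m \<Longrightarrow> l < p \<Longrightarrow> \<bar>inner_n n (sample_row n \<omega> (i, l)) u\<bar> \<le> T"
    and 4: "\<And>e h. e \<in> grid m \<Longrightarrow> h \<in> grid n \<Longrightarrow> \<bar>gain_deviation n m p T u e h \<omega>\<bar> \<le> p * sqrt m * \<delta> / 400"
  shows "good_sample n m p x \<delta> \<omega>"
proof -
  let ?b = "\<lambda>i l v. inner_n n (avec \<omega> i l) v"
  have q: "q > 0" using q_ge_1 by simp
  have X: "sqnorm_n n x = c\<^sup>2" by (simp add: x sqnorm_n_scale u)
  have bx: "?b i l x = c * ?b i l u" for i l by (simp add: x inner_n_scale_right)
  have cov: "\<bar>avg m p (\<lambda>i l. (?b i l v)\<^sup>2) - sqnorm_n n v\<bar> \<le> sqnorm_n n v / 100" for v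
  proof -
    let ?A = "\<lambda>k k'. avg m p (\<lambda>i l. avec \<omega> i l k * avec \<omega> i l k') - (if k = k' then 1 else 0)"
    have "\<bar>bilin n n ?A e h\<bar> \<le> 1 / 200" if "e \<in> grid n" "h \<in> grid n" for e h
    proof -
      have "rows_deviation n ({..<m} \<times> {..<p}) e h \<omega>
          = ((\<Sum>i<m. \<Sum>l<p. ?b i l e * ?b i l h) - real m * real p * inner_n n e h) / q"
        unfolding rows_deviation_def sum_rows_eq
        by (simp add: inner_n_row sum_subtractf flip: sum_divide_distrib)
      also have "\<dots> = (real m * real p / q) * bilin n n ?A e h"
      proof -
        have "(S - N * I) / q = (N / q) * (S / N - I)" if "N \<noteq> 0" for S N I :: real
          using that q by (simp add: field_simps)
        moreover have "real m * real p \<noteq> 0" using m p by simp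
        ultimately show ?thesis unfolding bilin_covariance by (simp only: avg_def not_False_eq_True)
      qed
      finally have "real m * real p / q * \<bar>bilin n n ?A e h\<bar> \<le> real m * real p / q * (1 / 200)"
        using 1[OF that] q by (simp add: abs_mult)
      then show ?thesis using m p q by (subst (asm) mult_le_cancel_left_pos) auto
    qed
    from bilin_le_if_on_grid[OF n n this, of v v] show ?thesis
      using sqnorm_n_nonneg[of n v] unfolding bilin_covariance sqnorm_n_eq_inner_n
      by (simp add: power2_eq_square)
  qed
  have blk: "\<bar>(\<Sum>l<p. (?b i l x)\<^sup>2) / p - sqnorm_n n x\<bar> \<le> sqnorm_n n x / 100" if i: "i < m" for i
  proof -
    have "rows_deviation n ({i} \<times> {..<p}) u u \<omega> = (\<Sum>l<p. ((?b i l u)\<^sup>2 - 1) / q)"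
      using sum.cartesian_product[of "\<lambda>i l. ((?b i l u)\<^sup>2 - 1) / q" "{..<p}" "{i}"] u
      by (simp add: rows_deviation_def inner_n_row power2_eq_square case_prod_unfold sqnorm_n_eq_inner_n
          sum.cartesian_product' sum.insert)
    also have "\<dots> = p / q * ((\<Sum>l<p. (?b i l u)\<^sup>2) / p - 1)"
      using p q by (simp add: sum_subtractf field_simps flip: sum_divide_distrib)
    finally have "p / q * \<bar>(\<Sum>l<p. (?b i l u)\<^sup>2) / p - 1\<bar> \<le> p / q * (1 / 200)"
      using 2[OF i] q by (simp add: abs_mult)
    then have "\<bar>(\<Sum>l<p. (?b i l u)\<^sup>2) / p - 1\<bar> \<le> 1 / 200"
      using p q by (subst (asm) mult_le_cancel_left_pos) auto
    then have "c\<^sup>2 * \<bar>(\<Sum>l<p. (?b i l u)\<^sup>2) / p - 1\<bar> \<le> c\<^sup>2 * (1 / 100)" by (intro mult_left_mono) auto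
    moreover have "(\<Sum>l<p. (?b i l x)\<^sup>2) / p - sqnorm_n n x = c\<^sup>2 * ((\<Sum>l<p. (?b i l u)\<^sup>2) / p - 1)"
      by (simp add: bx X power_mult_distrib algebra_simps flip: sum_distrib_left)
    ultimately show ?thesis by (simp add: abs_mult X)
  qed
  have gain: "\<bar>avg m p (\<lambda>i l. e i * (?b i l x * ?b i l h)) - (\<Sum>i<m. e i) / m * inner_n n x h\<bar>
      \<le> \<delta> / 100 * (sqrt (sqnorm_n n x) * sqrt (sqnorm_n n h) * sqrt (sqnorm_n m e / m))" for e h
  proof -
    let ?A = "\<lambda>i k. (\<Sum>l<p. ?b i l u * avec \<omega> i l k) / (real m * real p) - u k / m"
    have "\<bar>bilin m n ?A e h\<bar> \<le> \<delta> / (200 * sqrt m)" if "e \<in> grid m" "h \<in> grid n" for e h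
    proof -
      define E where "E = (\<integral>b. truncated_product n T u h b \<partial>row_law D n)"
      \<comment> \<open>As no row exceeds T along \<open>u\<close>, truncation leaves every observed
        product alone and shows only in the mean E.\<close>
      have Y: "truncated_product n T u h (sample_row n \<omega> (i, l)) = ?b i l u * ?b i l h" if "i < m" "l < p" for i l
        using 3[OF that] by (simp add: truncated_product_def inner_n_row)
      have "gain_deviation n m p T u e h \<omega> = (\<Sum>i<m. \<Sum>l<p. e i * (?b i l u * ?b i l h)) - p * (\<Sum>i<m. e i) * E"
        unfolding gain_deviation_def sum_rows_eq E_def[symmetric]
        by (simp add: Y right_diff_distrib sum_subtractf sum_distrib_left sum_distrib_right mult_ac)
      then have "gain_deviation n m p T u e h \<omega> / (real m * real p)
          = avg m p (\<lambda>i l. e i * (?b i l u * ?b i l h)) - (\<Sum>i<m. e i) / m * E"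
        using m p by (simp add: avg_def diff_divide_distrib)
      then have eq: "bilin m n ?A e h
          = gain_deviation n m p T u e h \<omega> / (real m * real p) + (\<Sum>i<m. e i) / m * (E - inner_n n u h)"
        unfolding bilin_gain[OF m p] right_diff_distrib by linarith
      have "\<bar>gain_deviation n m p T u e h \<omega> / (real m * real p)\<bar> = \<bar>gain_deviation n m p T u e h \<omega>\<bar> / (real m * real p)"
        using m p by simp
      also have "\<dots> \<le> p * sqrt m * \<delta> / 400 / (real m * real p)"
        using 4[OF that] by (intro divide_right_mono) auto
      also have "\<dots> = \<delta> / (400 * sqrt m)"
        using m p by (simp add: field_simps)
      finally have a: "\<bar>gain_deviation n m p T u e h \<omega> / (real m * real p)\<bar> \<le> \<delta> / (400 * sqrt m)" .
      \<comment> \<open>Cauchy-Schwarz keeps the bias at the scale 1 / sqrt m of the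
        deviation.\<close>
      have "\<bar>\<Sum>i<m. e i\<bar> \<le> sqrt m"
      proof -
        have "\<bar>inner_n m e (\<lambda>_. 1)\<bar> \<le> sqrt (sqnorm_n m e) * sqrt (sqnorm_n m (\<lambda>_. 1))" by (rule abs_inner_n_le)
        also have "\<dots> \<le> 1 * sqrt m"
          using grid_in_ball[OF that(1) m] by (intro mult_mono) (auto simp: sqnorm_n_def[of m "\<lambda>_. 1"])
        finally show ?thesis by (simp add: inner_n_def)
      qed
      then have "\<bar>(\<Sum>i<m. e i) / m\<bar> \<le> sqrt m / m" by (simp add: divide_right_mono)
      also have "\<dots> = 1 / sqrt m" using m by (simp add: field_simps)
      finally have se: "\<bar>(\<Sum>i<m. e i) / m\<bar> \<le> 1 / sqrt m" .
      have "\<bar>E - inner_n n u h\<bar> \<le> \<delta> / 400"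
        unfolding E_def using truncation_bias[of n u h T] u grid_in_ball[OF that(2) n] T bias by simp
      then have "\<bar>(\<Sum>i<m. e i) / m\<bar> * \<bar>E - inner_n n u h\<bar> \<le> 1 / sqrt m * (\<delta> / 400)"
        using se by (intro mult_mono) auto
      then have b: "\<bar>(\<Sum>i<m. e i) / m * (E - inner_n n u h)\<bar> \<le> \<delta> / (400 * sqrt m)"
        unfolding abs_mult by (simp add: mult.commute)
      have "\<bar>bilin m n ?A e h\<bar> \<le> \<delta> / (400 * sqrt m) + \<delta> / (400 * sqrt m)"
        unfolding eq by (rule order_trans[OF abs_triangle_ineq add_mono[OF a b]])
      then show ?thesis by (simp add: field_simps)
    qed
    from bilin_le_if_on_grid[OF m n this, of e h]
    have "\<bar>bilin m n ?A e h\<bar> \<le> \<delta> / 100 * (sqrt (sqnorm_n n h) * sqrt (sqnorm_n m e / m))"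
      by (simp add: real_sqrt_divide mult_ac)
    then have "c * \<bar>bilin m n ?A e h\<bar> \<le> c * (\<delta> / 100 * (sqrt (sqnorm_n n h) * sqrt (sqnorm_n m e / m)))"
      using x(2) by (intro mult_left_mono) auto
    moreover have "avg m p (\<lambda>i l. e i * (?b i l x * ?b i l h)) - (\<Sum>i<m. e i) / m * inner_n n x h = c * bilin m n ?A e h"
    proof -
      have "avg m p (\<lambda>i l. e i * (?b i l x * ?b i l h)) = c * avg m p (\<lambda>i l. e i * (?b i l u * ?b i l h))"
        unfolding avg_cmult[symmetric] bx by (simp add: mult_ac)
      moreover have "inner_n n x h = c * inner_n n u h" by (simp add: x inner_n_scale_left)
      ultimately show ?thesis unfolding bilin_gain[OF m p] by (simp add: algebra_simps)
    qed
    ultimately show ?thesis using x(2) by (simp add: abs_mult X mult_ac)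
  qed
  show ?thesis unfolding good_sample_def using cov blk gain by blast
qed

end

section \<open>Union bound over the grids\<close>

lemma (in finite_measure) measure_finite_UN_le:
  assumes "finite I" "\<And>i. i \<in> I \<Longrightarrow> A i \<in> sets M" "\<And>i. i \<in> I \<Longrightarrow> measure M (A i) \<le> b" "real (card I) \<le> c" "0 \<le> b"
  shows "measure M (\<Union>i\<in>I. A i) \<le> c * b"
proof -
  have "measure M (\<Union>i\<in>I. A i) \<le> (\<Sum>i\<in>I. measure M (A i))"
    using assms by (intro finite_measure_subadditive_finite) auto
  also have "\<dots> \<le> (\<Sum>i\<in>I. b)" using assms by (intro sum_mono) auto
  also have "\<dots> \<le> c * b" using assms by (simp add: mult_right_mono)
  finally show ?thesis .
qed

context subgaussian_design
begin

text \<open>\<open>good_sample\<close> quantifies over uncountably many vectors; a measurable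
  exceptional set \<open>B\<close> avoids asking whether it is measurable itself. The four summands
  belong to covariance, blocks, large rows and gains.\<close>

lemma prob_not_good_sample:
  assumes n: "0 < n" and m: "0 < m" and p: "0 < p" and T: "0 < T" and \<delta>: "0 < \<delta>"
    and x: "0 < sqnorm_n n x"
    and bias: "4 * q * exp (- (T\<^sup>2) / (2 * q)) \<le> \<delta> / 400"
  obtains B where "B \<in> sets (sample_space D n m p)"
    "\<And>\<omega>. \<omega> \<in> space (sample_space D n m p) - B \<Longrightarrow> good_sample n m p x \<delta> \<omega>"
    "measure (sample_space D n m p) B
      \<le> (3 * 2 ^ 16) ^ (n + n) * (2 * exp (- (real (m * p) / (3840000 * q\<^sup>2))))
       + m * (2 * exp (- (p / (3840000 * q\<^sup>2))))
       + real (m * p) * (2 * exp (- (T\<^sup>2 / q)))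
       + (3 * 2 ^ 16) ^ (m + n) * (2 * exp (- (real (m * p) * \<delta>\<^sup>2 / (81920000 * q * T\<^sup>2))))"
proof -
  let ?P = "sample_space D n m p"
  interpret P: prob_space ?P by (rule prob_space_sample_space)
  define c where "c = sqrt (sqnorm_n n x)"
  define u where "u = (\<lambda>k. (1 / c) * x k)"
  have c: "0 < c" using x by (simp add: c_def)
  have xu: "x = (\<lambda>k. c * u k)" using c by (simp add: u_def)
  have u: "sqnorm_n n u = 1"
    unfolding u_def sqnorm_n_scale using x by (simp add: c_def power_divide)
  define J where "J = {..<m} \<times> {..<p}"
  define \<tau> where "\<tau> = p * sqrt m * \<delta> / 400"
  define B1 where "B1 eh = {\<omega> \<in> space ?P. card J / (200 * q) \<le> \<bar>rows_deviation n J (fst eh) (snd eh) \<omega>\<bar>}" for eh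
  define B2 where "B2 i = {\<omega> \<in> space ?P. card ({i} \<times> {..<p}) / (200 * q) \<le> \<bar>rows_deviation n ({i} \<times> {..<p}) u u \<omega>\<bar>}" for i
  define B3 where "B3 j = {\<omega> \<in> space ?P. T < \<bar>inner_n n (sample_row n \<omega> j) u\<bar>}" for j
  define B4 where "B4 eh = {\<omega> \<in> space ?P. \<tau> \<le> \<bar>gain_deviation n m p T u (fst eh) (snd eh) \<omega>\<bar>}" for eh
  have row: "(\<lambda>\<omega>. f (sample_row n \<omega> j)) \<in> borel_measurable ?P"
    if f: "f \<in> borel_measurable (row_law D n)" and j: "j \<in> J" for f :: "(nat \<Rightarrow> real) \<Rightarrow> real" and j
  proof -
    obtain i l where "j = (i, l)" "i < m" "l < p" using j by (auto simp: J_def)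
    then show ?thesis using measurable_compose[OF distr_row(1) f] by auto
  qed
  have dev: "rows_deviation n J' e h \<in> borel_measurable ?P" if "J' \<subseteq> J" for J' e h
    unfolding rows_deviation_def[abs_def] using that
    by (intro borel_measurable_sum borel_measurable_divide borel_measurable_diff borel_measurable_times
        borel_measurable_const row) auto
  have gain: "gain_deviation n m p T u e h \<in> borel_measurable ?P" for e h
    unfolding gain_deviation_def[abs_def]
    by (intro borel_measurable_sum borel_measurable_diff borel_measurable_times
        borel_measurable_const row) (auto simp: J_def)
  have sets1: "B1 eh \<in> sets ?P" for eh
    unfolding B1_def using dev[OF order_refl] by measurable
  have sets2: "B2 i \<in> sets ?P" if "i \<in> {..<m}" for i
  proof -
    have [measurable]: "rows_deviation n ({i} \<times> {..<p}) u u \<in> borel_measurable ?P"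
      using that by (intro dev) (auto simp: J_def)
    show ?thesis unfolding B2_def by measurable
  qed
  have sets3: "B3 j \<in> sets ?P" if "j \<in> J" for j
  proof -
    have [measurable]: "(\<lambda>\<omega>. inner_n n (sample_row n \<omega> j) u) \<in> borel_measurable ?P"
      using that by (intro row) auto
    show ?thesis unfolding B3_def by measurable
  qed
  have sets4: "B4 eh \<in> sets ?P" for eh
    unfolding B4_def using gain by measurable
  let ?G1 = "grid n \<times> grid n" and ?G4 = "grid m \<times> grid n"
  have fin: "finite ?G1" "finite ?G4" "finite J" by (auto simp: finite_grid J_def)
  have cardG: "real (card ?G1) \<le> (3 * 2 ^ 16) ^ (n + n)" "real (card ?G4) \<le> (3 * 2 ^ 16) ^ (m + n)"
    unfolding card_cartesian_product of_nat_mult power_add by (intro mult_mono card_grid; simp)+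
  define B where "B = (\<Union>eh\<in>?G1. B1 eh) \<union> (\<Union>i\<in>{..<m}. B2 i) \<union> (\<Union>j\<in>J. B3 j) \<union> (\<Union>eh\<in>?G4. B4 eh)"
  have sets_UN: "(\<Union>eh\<in>?G1. B1 eh) \<in> sets ?P" "(\<Union>i\<in>{..<m}. B2 i) \<in> sets ?P"
    "(\<Union>j\<in>J. B3 j) \<in> sets ?P" "(\<Union>eh\<in>?G4. B4 eh) \<in> sets ?P"
    using fin by (auto intro!: sets.finite_UN sets1 sets2 sets3 sets4)
  have good: "good_sample n m p x \<delta> \<omega>" if \<omega>: "\<omega> \<in> space ?P - B" for \<omega>
  proof (rule good_sample_if_on_grid[OF n m p less_imp_le[OF T] \<delta> u xu c bias])
    fix e h assume "e \<in> grid n" "h \<in> grid n"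
    then have "\<omega> \<notin> B1 (e, h)" using \<omega> by (auto simp: B_def)
    then show "\<bar>rows_deviation n ({..<m} \<times> {..<p}) e h \<omega>\<bar> \<le> real m * real p / (200 * q)"
      using \<omega> by (simp add: B1_def J_def)
  next
    fix i assume "i < m"
    then have "\<omega> \<notin> B2 i" using \<omega> by (auto simp: B_def)
    then show "\<bar>rows_deviation n ({i} \<times> {..<p}) u u \<omega>\<bar> \<le> p / (200 * q)"
      using \<omega> by (simp add: B2_def)
  next
    fix i l assume "i < m" "l < p"
    then have "\<omega> \<notin> B3 (i, l)" using \<omega> by (auto simp: B_def J_def)
    then show "\<bar>inner_n n (sample_row n \<omega> (i, l)) u\<bar> \<le> T"
      using \<omega> by (simp add: B3_def)
  next
    fix e h assume "e \<in> grid m" "h \<in> grid n"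
    then have "\<omega> \<notin> B4 (e, h)" using \<omega> by (auto simp: B_def)
    then show "\<bar>gain_deviation n m p T u e h \<omega>\<bar> \<le> p * sqrt m * \<delta> / 400"
      using \<omega> by (simp add: B4_def \<tau>_def)
  qed
  have 1: "measure ?P (\<Union>eh\<in>?G1. B1 eh) \<le> (3 * 2 ^ 16) ^ (n + n) * (2 * exp (- (real (m * p) / (3840000 * q\<^sup>2))))"
  proof (rule P.measure_finite_UN_le[OF fin(1) sets1 _ cardG(1)])
    fix eh assume "eh \<in> ?G1"
    then have "measure ?P (B1 eh) \<le> 2 * exp (- (card J / (3840000 * q\<^sup>2)))"
      unfolding B1_def rows_deviation_def J_def using grid_in_ball n
      by (intro prob_product_deviation) auto
    then show "measure ?P (B1 eh) \<le> 2 * exp (- (real (m * p) / (3840000 * q\<^sup>2)))" by (simp add: J_def)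
  qed simp
  have 2: "measure ?P (\<Union>i\<in>{..<m}. B2 i) \<le> m * (2 * exp (- (p / (3840000 * q\<^sup>2))))"
  proof (rule P.measure_finite_UN_le[OF finite_lessThan sets2])
    fix i assume "i \<in> {..<m}"
    then have "measure ?P (B2 i) \<le> 2 * exp (- (card ({i} \<times> {..<p}) / (3840000 * q\<^sup>2)))"
      unfolding B2_def rows_deviation_def using u
      by (intro prob_product_deviation) auto
    then show "measure ?P (B2 i) \<le> 2 * exp (- (p / (3840000 * q\<^sup>2)))" by simp
  qed simp_all
  have 3: "measure ?P (\<Union>j\<in>J. B3 j) \<le> real (m * p) * (2 * exp (- (T\<^sup>2 / q)))"
  proof (rule P.measure_finite_UN_le[OF fin(3) sets3])
    fix j assume "j \<in> J"
    then obtain i l where "j = (i, l)" "i < m" "l < p" by (auto simp: J_def)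
    then show "measure ?P (B3 j) \<le> 2 * exp (- (T\<^sup>2 / q))"
      unfolding B3_def using u T by (auto intro!: prob_row_tail)
  qed (simp_all add: J_def)
  have 4: "measure ?P (\<Union>eh\<in>?G4. B4 eh) \<le> (3 * 2 ^ 16) ^ (m + n) * (2 * exp (- (real (m * p) * \<delta>\<^sup>2 / (81920000 * q * T\<^sup>2))))"
  proof (rule P.measure_finite_UN_le[OF fin(2) sets4 _ cardG(2)])
    fix eh assume eh: "eh \<in> ?G4"
    have \<tau>: "\<tau> \<ge> 0" using \<delta> by (simp add: \<tau>_def)
    have "measure ?P (B4 eh) \<le> 2 * exp (- (\<tau>\<^sup>2 / (512 * q * T\<^sup>2 * p)))"
      unfolding B4_def gain_deviation_def using grid_in_ball n m eh \<tau> T p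
      by (intro prob_truncated_deviation) auto
    \<comment> \<open>81920000 is 512 * 400^2.\<close>
    also have "\<tau>\<^sup>2 / (512 * q * T\<^sup>2 * p) = real (m * p) * \<delta>\<^sup>2 / (81920000 * q * T\<^sup>2)"
      using q_ge_1 T p by (simp add: \<tau>_def power_divide power_mult_distrib field_simps power2_eq_square)
    finally show "measure ?P (B4 eh) \<le> 2 * exp (- (real (m * p) * \<delta>\<^sup>2 / (81920000 * q * T\<^sup>2)))" .
  qed simp
  have "measure ?P B \<le> measure ?P (\<Union>eh\<in>?G1. B1 eh) + measure ?P (\<Union>i\<in>{..<m}. B2 i)
      + measure ?P (\<Union>j\<in>J. B3 j) + measure ?P (\<Union>eh\<in>?G4. B4 eh)"
    unfolding B_def using sets_UN
    by (intro order_trans[OF measure_Un_le] add_right_mono sets.Un) auto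
  then have "measure ?P B
      \<le> (3 * 2 ^ 16) ^ (n + n) * (2 * exp (- (real (m * p) / (3840000 * q\<^sup>2))))
       + m * (2 * exp (- (p / (3840000 * q\<^sup>2))))
       + real (m * p) * (2 * exp (- (T\<^sup>2 / q)))
       + (3 * 2 ^ 16) ^ (m + n) * (2 * exp (- (real (m * p) * \<delta>\<^sup>2 / (81920000 * q * T\<^sup>2))))"
    using 1 2 3 4 by linarith
  then show thesis using sets_UN by (intro that[of B] good) (auto simp: B_def)
qed

end

text \<open>Since 3 * 2^16 <= 2^18 <= exp 18, a grid in dimension \<open>k\<close> costs 18 k in the
  exponent.\<close>

lemma power_times_exp_le:
  fixes a b :: real
  assumes "18 * real k + b \<le> a"
  shows "(3 * 2 ^ 16) ^ k * (2 * exp (- a)) \<le> 2 * exp (- b)"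
proof -
  have "(2 :: real) ^ 18 \<le> exp 1 ^ 18" using exp_ge_add_one_self[of 1] by (intro power_mono) auto
  then have "(3 * 2 ^ 16 :: real) \<le> exp 18" by (simp flip: exp_of_nat_mult)
  then have "(3 * 2 ^ 16 :: real) ^ k \<le> exp 18 ^ k" by (intro power_mono) auto
  also have "\<dots> = exp (18 * real k)" by (simp add: mult.commute flip: exp_of_nat_mult)
  finally have "(3 * 2 ^ 16) ^ k * (2 * exp (- a)) \<le> exp (18 * real k) * (2 * exp (- a))"
    by (intro mult_right_mono) auto
  also have "\<dots> = 2 * exp (18 * real k - a)" by (simp add: exp_diff exp_minus field_simps)
  also have "\<dots> \<le> 2 * exp (- b)" using assms by simp
  finally show ?thesis .
qed

section \<open>Numerical constants of the sample size\<close>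

context subgaussian_design
begin

text \<open>Each of the four summands is brought below 2 exp(-t log(mp)). The last one is the most
  demanding: it needs 19 * 327680000 <= 10^10, and the constant is twice 10^10 because the spare
  logarithm is only known to be at least 1/2.\<close>

lemma prob_not_good_sample_le:
  fixes t \<delta> :: real and n m p :: nat
  assumes n: "0 < n" and m: "0 < m" and p: "0 < p" and N: "2 \<le> m * p"
    and \<delta>: "0 < \<delta>" "\<delta> \<le> 1 / 4" and t: "1 \<le> t" and x: "0 < sqnorm_n n x"
    and hn: "t * ln (real (m * p)) \<le> real n"
    and hN: "real (m * p) \<ge> 20000000000 * q\<^sup>2 * t * \<delta> powr (-2) * real (n + m)
       * (ln (real (m * (p + n))))\<^sup>2 * ln (1 / \<delta>)"
  obtains B where "B \<in> sets (sample_space D n m p)"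
    "\<And>\<omega>. \<omega> \<in> space (sample_space D n m p) - B \<Longrightarrow> good_sample n m p x \<delta> \<omega>"
    "measure (sample_space D n m p) B \<le> 8 * real (m * p) powr (- t)"
proof -
  define M where "M = real (m * p)"
  define lam where "lam = ln M"
  define L where "L = ln (real (m * (p + n)))"
  define Q where "Q = q\<^sup>2"
  define T where "T = sqrt (4 * q * t * lam)"
    \<comment> \<open>large enough for the tails of all rows and the truncation bias to be powers of \<open>1 / M\<close>\<close>
  have q: "1 \<le> q" "0 < q" using q_ge_1 by auto
  have Q: "1 \<le> Q" "q \<le> Q" "Q > 0"
    using q mult_left_mono[OF q(1), of q] power_mono[of 1 q 2] by (auto simp: Q_def power2_eq_square)
  have M: "2 \<le> M" using N unfolding M_def by (metis of_nat_le_iff of_nat_numeral)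
  have half: "1 / 2 \<le> ln (2 :: real)" using ln2_ge_two_thirds by simp
  have "ln 2 \<le> lam" unfolding lam_def using M by (intro ln_mono) auto
  then have lam: "1 / 2 \<le> lam" using half by linarith
  have explam: "exp lam = M" using M by (simp add: lam_def)
  have lamL: "lam \<le> L"
  proof -
    have "M \<le> real (m * (p + n))" unfolding M_def by (intro of_nat_mono) simp
    then show ?thesis using M by (simp add: lam_def L_def)
  qed
  have tlam: "lam \<le> t * lam" "t * lam \<le> n" using t lam hn mult_right_mono[OF t, of lam] by (auto simp: lam_def M_def)
  have L2: "L / 2 \<le> L\<^sup>2" "1 / 4 \<le> L\<^sup>2"
  proof -
    show "L / 2 \<le> L\<^sup>2" using lam lamL mult_left_mono[of "1 / 2" L L] by (simp add: power2_eq_square)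
    then show "1 / 4 \<le> L\<^sup>2" using lam lamL by linarith
  qed
  define Z where "Z = 20000000000 * Q * (t * (real (n + m) * L\<^sup>2))"
  have Z0: "0 \<le> Z" using Q t by (simp add: Z_def)
  have MZ: "Z \<le> M * \<delta>\<^sup>2"
  proof -
    \<comment> \<open>\<delta> <= 1/4 < 1/exp 1 bounds this factor below by 1.\<close>
    have "1 \<le> ln (1 / \<delta>)"
    proof -
      have "exp 1 \<le> 1 / \<delta>" using mult_mono[OF \<delta>(2) exp_le] \<delta> by (simp add: field_simps)
      then have "ln (exp 1) \<le> ln (1 / \<delta>)" by (intro ln_mono) auto
      then show ?thesis by simp
    qed
    then have "Z * 1 \<le> Z * ln (1 / \<delta>)" using Z0 by (intro mult_left_mono)
    also have "\<dots> = (20000000000 * q\<^sup>2 * t * \<delta> powr (-2) * real (n + m) * (ln (real (m * (p + n))))\<^sup>2 * ln (1 / \<delta>)) * \<delta>\<^sup>2"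
      using \<delta> by (simp add: Z_def Q_def L_def powr_minus powr_numeral field_simps)
    also have "\<dots> \<le> M * \<delta>\<^sup>2" using hN unfolding M_def by (intro mult_right_mono) auto
    finally show ?thesis by simp
  qed
  have "\<delta>\<^sup>2 \<le> \<delta> / 4" using mult_left_mono[OF \<delta>(2), of \<delta>] \<delta> by (simp add: power2_eq_square)
  then have \<delta>2: "\<delta>\<^sup>2 \<le> 1" "\<delta>\<^sup>2 \<le> \<delta> / 4" using \<delta> by linarith+
  have MZ': "Z \<le> M"
    using MZ mult_left_mono[OF \<delta>2(1), of M] M by linarith
  have nZ: "568320000 * Q * n \<le> Z" "20000000000 * Q * ((t * lam) * (n + m)) * L \<le> Z"
  proof -
    have "real n * (1 / 4) \<le> t * real (n + m) * L\<^sup>2"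
      using t L2 by (intro mult_mono) (auto intro: order_trans[OF _ mult_right_mono[OF t]])
    then have "20000000000 * Q * (real n * (1 / 4)) \<le> Z"
      unfolding Z_def mult.assoc[of t] using Q by (intro mult_left_mono) auto
    moreover have "0 \<le> Q * real n" using Q by simp
    ultimately show "568320000 * Q * n \<le> Z" by simp
    \<comment> \<open>One of the two logarithms in L^2 is set aside for the squared truncation
      level, which is proportional to log(mp).\<close>
    have "lam * L \<le> L\<^sup>2" using lamL lam by (simp add: power2_eq_square)
    then have "t * (real (n + m) * (lam * L)) \<le> t * (real (n + m) * L\<^sup>2)" using t by (intro mult_left_mono) auto
    then have "20000000000 * Q * (t * (real (n + m) * (lam * L))) \<le> Z"
      unfolding Z_def by (rule mult_left_mono) (use Q in simp)
    then show "20000000000 * Q * ((t * lam) * (n + m)) * L \<le> Z" by (simp add: mult_ac)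
  qed
  have T2: "T\<^sup>2 = 4 * q * (t * lam)" "0 < T" using q t lam by (auto simp: T_def)
  have bias: "4 * q * exp (- (T\<^sup>2) / (2 * q)) \<le> \<delta> / 400"
  proof -
    have "- (T\<^sup>2) / (2 * q) = - (2 * (t * lam))" using q by (simp add: T2)
    also have "\<dots> \<le> - lam" using tlam lam by simp
    finally have "exp (- (T\<^sup>2) / (2 * q)) \<le> exp (- lam)" by (simp only: exp_le_cancel_iff)
    then have "exp (- (T\<^sup>2) / (2 * q)) \<le> 1 / M" by (simp only: exp_minus explam inverse_eq_divide)
    then have "4 * q * exp (- (T\<^sup>2) / (2 * q)) \<le> 4 * q * (1 / M)" using q by (intro mult_left_mono) auto
    also have "\<dots> \<le> \<delta> / 400"
    proof -
      have "1600 * q \<le> Z"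
      proof -
        have "1600 * q * 1 \<le> (568320000 * Q) * n"
          using Q q n by (intro mult_mono) auto
        then show ?thesis using nZ by linarith
      qed
      also have "Z \<le> M * \<delta>\<^sup>2" by (rule MZ)
      also have "\<dots> \<le> M * \<delta>" using \<delta>2 \<delta> M by (intro mult_left_mono) auto
      finally show ?thesis using M by (simp add: field_simps)
    qed
    finally show ?thesis .
  qed
  obtain B where B: "B \<in> sets (sample_space D n m p)"
    "\<And>\<omega>. \<omega> \<in> space (sample_space D n m p) - B \<Longrightarrow> good_sample n m p x \<delta> \<omega>"
    "measure (sample_space D n m p) B
      \<le> (3 * 2 ^ 16) ^ (n + n) * (2 * exp (- (real (m * p) / (3840000 * q\<^sup>2))))
       + m * (2 * exp (- (p / (3840000 * q\<^sup>2))))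
       + real (m * p) * (2 * exp (- (T\<^sup>2 / q)))
       + (3 * 2 ^ 16) ^ (m + n) * (2 * exp (- (real (m * p) * \<delta>\<^sup>2 / (81920000 * q * T\<^sup>2))))"
    by (rule prob_not_good_sample[OF n m p T2(2) \<delta>(1) x bias]) (rule that)
  have 1: "(3 * 2 ^ 16) ^ (n + n) * (2 * exp (- (real (m * p) / (3840000 * q\<^sup>2)))) \<le> 2 * exp (- (t * lam))"
  proof (rule power_times_exp_le)
    \<comment> \<open>18 * 2n for the pair of grids and n for the failure exponent make 37
      n.\<close>
    have "(3840000 * Q) * (18 * real (n + n) + t * lam) \<le> (3840000 * Q) * (37 * n)"
      using tlam Q by (intro mult_left_mono) auto
    also have "\<dots> \<le> 568320000 * Q * n" using mult_nonneg_nonneg[of Q "real n"] Q by simp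
    also have "\<dots> \<le> M" using nZ MZ' by linarith
    finally show "18 * real (n + n) + t * lam \<le> real (m * p) / (3840000 * q\<^sup>2)"
      using Q by (simp add: M_def Q_def[symmetric] field_simps)
  qed
  have 2: "m * (2 * exp (- (p / (3840000 * q\<^sup>2)))) \<le> 2 * exp (- (t * lam))"
  proof -
    \<comment> \<open>A single block has just p rows. Keeping only the m in n + m and cancelling it
      turns the sample size into a lower bound on p alone.\<close>
    have "real m * (20000000000 * Q * (t * L\<^sup>2)) \<le> real m * p"
    proof -
      have "real m * (20000000000 * Q * (t * L\<^sup>2)) = 20000000000 * Q * (t * (real m * L\<^sup>2))" by (simp add: mult_ac)
      also have "\<dots> \<le> Z" unfolding Z_def using Q t by (intro mult_left_mono mult_right_mono) auto
      finally show ?thesis using MZ' by (simp add: M_def)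
    qed
    then have pZ: "20000000000 * Q * (t * L\<^sup>2) \<le> p" using m by simp
    have "lam + t * lam \<le> 2 * (t * lam)" using tlam by linarith
    also have "\<dots> \<le> 2 * (t * (2 * L\<^sup>2))" using lamL L2 t by (intro mult_left_mono) auto
    finally have "(3840000 * Q) * (lam + t * lam) \<le> (3840000 * Q) * (2 * (t * (2 * L\<^sup>2)))"
      using Q by (intro mult_left_mono) auto
    also have "\<dots> \<le> 20000000000 * Q * (t * L\<^sup>2)"
      using Q t mult_nonneg_nonneg[of Q "t * L\<^sup>2"] by (simp add: mult_ac)
    also note pZ
    finally have le: "lam + t * lam \<le> p / (3840000 * q\<^sup>2)"
      using Q by (simp add: Q_def[symmetric] field_simps)
    have "real m \<le> exp lam"
    proof -
      have "real m * 1 \<le> real m * p" using p by (intro mult_left_mono) auto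
      then show ?thesis by (simp add: explam M_def)
    qed
    then have "m * (2 * exp (- (p / (3840000 * q\<^sup>2)))) \<le> exp lam * (2 * exp (- (lam + t * lam)))"
      using le by (intro mult_mono) auto
    also have "\<dots> = 2 * exp (- (t * lam))" by (simp flip: exp_add)
    finally show ?thesis .
  qed
  have 3: "real (m * p) * (2 * exp (- (T\<^sup>2 / q))) \<le> 2 * exp (- (t * lam))"
  proof -
    have "real (m * p) * (2 * exp (- (T\<^sup>2 / q))) = 2 * exp (lam - 4 * (t * lam))"
      using q explam by (simp add: T2 exp_diff exp_minus M_def field_simps)
    also have "\<dots> \<le> 2 * exp (- (t * lam))" using tlam lam by simp
    finally show ?thesis .
  qed
  have 4: "(3 * 2 ^ 16) ^ (m + n) * (2 * exp (- (real (m * p) * \<delta>\<^sup>2 / (81920000 * q * T\<^sup>2)))) \<le> 2 * exp (- (t * lam))"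
  proof (rule power_times_exp_le)
    have tl: "0 < t * lam" using t lam by simp
    have "(327680000 * Q * (t * lam)) * (18 * real (m + n) + t * lam) \<le> (327680000 * Q * (t * lam)) * (19 * (n + m))"
      using tlam Q tl by (intro mult_left_mono) auto
    also have "\<dots> \<le> 20000000000 * Q * ((t * lam) * (n + m)) * (1 / 2)"
    proof -
      define W where "W = Q * ((t * lam) * real (n + m))"
      have "0 \<le> W" using Q tl by (simp add: W_def)
      moreover have "(327680000 * Q * (t * lam)) * (19 * (n + m)) = 6225920000 * W"
        "20000000000 * Q * ((t * lam) * (n + m)) * (1 / 2) = 10000000000 * W"
        by (simp_all add: W_def algebra_simps)
      ultimately show ?thesis by linarith
    qed
    also have "\<dots> \<le> 20000000000 * Q * ((t * lam) * (n + m)) * L"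
      using Q tl lam lamL by (intro mult_left_mono) auto
    also have "\<dots> \<le> M * \<delta>\<^sup>2" using nZ MZ by linarith
    finally have "18 * real (m + n) + t * lam \<le> M * \<delta>\<^sup>2 / (327680000 * Q * (t * lam))"
      using Q tl by (simp add: pos_le_divide_eq mult.commute)
    also have "327680000 * Q * (t * lam) = 81920000 * q * T\<^sup>2"
      unfolding T2(1) Q_def by (simp add: power2_eq_square)
    finally show "18 * real (m + n) + t * lam \<le> real (m * p) * \<delta>\<^sup>2 / (81920000 * q * T\<^sup>2)"
      by (simp add: M_def)
  qed
  have "exp (- (t * lam)) = real (m * p) powr (- t)"
    using m p by (simp add: powr_def lam_def M_def)
  then have le: "measure (sample_space D n m p) B \<le> 8 * real (m * p) powr (- t)"
    using B(3) 1 2 3 4 by linarith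
  show thesis by (rule that[OF B(1) _ le]) (rule B(2))
qed

end

section \<open>From the psi_2 norm to the locale\<close>

lemma one_le_if_in_psi2_set:
  assumes "prob_space D" "sets D = sets borel" "integrable D (\<lambda>u. u\<^sup>2)" "(\<integral>u. u\<^sup>2 \<partial>D) = (1 :: real)" "k \<in> psi2_set D"
  shows "1 \<le> k"
proof -
  interpret prob_space D by fact
  have k: "k > 0" "integrable D (\<lambda>u. exp (u\<^sup>2 / k\<^sup>2))" "(\<integral>u. exp (u\<^sup>2 / k\<^sup>2) \<partial>D) \<le> 2"
    using assms(5) by (auto simp: psi2_set_def)
  \<comment> \<open>The linear lower bound of exp sees only the second moment, which is 1, and gives
    1 + 1/k^2 <= 2.\<close>
  have "(\<integral>u. 1 + u\<^sup>2 / k\<^sup>2 \<partial>D) \<le> (\<integral>u. exp (u\<^sup>2 / k\<^sup>2) \<partial>D)"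
    using assms(3) k(2) by (intro integral_mono) (auto intro: exp_ge_add_one_self)
  moreover have "(\<integral>u. 1 + u\<^sup>2 / k\<^sup>2 \<partial>D) = 1 + 1 / k\<^sup>2" using assms(3,4) by (simp add: prob_space)
  ultimately have "1 / k\<^sup>2 \<le> 1" using k(3) by linarith
  then have "1 \<le> k\<^sup>2" using k(1) by (simp add: field_simps)
  then show ?thesis using k(1) power2_le_imp_le[of 1 k] by simp
qed

text \<open>Doubling leaves room for some \<open>k\<close> in \<open>psi2_set\<close>, so that
  attainment of the infimum is not an issue. The \<open>max\<close> keeps the final constants
  positive for any real \<alpha> fixed in advance.\<close>

lemma subgaussian_design_if_psi2_norm:
  assumes "prob_space D" "sets D = sets borel" "psi2_set D \<noteq> {}"
    and mean: "integrable D (\<lambda>u. u)" "(\<integral>u. u \<partial>D) = 0"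
    and var: "integrable D (\<lambda>u. u\<^sup>2)" "(\<integral>u. u\<^sup>2 \<partial>D) = (1 :: real)"
  shows "subgaussian_design D (2 * max (psi2_norm D) 1)"
proof -
  have ge1: "1 \<le> psi2_norm D"
    unfolding psi2_norm_def using assms one_le_if_in_psi2_set by (intro cInf_greatest) auto
  then have "psi2_norm D < 2 * psi2_norm D" by simp
  then obtain k where k: "k \<in> psi2_set D" "k < 2 * psi2_norm D"
    unfolding psi2_norm_def using cInf_lessD[OF assms(3)] by blast
  let ?K = "2 * max (psi2_norm D) 1"
  have kK: "0 < k" "k \<le> ?K" using k one_le_if_in_psi2_set[OF assms(1,2) var k(1)] by auto
  have ik: "integrable D (\<lambda>u. exp (u\<^sup>2 / k\<^sup>2))" "(\<integral>u. exp (u\<^sup>2 / k\<^sup>2) \<partial>D) \<le> 2"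
    using k(1) by (auto simp: psi2_set_def)
  have "(\<integral>\<^sup>+u. ennreal (exp (u\<^sup>2 / ?K\<^sup>2)) \<partial>D) \<le> (\<integral>\<^sup>+u. ennreal (exp (u\<^sup>2 / k\<^sup>2)) \<partial>D)"
  proof (intro nn_integral_mono ennreal_leI)
    fix u
    have "k\<^sup>2 \<le> ?K\<^sup>2" using kK by (intro power_mono) auto
    then have "u\<^sup>2 / ?K\<^sup>2 \<le> u\<^sup>2 / k\<^sup>2" using kK by (intro divide_left_mono mult_pos_pos) auto
    then show "exp (u\<^sup>2 / ?K\<^sup>2) \<le> exp (u\<^sup>2 / k\<^sup>2)" by simp
  qed
  also have "\<dots> = ennreal (\<integral>u. exp (u\<^sup>2 / k\<^sup>2) \<partial>D)"
    using ik(1) by (intro nn_integral_eq_integral) auto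
  also have "\<dots> \<le> ennreal 2" using ik(2) by (rule ennreal_leI)
  finally have "(\<integral>\<^sup>+u. ennreal (exp (u\<^sup>2 / ?K\<^sup>2)) \<partial>D) \<le> ennreal 2" .
  moreover have "1 \<le> ?K" by simp
  ultimately show ?thesis
    unfolding subgaussian_design_def random_design_def random_design_axioms_def subgaussian_design_axioms_def
    using assms by blast
qed

lemma pgd_success_probability:
  fixes D :: "real measure" and n m p :: nat and x g :: "nat \<Rightarrow> real" and \<rho> \<delta> t \<mu> :: real
  defines "Q \<equiv> 128 * (2 * max (psi2_norm D) 1)\<^sup>2"
  assumes D: "prob_space D" "sets D = sets borel" "psi2_set D \<noteq> {}"
      "integrable D (\<lambda>u. u)" "(\<integral>u. u \<partial>D) = 0" "integrable D (\<lambda>u. u\<^sup>2)" "(\<integral>u. u\<^sup>2 \<partial>D) = 1"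
    and m: "m \<ge> 1" and p: "p \<ge> 1" and x: "\<exists>k<n. x k \<noteq> 0" and g: "g \<in> G_set m \<rho>"
    and \<delta>: "0 < \<delta>" and t: "t \<ge> 1"
    and hn: "real n \<ge> t * ln (real (m * p))"
    and hN: "real (m * p) \<ge> 20000000000 * Q\<^sup>2 * t * \<delta> powr (-2) * real (n + m) * (ln (real (m * (p + n))))\<^sup>2 * ln (1 / \<delta>)"
    and \<rho>: "\<rho> < (1 - 4 * \<delta>) / 31"
    and \<mu>: "0 < \<mu>" "\<mu> < 1 / 25 * (1 - 4 * \<delta> - 31 * \<rho>) / real m"
  shows "measure (sample_space D n m p)
        {\<omega> \<in> space (sample_space D n m p).
           (\<forall>j. Delta n m x g (pgd n m p \<omega> g x \<rho> \<mu> j)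
                  \<le> (1 - (1 - 4 * \<delta> - 31 * \<rho>) * \<mu>) ^ j * (\<delta>\<^sup>2 + \<rho>\<^sup>2) * sqnorm_n n x) \<and>
           ((\<lambda>j. Delta n m x g (pgd n m p \<omega> g x \<rho> \<mu> j)) \<longlonglongrightarrow> 0)}
      > 1 - 9 * real (m * p) powr (-t)" (is "measure ?P ?S > _")
proof (cases "m * p = 1")
  case True
  \<comment> \<open>For a single measurement the logarithm of mp vanishes, but the claimed bound is
    negative.\<close>
  have "1 - 9 * real (m * p) powr (-t) < 0" unfolding True by simp
  then show ?thesis using measure_nonneg[of ?P ?S] by linarith
next
  case False
  interpret subgaussian_design D "2 * max (psi2_norm D) 1"
    by (rule subgaussian_design_if_psi2_norm[OF D])
  interpret P: prob_space ?P by (rule prob_space_sample_space)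
  have Q: "Q = q" by (simp only: Q_def q_def)
  have pos: "0 < n" "0 < m" "0 < p" using x m p by auto
  have N: "2 \<le> m * p" using False m p by (cases "m * p") auto
  \<comment> \<open>Membership of \<open>g\<close> with m >= 1 forces \<rho> >= 0, and the bound on
    \<rho> then gives \<delta> <= 1/4.\<close>
  have "0 \<le> \<bar>g 0 - 1\<bar>" by simp
  also have "\<dots> \<le> \<rho>" using g pos by (auto simp: G_set_def)
  finally have \<rho>0: "0 \<le> \<rho>" .
  have \<rho>\<delta>: "4 * \<delta> + 31 * \<rho> < 1" using \<rho> by simp
  have \<delta>4: "\<delta> \<le> 1 / 4" using \<rho>0 \<rho>\<delta> by simp
  have X: "0 < sqnorm_n n x" using x unfolding sqnorm_n_def by (auto intro: sum_pos2)
  have \<mu>m: "25 * real m * \<mu> \<le> 1"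
  proof -
    \<comment> \<open>The factor 1/25 in the step size is chosen for this: \<eta> = 1 - 4\<delta> -
      31\<rho> is below 1.\<close>
    have "25 * real m * \<mu> \<le> 1 - 4 * \<delta> - 31 * \<rho>" using \<mu>(2) pos by (simp add: field_simps)
    then show ?thesis using \<delta> \<rho>0 by linarith
  qed
  obtain B where B: "B \<in> sets ?P" "\<And>\<omega>. \<omega> \<in> space ?P - B \<Longrightarrow> good_sample n m p x \<delta> \<omega>"
    "measure ?P B \<le> 8 * real (m * p) powr (- t)"
    using prob_not_good_sample_le[OF pos N \<delta> \<delta>4 t X hn hN[unfolded Q]] by blast
  \<comment> \<open>The geometric bound already implies convergence, so measurability is settled by
    the first conjunct.\<close>
  have "?S = {\<omega> \<in> space ?P. \<forall>j. Delta n m x g (pgd n m p \<omega> g x \<rho> \<mu> j)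
      \<le> (1 - (1 - 4 * \<delta> - 31 * \<rho>) * \<mu>) ^ j * (\<delta>\<^sup>2 + \<rho>\<^sup>2) * sqnorm_n n x}"
    using Delta_tendsto_zero[OF m \<rho>0 \<delta> \<rho>\<delta> \<mu>(1) \<mu>m] by blast
  then have S: "?S \<in> sets ?P" using sets_Delta_bounded[OF D(2) \<rho>0] by simp
  have "space ?P - B \<subseteq> ?S"
    using pgd_linear_convergence(1)[OF m p B(2) g \<rho>0 \<delta> \<rho>\<delta> X \<mu>(1) \<mu>m]
      Delta_tendsto_zero[OF m \<rho>0 \<delta> \<rho>\<delta> \<mu>(1) \<mu>m] by blast
  then have "measure ?P (space ?P - B) \<le> measure ?P ?S" by (intro P.finite_measure_mono S)
  moreover have "measure ?P (space ?P - B) = 1 - measure ?P B" by (rule P.prob_compl[OF B(1)])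
  \<comment> \<open>The constant 9 in place of 8 makes the final inequality strict.\<close>
  moreover have "0 < real (m * p) powr (- t)" using pos by simp
  ultimately show ?thesis using B(3) by linarith
qed

theorem mainTheorem7:
  shows "\<exists>c>0. \<forall>c0>0. \<forall>\<alpha>::real. \<exists>C1>0. \<exists>C2>0. \<exists>C>0.
    \<forall>(D::real measure) (n::nat) (m::nat) (p::nat) (x::nat \<Rightarrow> real) (g::nat \<Rightarrow> real)
      (\<rho>::real) (\<delta>::real) (t::real) (\<mu>::real).
      prob_space D \<and> sets D = sets borel \<and>
      psi2_set D \<noteq> {} \<and> psi2_norm D = \<alpha> \<and>
      integrable D (\<lambda>u. u) \<and> (\<integral>u. u \<partial>D) = 0 \<and>
      integrable D (\<lambda>u. u\<^sup>2) \<and> (\<integral>u. u\<^sup>2 \<partial>D) = 1 \<and>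
      ((\<integral>u. u ^ 4 \<partial>D) = 1 \<longrightarrow>
          n > 1 \<and> (\<Sum>k<n. x k ^ 4) / (sqnorm_n n x)\<^sup>2 \<le> 1 - c0 / real n) \<and>
      m \<ge> 1 \<and> p \<ge> 1 \<and> (\<exists>k<n. x k \<noteq> 0) \<and> g \<in> G_set m \<rho> \<and>
      0 < \<delta> \<and> \<delta> < 1 \<and> t \<ge> 1 \<and>
      real n \<ge> C1 * t * ln (real (m * p)) \<and>
      real (m * p) \<ge> C2 * t * \<delta> powr (-2) * real (n + m) * (ln (real (m * (p + n))))\<^sup>2 * ln (1 / \<delta>) \<and>
      \<rho> < (1 - 4 * \<delta>) / 31 \<and>
      0 < \<mu> \<and> \<mu> < c * (1 - 4 * \<delta> - 31 * \<rho>) / real m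
      \<longrightarrow>
      measure (sample_space D n m p)
        {\<omega> \<in> space (sample_space D n m p).
           (\<forall>j. Delta n m x g (pgd n m p \<omega> g x \<rho> \<mu> j)
                  \<le> (1 - (1 - 4 * \<delta> - 31 * \<rho>) * \<mu>) ^ j * (\<delta>\<^sup>2 + \<rho>\<^sup>2) * sqnorm_n n x) \<and>
           ((\<lambda>j. Delta n m x g (pgd n m p \<omega> g x \<rho> \<mu> j)) \<longlonglongrightarrow> 0)}
      > 1 - C * real (m * p) powr (-t)"
  apply (rule exI[of _ "1 / 25"], rule conjI, simp, intro allI impI)
  subgoal for c0 \<alpha>
    apply (rule exI[of _ 1], rule conjI, simp)
    \<comment> \<open>128 * (2 * max \<alpha> 1)^2 is the \<open>q\<close> of the locale when
      \<open>psi2_norm D\<close> is \<alpha>, so the constant depends on \<alpha> alone.\<close>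
    apply (rule exI[of _ "20000000000 * (128 * (2 * max \<alpha> 1)\<^sup>2)\<^sup>2"], rule conjI, simp)
    apply (rule exI[of _ 9], rule conjI, simp)
    apply (intro allI impI, elim conjE)
    apply (rule pgd_success_probability)
    by (simp_all only: mult_1 not_False_eq_True)
  done

end
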